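(* Let $S\subset\mathbb{R}^n$ be a semialgebraic set with interior $S^\circ$, and let $I\subset\mathbb{R}[x]=\mathbb{R}[x_1,\dots,x_n]$ be an ideal with prime decomposition $I=I_1\cap\cdots\cap I_k$. Suppose $S^\circ\cap\mathcal{V}(I)\neq\emptyset$. Then the following are equivalent: (i) $\mathcal{I}(S^\circ\cap\mathcal{V}(I))=I$; (ii) for every $t$ with $1\le t\le k$ there exists $x^t\in\mathcal{V}(I_t)\cap S^\circ$ such that $\operatorname{rank}_{x^t}I_t=n-\dim I_t$; (iii) for every $t$ with $1\le t\le k$, $\dim^{\mathrm{top}}(\mathcal{V}(I_t)\cap S^\circ)=\dim I_t$.
   Context: A semialgebraic set in $\mathbb{R}^n$ is a finite union of sets of the form $\bigcap_j\{x: g_j(x)*_j0\}$ with $g_j\in\mathbb{R}[x]$ and $*_j\in\{>,\ge,=\}$. For an ideal $J\subset\mathbb{R}[x]$, $\mathcal{V}(J)=\{x\in\mathbb{R}^n:p(x)=0\ \forall p\in J\}$; for $A\subset\mathbb{R}^n$, $\mathcal{I}(A)=\{p\in\mathbb{R}[x]:p|_A=0\}$. "Prime decomposition" means an irredundant expression of $I$ as an intersection of prime ideals $I_1,\dots,I_k$. $\dim I_t$ is the Krull dimension of $\mathbb{R}[x]/I_t$ (transcendence degree of its fraction field). For $I_t=\langle f_1,\dots,f_m\rangle$ and $x\in\mathcal{V}(I_t)$, $\operatorname{rank}_xI_t$ is the rank of the Jacobian matrix $\frac{\partial(f_1,\dots,f_m)}{\partial(x_1,\dots,x_n)}(x)$.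 $\dim^{\mathrm{top}}$ is the topological dimension, i.e. the maximal dimension of a manifold contained in the set, with $\dim^{\mathrm{top}}\emptyset=-1$. *)

theory Defs
  imports "HOL-Analysis.Analysis" "HOL-Library.Poly_Mapping"
begin

text \<open>Real polynomials in the variables x_i, i ranging over the finite index type 'n
  (so n = CARD('n)), represented as finitely supported maps from monomials
  (exponent vectors 'n =>0 nat) to real coefficients. This is a commutative ring.\<close>

type_synonym 'n mpoly = "('n \<Rightarrow>\<^sub>0 nat) \<Rightarrow>\<^sub>0 real"

definition peval :: "'n::finite mpoly \<Rightarrow> real^'n \<Rightarrow> real" where
  "peval p x = (\<Sum>mon\<in>Poly_Mapping.keys p. Poly_Mapping.lookup p mon * (\<Prod>i\<in>UNIV. (x $ i) ^ Poly_Mapping.lookup (mon :: 'n \<Rightarrow>\<^sub>0 nat) i))"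

definition is_ideal :: "'a::comm_ring_1 set \<Rightarrow> bool" where
  "is_ideal J \<longleftrightarrow> 0 \<in> J \<and> (\<forall>a\<in>J. \<forall>b\<in>J. a + b \<in> J) \<and> (\<forall>a\<in>J. \<forall>r. r * a \<in> J)"

definition prime_ideal :: "'a::comm_ring_1 set \<Rightarrow> bool" where
  "prime_ideal P \<longleftrightarrow> is_ideal P \<and> P \<noteq> UNIV \<and> (\<forall>a b. a * b \<in> P \<longrightarrow> a \<in> P \<or> b \<in> P)"

definition ideal_gen :: "'a::comm_ring_1 set \<Rightarrow> 'a set" where
  "ideal_gen G = \<Inter> {J. is_ideal J \<and> G \<subseteq> J}"

definition prime_decomposition :: "'a::comm_ring_1 set \<Rightarrow> nat \<Rightarrow> (nat \<Rightarrow> 'a set) \<Rightarrow> bool" where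
  "prime_decomposition I k Is \<longleftrightarrow>
     (\<forall>t\<in>{1..k}. prime_ideal (Is t)) \<and>
     I = (\<Inter>t\<in>{1..k}. Is t) \<and>
     (\<forall>t\<in>{1..k}. (\<Inter>s\<in>{1..k} - {t}. Is s) \<noteq> I)"

definition krull_dim :: "'a::comm_ring_1 set \<Rightarrow> nat" where
  "krull_dim P = Sup {d. \<exists>Q :: nat \<Rightarrow> 'a set. (\<forall>i\<le>d. prime_ideal (Q i)) \<and> P \<subseteq> Q 0 \<and>
                        (\<forall>i<d. Q i \<subset> Q (Suc i))}"

definition zero_set :: "'n::finite mpoly set \<Rightarrow> (real^'n) set" where
  "zero_set J = {x. \<forall>p\<in>J. peval p x = 0}"

definition vanishing_ideal :: "(real^'n::finite) set \<Rightarrow> 'n mpoly set" where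
  "vanishing_ideal A = {p. \<forall>x\<in>A. peval p x = 0}"

datatype sign_rel = Gt | Ge | Eq

fun sign_holds :: "sign_rel \<Rightarrow> real \<Rightarrow> bool" where
  "sign_holds Gt v \<longleftrightarrow> v > 0"
| "sign_holds Ge v \<longleftrightarrow> v \<ge> 0"
| "sign_holds Eq v \<longleftrightarrow> v = 0"

definition semialgebraic :: "(real^'n::finite) set \<Rightarrow> bool" where
  "semialgebraic S \<longleftrightarrow> (\<exists>css :: ('n mpoly \<times> sign_rel) list list.
      S = (\<Union>cs\<in>set css. {x. \<forall>(g, r)\<in>set cs. sign_holds r (peval g x)}))"

definition pgrad :: "'n::finite mpoly \<Rightarrow> real^'n \<Rightarrow> real^'n" where
  "pgrad f x = (\<chi> i. deriv (\<lambda>s. peval f (x + s *\<^sub>R axis i 1)) 0)"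

definition jacobian_rank :: "'n::finite mpoly list \<Rightarrow> real^'n \<Rightarrow> nat" where
  "jacobian_rank fs x = dim (span ((\<lambda>f. pgrad f x) ` set fs))"

text \<open>Topological manifolds of dimension d in R^n: every point has a neighbourhood
  (open in M) homeomorphic to an open subset of R^d, realised as a d-dimensional
  linear subspace of R^n.\<close>
definition is_manifold :: "nat \<Rightarrow> (real^'n::finite) set \<Rightarrow> bool" where
  "is_manifold d M \<longleftrightarrow> (\<forall>x\<in>M. \<exists>V U L. x \<in> V \<and> openin (top_of_set M) V \<and>
       subspace (L :: (real^'n) set) \<and> dim L = d \<and> openin (top_of_set L) U \<and> V homeomorphic U)"

definition dim_top :: "(real^'n::finite) set \<Rightarrow> int" where
  "dim_top A = (if A = {} then -1
     else int (Sup {d. \<exists>M. M \<subseteq> A \<and> M \<noteq> {} \<and> is_manifold d M}))"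

end

theory Submission
  imports Defs
begin

text \<open>
  Irredundance of the decomposition reduces everything to a single prime \<open>P\<close> and an open set \<open>U\<close>.
  Let \<open>r\<close> be the maximal size of a set \<open>B\<close> of variables with \<open>P \<inter> \<real>[B] = 0\<close>. Counting monomials shows
  that every polynomial is algebraic over \<open>\<real>[B]\<close> modulo \<open>P\<close>, whence \<open>r\<close> is the Krull dimension.
  The derivations \<open>\<partial>/\<partial>x\<^sub>b\<close>, \<open>b \<in> B\<close>, lift to polynomial vector fields that map \<open>P\<close> into itself, so the
  Jacobian has rank at most \<open>n - r\<close> on the zero set of \<open>P\<close>. At a real point where this rank is attained
  by \<open>f\<^sub>1, \<dots>, f\<^sub>n\<^sub>-\<^sub>r \<in> P\<close>, the fields tangent to \<open>f = 0\<close> also preserve \<open>P\<close>; along their integral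
  curves the generators of \<open>P\<close> solve a homogeneous linear differential equation and therefore vanish.
  Hence the zero set of \<open>P\<close> contains an \<open>r\<close>-dimensional graph over the remaining variables, which
  gives both the dimension and the vanishing ideal. Conversely, on a small piece of a manifold of
  dimension \<open>r\<close> inside the zero set, invariance of dimension forces \<open>r\<close> coordinates to be
  algebraically independent, so no polynomial outside \<open>P\<close> vanishes there; in particular some
  Jacobian minor of size \<open>n - r\<close> does not.
\<close>

section \<open>The polynomial ring\<close>

text \<open>The obstacle: elements \<open>f\<close> of \<open>P\<close> with a nonvanishing Jacobian
  minor cut out a graph that might be larger than the zero set of \<open>P\<close> near the point.
  Commutative algebra would say that \<open>f\<close> generates \<open>P\<close> in the local ring;
  here derivations do this work. They kill one relation per dependent variable, hence preserve the
  ideal \<open>J\<close> generated by these relations. \<open>P\<close> may be larger than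
  \<open>J\<close>, but counting modulo \<open>J\<close> gives, for each \<open>p\<close> in
  \<open>P\<close>, some \<open>s * p ^ N\<close> in \<open>J\<close> with \<open>s\<close> outside
  \<open>P\<close>; differentiation lowers \<open>N\<close> until \<open>P\<close> itself is seen to
  be preserved. This is why the counting is set up modulo an arbitrary ideal. The lower bound for
  the Krull dimension comes from cutting with hyperplanes x_b = \<nu>, one for each b in
  \<open>B\<close>, where \<nu> is chosen so that the rest of \<open>B\<close> stays independent. A
  recurring device is the constant term of a relation for a polynomial \<open>q\<close> over
  \<real>[B]: it vanishes wherever \<open>P\<close> and \<open>q\<close> do, yet it is a nonzero
  polynomial in independent variables.\<close>

definition mconst :: "real \<Rightarrow> 'n mpoly" where
  "mconst c = Poly_Mapping.single 0 c"

definition mvar :: "'n \<Rightarrow> 'n mpoly" where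
  "mvar i = Poly_Mapping.single (Poly_Mapping.single i 1) 1"

text \<open>The subring \<real>[B], kept inside one type for all \<open>B\<close>; for
  \<open>B = UNIV\<close> its induction rule becomes induction over all polynomials.\<close>

inductive_set polys_in :: "'n set \<Rightarrow> 'n mpoly set" for B where
  const [intro, simp]: "mconst c \<in> polys_in B"
| var [intro]: "i \<in> B \<Longrightarrow> mvar i \<in> polys_in B"
| add [intro]: "p \<in> polys_in B \<Longrightarrow> q \<in> polys_in B \<Longrightarrow> p + q \<in> polys_in B"
| mult [intro]: "p \<in> polys_in B \<Longrightarrow> q \<in> polys_in B \<Longrightarrow> p * q \<in> polys_in B"

lemma mconst_0 [simp]: "mconst 0 = 0"
  and mconst_1 [simp]: "mconst 1 = 1"
  by (simp_all add: mconst_def)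

lemma mconst_add: "mconst (a + b) = mconst a + mconst b"
  by (simp add: mconst_def single_add)

lemma mconst_mult: "mconst (a * b) = mconst a * mconst b"
  by (simp add: mconst_def mult_single)

lemma mconst_minus: "mconst (- a) = - mconst a"
  by (simp add: mconst_def single_uminus)

lemma mconst_of_nat: "mconst (of_nat k) = of_nat k"
  by (induction k) (auto simp: mconst_add)

lemma polys_in_0 [simp, intro]: "0 \<in> polys_in B"
  using polys_in.const[of 0] by simp

lemma polys_in_1 [simp, intro]: "1 \<in> polys_in B"
  using polys_in.const[of 1] by simp

lemma polys_in_of_nat [simp, intro]: "of_nat k \<in> polys_in B"
  using polys_in.const[of "of_nat k"] by (simp add: mconst_of_nat)

lemma polys_in_uminus [intro]: "p \<in> polys_in B \<Longrightarrow> - p \<in> polys_in B"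
  using polys_in.mult[of "mconst (-1)" B p, OF polys_in.const] by (simp add: mconst_minus)

lemma polys_in_diff [intro]: "p \<in> polys_in B \<Longrightarrow> q \<in> polys_in B \<Longrightarrow> p - q \<in> polys_in B"
  using polys_in.add[of p B "- q"] by auto

lemma polys_in_sum [intro]: "(\<And>i. i \<in> A \<Longrightarrow> f i \<in> polys_in B) \<Longrightarrow> sum f A \<in> polys_in B"
  by (induction A rule: infinite_finite_induct) auto

lemma polys_in_prod [intro]: "(\<And>i. i \<in> A \<Longrightarrow> f i \<in> polys_in B) \<Longrightarrow> prod f A \<in> polys_in B"
  by (induction A rule: infinite_finite_induct) auto

lemma polys_in_power [intro]: "p \<in> polys_in B \<Longrightarrow> p ^ k \<in> polys_in B"
  by (induction k) auto

lemma polys_in_mono: "p \<in> polys_in B \<Longrightarrow> B \<subseteq> B' \<Longrightarrow> p \<in> polys_in B'"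
  by (induction rule: polys_in.induct) auto

definition mono_poly :: "('n \<Rightarrow>\<^sub>0 nat) \<Rightarrow> 'n mpoly" where
  "mono_poly m = Poly_Mapping.single m 1"

lemma mono_poly_0 [simp]: "mono_poly 0 = 1"
  by (simp add: mono_poly_def)

lemma mono_poly_add: "mono_poly (m + m') = mono_poly m * mono_poly m'"
  by (simp add: mono_poly_def mult_single)

lemma mono_poly_sum: "mono_poly (sum f A) = (\<Prod>i\<in>A. mono_poly (f i))"
  by (induction A rule: infinite_finite_induct) (auto simp: mono_poly_add)

lemma mono_poly_single: "mono_poly (Poly_Mapping.single i k) = mvar i ^ k"
proof (induction k)
  case (Suc k)
  have "Poly_Mapping.single i (Suc k) = Poly_Mapping.single i 1 + Poly_Mapping.single i k"
    using single_add[of i 1 k] by simp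
  then have "mono_poly (Poly_Mapping.single i (Suc k)) = mono_poly (Poly_Mapping.single i 1) * mvar i ^ k"
    by (simp only: mono_poly_add Suc)
  then show ?case by (simp add: mono_poly_def mvar_def)
qed simp

lemma monomial_expand:
  fixes m :: "'n::finite \<Rightarrow>\<^sub>0 nat"
  shows "m = (\<Sum>i\<in>UNIV. Poly_Mapping.single i (Poly_Mapping.lookup m i))"
  by (rule poly_mapping_eqI) (simp add: lookup_sum lookup_single when_def)

lemma mono_poly_eq_prod:
  fixes m :: "'n::finite \<Rightarrow>\<^sub>0 nat"
  shows "mono_poly m = (\<Prod>i\<in>UNIV. mvar i ^ Poly_Mapping.lookup m i)"
  by (subst monomial_expand[of m]) (simp only: mono_poly_sum mono_poly_single)

lemma mpoly_expand:
  fixes p :: "'n mpoly"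
  shows "p = (\<Sum>m\<in>Poly_Mapping.keys p. mconst (Poly_Mapping.lookup p m) * mono_poly m)"
proof (rule poly_mapping_eqI)
  fix k
  have "Poly_Mapping.lookup (\<Sum>m\<in>Poly_Mapping.keys p. mconst (Poly_Mapping.lookup p m) * mono_poly m) k
    = (\<Sum>m\<in>Poly_Mapping.keys p. if m = k then Poly_Mapping.lookup p m else 0)"
    unfolding lookup_sum by (intro sum.cong) (auto simp: mconst_def mono_poly_def mult_single lookup_single when_def)
  then show "Poly_Mapping.lookup p k = Poly_Mapping.lookup (\<Sum>m\<in>Poly_Mapping.keys p. mconst (Poly_Mapping.lookup p m) * mono_poly m) k"
    by (simp add: in_keys_iff)
qed

lemma mono_poly_in:
  fixes m :: "'n::finite \<Rightarrow>\<^sub>0 nat"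
  assumes "\<And>i. i \<notin> B \<Longrightarrow> Poly_Mapping.lookup m i = 0"
  shows "mono_poly m \<in> polys_in B"
  unfolding mono_poly_eq_prod
proof (intro polys_in_prod)
  fix i show "mvar i ^ Poly_Mapping.lookup m i \<in> polys_in B"
    by (cases "i \<in> B") (auto simp: assms)
qed

lemma polys_in_UNIV [simp, intro]: "(p :: 'n::finite mpoly) \<in> polys_in UNIV"
  by (subst mpoly_expand) (intro polys_in_sum polys_in.mult polys_in.const mono_poly_in; simp)

lemma mpoly_induct [case_names const var add mult]:
  fixes p :: "'n::finite mpoly"
  assumes "\<And>c. Q (mconst c)" "\<And>i. Q (mvar i)" "\<And>p q. Q p \<Longrightarrow> Q q \<Longrightarrow> Q (p + q)"
    "\<And>p q. Q p \<Longrightarrow> Q q \<Longrightarrow> Q (p * q)"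
  shows "Q p"
  using polys_in_UNIV[of p] by (induction rule: polys_in.induct) (use assms in auto)

lemma polys_in_keys:
  assumes "p \<in> polys_in B" "m \<in> Poly_Mapping.keys p" "i \<notin> B"
  shows "Poly_Mapping.lookup m i = 0"
  using assms
proof (induction arbitrary: m rule: polys_in.induct)
  case (const c)
  then show ?case by (auto simp: mconst_def split: if_splits)
next
  case (var j)
  then show ?case by (auto simp: mvar_def lookup_single when_def)
next
  case (add p q)
  then show ?case using keys_add[of p q] by blast
next
  case (mult p q)
  from mult.prems(1) keys_mult[of p q] obtain a b where "m = a + b" "a \<in> Poly_Mapping.keys p" "b \<in> Poly_Mapping.keys q"
    by blast
  with mult show ?case by (simp add: lookup_add)
qed

subsection \<open>Evaluation\<close>

lemma peval_superset:
  assumes "finite K" "Poly_Mapping.keys p \<subseteq> K"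
  shows "peval p x = (\<Sum>m\<in>K. Poly_Mapping.lookup p m * (\<Prod>i\<in>UNIV. (x $ i) ^ Poly_Mapping.lookup m i))"
  unfolding peval_def using assms by (intro sum.mono_neutral_left) (auto simp: in_keys_iff)

lemma peval_add [simp]: "peval (p + q) x = peval p x + peval q x"
proof -
  let ?K = "Poly_Mapping.keys p \<union> Poly_Mapping.keys q"
  show ?thesis
    using keys_add[of p q]
    by (simp add: peval_superset[of ?K] lookup_add distrib_right sum.distrib)
qed

lemma peval_0 [simp]: "peval 0 x = 0"
  by (simp add: peval_def)

lemma peval_sum [simp]: "peval (sum f A) x = (\<Sum>i\<in>A. peval (f i) x)"
  by (induction A rule: infinite_finite_induct) auto

lemma peval_single: "peval (Poly_Mapping.single m c) x = c * (\<Prod>i\<in>UNIV. (x $ i) ^ Poly_Mapping.lookup m i)"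
  by (simp add: peval_def)

lemma peval_mconst [simp]: "peval (mconst c) x = c"
  by (simp add: mconst_def peval_single)

lemma peval_1 [simp]: "peval 1 x = 1"
  using peval_mconst[of 1 x] by simp

lemma peval_mvar [simp]: "peval (mvar i) x = x $ i"
proof -
  have "(\<Prod>j\<in>UNIV. (x $ j) ^ Poly_Mapping.lookup (Poly_Mapping.single i (1::nat)) j) = (\<Prod>j\<in>UNIV. if j = i then x $ j else 1)"
    by (intro prod.cong) (auto simp: lookup_single when_def)
  then show ?thesis by (simp add: mvar_def peval_single)
qed

lemma peval_mult [simp]: "peval (p * q) x = peval p x * peval q x"
proof -
  have single: "peval (Poly_Mapping.single a c * Poly_Mapping.single b d) x
      = peval (Poly_Mapping.single a c) x * peval (Poly_Mapping.single b d) x" for a b c d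
    by (simp add: mult_single peval_single lookup_add power_add prod.distrib)
  have mono: "mconst c * mono_poly m = Poly_Mapping.single m c" for c and m :: "'a \<Rightarrow>\<^sub>0 nat"
    by (simp add: mconst_def mono_poly_def mult_single)
  let ?s = "\<lambda>p m. Poly_Mapping.single m (Poly_Mapping.lookup p m)"
  have p: "p = (\<Sum>m\<in>Poly_Mapping.keys p. ?s p m)" and q: "q = (\<Sum>m\<in>Poly_Mapping.keys q. ?s q m)"
    using mpoly_expand[of p] mpoly_expand[of q] by (simp_all add: mono)
  have "peval (p * q) x = peval ((\<Sum>m\<in>Poly_Mapping.keys p. ?s p m) * (\<Sum>m\<in>Poly_Mapping.keys q. ?s q m)) x"
    using p q by simp
  also have "\<dots> = peval (\<Sum>m\<in>Poly_Mapping.keys p. ?s p m) x * peval (\<Sum>m\<in>Poly_Mapping.keys q. ?s q m) x"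
    by (simp only: sum_product peval_sum single)
  also have "\<dots> = peval p x * peval q x" using p q by simp
  finally show ?thesis .
qed

lemma peval_uminus [simp]: "peval (- p) x = - peval p x"
  using peval_add[of p "- p" x] by simp

lemma peval_diff [simp]: "peval (p - q) x = peval p x - peval q x"
  using peval_add[of p "- q" x] by simp

lemma peval_prod [simp]: "peval (prod f A) x = (\<Prod>i\<in>A. peval (f i) x)"
  by (induction A rule: infinite_finite_induct) auto

lemma peval_power [simp]: "peval (p ^ k) x = peval p x ^ k"
  by (induction k) auto

lemma peval_cong:
  assumes "p \<in> polys_in B" "\<And>i. i \<in> B \<Longrightarrow> x $ i = y $ i"
  shows "peval p x = peval p y"
  using assms by (induction rule: polys_in.induct) auto

lemma continuous_on_peval [continuous_intros]: "continuous_on S (peval p)"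
proof (induction p rule: mpoly_induct)
  case (const c)
  then show ?case by (simp add: continuous_on_const)
next
  case (var i)
  then show ?case by (simp add: continuous_on_component continuous_on_id)
next
  case (add p q)
  then show ?case using continuous_on_add[of S "peval p" "peval q"] by simp
next
  case (mult p q)
  then show ?case using continuous_on_mult[of S "peval p" "peval q"] by simp
qed

section \<open>Polynomials over \<real>[B] in one further variable, later evaluated at
  \<open>mvar j\<close> or at an arbitrary polynomial\<close>

definition coeffs_in :: "'n set \<Rightarrow> 'n mpoly poly \<Rightarrow> bool" where
  "coeffs_in B h \<longleftrightarrow> (\<forall>i. coeff h i \<in> polys_in B)"

lemma coeffs_in_pCons [simp]: "coeffs_in B (pCons a h) \<longleftrightarrow> a \<in> polys_in B \<and> coeffs_in B h"
  by (force simp: coeffs_in_def coeff_pCons split: nat.splits)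

lemma coeffs_in_0 [simp]: "coeffs_in B 0"
  by (simp add: coeffs_in_def)

lemma coeffs_in_add: "coeffs_in B h \<Longrightarrow> coeffs_in B g \<Longrightarrow> coeffs_in B (h + g)"
  by (auto simp: coeffs_in_def)

lemma coeffs_in_mult: "coeffs_in B h \<Longrightarrow> coeffs_in B g \<Longrightarrow> coeffs_in B (h * g)"
  by (auto simp: coeffs_in_def coeff_mult)

lemma coeffs_in_mono: "coeffs_in B h \<Longrightarrow> B \<subseteq> B' \<Longrightarrow> coeffs_in B' h"
  by (auto simp: coeffs_in_def intro: polys_in_mono)

text \<open>The library derivative \<open>pderiv\<close> needs a type class without zero divisors, which \<open>'n mpoly\<close>
  only instantiates for linearly ordered \<open>'n\<close>.\<close>

definition formal_deriv :: "'a::comm_ring_1 poly \<Rightarrow> 'a poly" where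
  "formal_deriv h = (\<Sum>i\<le>degree h. monom (of_nat (Suc i) * coeff h (Suc i)) i)"

lemma coeff_formal_deriv: "coeff (formal_deriv h) i = of_nat (Suc i) * coeff h (Suc i)"
proof -
  have "coeff (formal_deriv h) i = (\<Sum>l\<le>degree h. if l = i then of_nat (Suc l) * coeff h (Suc l) else 0)"
    unfolding formal_deriv_def coeff_sum coeff_monom by (intro sum.cong) auto
  then show ?thesis by (auto simp: coeff_eq_0)
qed

lemma formal_deriv_pCons: "formal_deriv (pCons a h) = h + pCons 0 (formal_deriv h)"
proof (rule poly_eqI)
  show "coeff (formal_deriv (pCons a h)) i = coeff (h + pCons 0 (formal_deriv h)) i" for i
    by (cases i) (auto simp: coeff_formal_deriv algebra_simps)
qed

lemma coeffs_in_formal_deriv: "coeffs_in B h \<Longrightarrow> coeffs_in B (formal_deriv h)"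
  unfolding coeffs_in_def coeff_formal_deriv by (intro allI polys_in.mult polys_in_of_nat) auto

lemma polys_in_poly: "coeffs_in B h \<Longrightarrow> p \<in> polys_in B \<Longrightarrow> poly h p \<in> polys_in B"
  by (induction h) auto

lemma polys_in_insert_poly:
  assumes "p \<in> polys_in (insert j B)"
  obtains h where "coeffs_in B h" "p = poly h (mvar j)"
proof -
  have "\<exists>h. coeffs_in B h \<and> p = poly h (mvar j)"
    using assms
  proof (induction rule: polys_in.induct)
    case (const c)
    show ?case by (rule exI[of _ "[:mconst c:]"]) auto
  next
    case (var i)
    show ?case
    proof (cases "i = j")
      case True
      then show ?thesis by (intro exI[of _ "[:0, 1:]"]) auto
    next
      case False
      with var show ?thesis by (intro exI[of _ "[:mvar i:]"]) auto
    qed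
  next
    case (add p q)
    then obtain h g where "coeffs_in B h" "p = poly h (mvar j)" "coeffs_in B g" "q = poly g (mvar j)"
      by blast
    then show ?case by (intro exI[of _ "h + g"]) (auto simp: coeffs_in_add)
  next
    case (mult p q)
    then obtain h g where "coeffs_in B h" "p = poly h (mvar j)" "coeffs_in B g" "q = poly g (mvar j)"
      by blast
    then show ?case by (intro exI[of _ "h * g"]) (auto simp: coeffs_in_mult)
  qed
  then show ?thesis using that by blast
qed

section \<open>Polynomials are determined by their values, and form an integral domain\<close>

lemma peval_poly_map: "peval (poly h p) x = poly (map_poly (\<lambda>c. peval c x) h) (peval p x)"
  by (induction h) (auto simp: map_poly_pCons)

text \<open>Induction on the set of variables: with all variables but one fixed, a univariate real
  polynomial with only zeros remains, so its coefficients vanish at every point.\<close>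

lemma peval_eq_0_imp:
  fixes p :: "'n::finite mpoly"
  assumes "\<And>x. peval p x = 0"
  shows "p = 0"
proof -
  have "p \<in> polys_in A \<Longrightarrow> (\<forall>x. peval p x = 0) \<Longrightarrow> p = 0" if "finite A" for A :: "'n set"
    using that
  proof (induction A arbitrary: p rule: finite_induct)
    case empty
    have "\<exists>c. p = mconst c"
      using empty(1)
      by (induction rule: polys_in.induct) (auto simp: mconst_add[symmetric] mconst_mult[symmetric])
    then show ?case using empty(2) by auto
  next
    case (insert j A)
    from polys_in_insert_poly[OF insert.prems(1)]
    obtain h where h: "coeffs_in A h" "p = poly h (mvar j)" by blast
    have "coeff h i = 0" for i
    proof (rule insert.IH)
      show "coeff h i \<in> polys_in A" using h by (auto simp: coeffs_in_def)
      show "\<forall>x. peval (coeff h i) x = 0"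
      proof
        fix x :: "real^'n"
        let ?g = "map_poly (\<lambda>c. peval c x) h"
        have "poly ?g t = 0" for t
        proof -
          \<comment> \<open>Moving coordinate \<open>j\<close> alone does not affect the
            coefficients, which lie in \<real>[A] with \<open>j\<close> outside
            \<open>A\<close>.\<close>
          let ?y = "\<chi> l. if l = j then t else x $ l"
          have "coeffs_in A h \<Longrightarrow> map_poly (\<lambda>c. peval c ?y) h = map_poly (\<lambda>c. peval c x) h" for h
            by (induction h) (use insert.hyps in \<open>auto simp: map_poly_pCons intro!: peval_cong\<close>)
          then have "map_poly (\<lambda>c. peval c ?y) h = ?g" using h by blast
          moreover have "peval p ?y = 0" using insert.prems(2) by blast
          ultimately show ?thesis by (simp add: h(2) peval_poly_map)
        qed
        then have "?g = 0" using poly_all_0_iff_0 by blast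
        then have "coeff ?g i = 0" by simp
        then show "peval (coeff h i) x = 0" by (simp add: coeff_map_poly)
      qed
    qed
    then have "h = 0" by (simp add: poly_eqI)
    then show ?case using h by simp
  qed
  from this[of UNIV] show ?thesis using assms by simp
qed

lemma peval_inject: "(\<And>x. peval p x = peval q x) \<Longrightarrow> p = q"
  using peval_eq_0_imp[of "p - q"] by simp

lemma peval_line_poly: "\<exists>f. \<forall>t. peval p (a + t *\<^sub>R v) = poly f t"
proof (induction p rule: mpoly_induct)
  case (const c)
  show ?case by (rule exI[of _ "[:c:]"]) simp
next
  case (var i)
  show ?case by (rule exI[of _ "[:a $ i, v $ i:]"]) simp
next
  case (add p q)
  then obtain f g where "\<forall>t. peval p (a + t *\<^sub>R v) = poly f t" "\<forall>t. peval q (a + t *\<^sub>R v) = poly g t"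
    by blast
  then show ?case by (intro exI[of _ "f + g"]) simp
next
  case (mult p q)
  then obtain f g where "\<forall>t. peval p (a + t *\<^sub>R v) = poly f t" "\<forall>t. peval q (a + t *\<^sub>R v) = poly g t"
    by blast
  then show ?case by (intro exI[of _ "f * g"]) simp
qed

text \<open>On the line through \<open>a\<close> and \<open>x\<close> the polynomial becomes
  univariate and vanishes on an interval, hence also at \<open>t = 1\<close>, which is
  \<open>x\<close>.\<close>

lemma peval_eq_0_on_ball:
  assumes "r > 0" "\<And>x. x \<in> ball a r \<Longrightarrow> peval p x = 0"
  shows "p = 0"
proof (rule peval_eq_0_imp)
  fix x
  define v where "v = x - a"
  obtain f where f: "\<And>t. peval p (a + t *\<^sub>R v) = poly f t" using peval_line_poly[of p a v] by blast
  have "poly f t = 0" if "t \<in> {0<..<r / (norm v + 1)}" for t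
  proof -
    have t: "0 < t" "t * (norm v + 1) < r" using that by (auto simp: field_simps add_pos_nonneg)
    have "t * norm v \<le> t * (norm v + 1)" using t by (intro mult_left_mono) auto
    then have "t * norm v < r" using t by linarith
    then have "a + t *\<^sub>R v \<in> ball a r" using t by (simp add: dist_norm)
    then show ?thesis using assms(2) f by metis
  qed
  moreover have "infinite {0<..<r / (norm v + 1)}"
    using assms by (simp add: add_nonneg_pos)
  moreover have "{0<..<r / (norm v + 1)} \<subseteq> {t. poly f t = 0}" using calculation(1) by blast
  ultimately have "infinite {t. poly f t = 0}" using infinite_super by blast
  then have "f = 0" using poly_roots_finite by blast
  then show "peval p x = 0" using f[of 1] by (simp add: v_def)
qed

text \<open>Analytic argument: a nonzero \<open>q\<close> is nonzero on some ball, so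
  \<open>p\<close> vanishes on that ball.\<close>

lemma mpoly_mult_eq_0:
  fixes p q :: "'n::finite mpoly"
  assumes "p * q = 0"
  shows "p = 0 \<or> q = 0"
proof (rule disjCI)
  assume "q \<noteq> 0"
  then obtain a where a: "peval q a \<noteq> 0" using peval_eq_0_imp by blast
  have "open {x. peval q x \<noteq> 0}"
    using continuous_on_peval[of UNIV q] by (intro open_Collect_neq) auto
  with a obtain r where r: "r > 0" "ball a r \<subseteq> {x. peval q x \<noteq> 0}"
    unfolding open_contains_ball by auto
  show "p = 0"
  proof (rule peval_eq_0_on_ball[OF r(1)])
    fix x assume "x \<in> ball a r"
    then have "peval q x \<noteq> 0" using r(2) by blast
    then show "peval p x = 0" using assms peval_mult[of p q x] by simp
  qed
qed

lemma mpoly_power_neq_0: "(p :: 'n::finite mpoly) \<noteq> 0 \<Longrightarrow> p ^ k \<noteq> 0"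
  by (induction k) (auto dest: mpoly_mult_eq_0)

lemma mpoly_prod_neq_0: "(\<And>i. i \<in> A \<Longrightarrow> f i \<noteq> (0 :: 'n::finite mpoly)) \<Longrightarrow> prod f A \<noteq> 0"
  by (induction A rule: infinite_finite_induct) (auto dest: mpoly_mult_eq_0)

section \<open>Ideals and counting\<close>

lemma ideal_0: "is_ideal J \<Longrightarrow> 0 \<in> J"
  and ideal_add: "is_ideal J \<Longrightarrow> a \<in> J \<Longrightarrow> b \<in> J \<Longrightarrow> a + b \<in> J"
  and ideal_mult_left: "is_ideal J \<Longrightarrow> a \<in> J \<Longrightarrow> r * a \<in> J"
  by (auto simp: is_ideal_def)

lemma ideal_mult_right: "is_ideal J \<Longrightarrow> a \<in> J \<Longrightarrow> a * r \<in> J"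
  using ideal_mult_left[of J a r] by (simp add: mult.commute)

lemma ideal_uminus: "is_ideal J \<Longrightarrow> a \<in> J \<Longrightarrow> - a \<in> J"
  using ideal_mult_left[of J a "-1"] by simp

lemma ideal_diff: "is_ideal J \<Longrightarrow> a \<in> J \<Longrightarrow> b \<in> J \<Longrightarrow> a - b \<in> J"
  using ideal_add[of J a "- b"] ideal_uminus[of J b] by simp

lemma ideal_sum: "is_ideal J \<Longrightarrow> (\<And>i. i \<in> A \<Longrightarrow> f i \<in> J) \<Longrightarrow> sum f A \<in> J"
  by (induction A rule: infinite_finite_induct) (auto simp: ideal_0 ideal_add)

text \<open>Fewer equations than unknowns: Gaussian elimination, one equation at a time.\<close>

lemma exists_real_dependence:
  fixes A :: "'k \<Rightarrow> 'i \<Rightarrow> real"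
  assumes "finite I" "finite K" "card I < card K"
  shows "\<exists>\<alpha>. (\<exists>k\<in>K. \<alpha> k \<noteq> 0) \<and> (\<forall>i\<in>I. (\<Sum>k\<in>K. \<alpha> k * A k i) = 0)"
  using assms
proof (induction I arbitrary: K A rule: finite_induct)
  case empty
  then have "K \<noteq> {}" by auto
  then show ?case by (intro exI[of _ "\<lambda>_. 1"]) auto
next
  case (insert i I)
  show ?case
  proof (cases "\<forall>k\<in>K. A k i = 0")
    case True
    have "card I < card K" using insert by simp
    with insert.IH[of K A] insert.prems
    obtain \<alpha> where "\<exists>k\<in>K. \<alpha> k \<noteq> 0" "\<forall>i\<in>I. (\<Sum>k\<in>K. \<alpha> k * A k i) = 0" by blast
    with True show ?thesis by (intro exI[of _ \<alpha>]) auto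
  next
    case False
    then obtain k0 where k0: "k0 \<in> K" "A k0 i \<noteq> 0" by blast
    define K' where "K' = K - {k0}"
    have "card I < card K'" "finite K'" using insert k0 by (auto simp: K'_def)
    with insert.IH[of K' "\<lambda>k j. A k j - A k i / A k0 i * A k0 j"]
    obtain \<alpha> where \<alpha>: "\<exists>k\<in>K'. \<alpha> k \<noteq> 0"
      "\<forall>j\<in>I. (\<Sum>k\<in>K'. \<alpha> k * (A k j - A k i / A k0 i * A k0 j)) = 0" by blast
    \<comment> \<open>The pivot coefficient is chosen to satisfy equation \<open>i\<close>;
      substituting it into equation \<open>j\<close> gives the modified equation solved by
      \<alpha>.\<close>
    define \<beta> where "\<beta> k = (if k = k0 then - (\<Sum>k\<in>K'. \<alpha> k * A k i) / A k0 i else \<alpha> k)" for k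
    have split: "(\<Sum>k\<in>K. \<beta> k * A k j) = - (\<Sum>k\<in>K'. \<alpha> k * A k i) / A k0 i * A k0 j + (\<Sum>k\<in>K'. \<alpha> k * A k j)" for j
    proof -
      have "(\<Sum>k\<in>K. \<beta> k * A k j) = \<beta> k0 * A k0 j + (\<Sum>k\<in>K'. \<beta> k * A k j)"
        unfolding K'_def using insert.prems(1) k0(1) by (rule sum.remove)
      moreover have "(\<Sum>k\<in>K'. \<beta> k * A k j) = (\<Sum>k\<in>K'. \<alpha> k * A k j)"
        by (intro sum.cong) (auto simp: \<beta>_def K'_def)
      ultimately show ?thesis by (simp add: \<beta>_def)
    qed
    have "(\<Sum>k\<in>K. \<beta> k * A k j) = 0" if "j \<in> insert i I" for j
    proof (cases "j = i")
      case True
      then show ?thesis using k0 by (simp add: split)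
    next
      case False
      with that have "(\<Sum>k\<in>K'. \<alpha> k * (A k j - A k i / A k0 i * A k0 j)) = 0" using \<alpha> by blast
      then have "(\<Sum>k\<in>K'. \<alpha> k * A k j) - (\<Sum>k\<in>K'. \<alpha> k * A k i) / A k0 i * A k0 j = 0"
        by (simp add: right_diff_distrib sum_subtractf sum_divide_distrib sum_distrib_right mult.assoc)
      then show ?thesis by (simp add: split)
    qed
    moreover have "\<exists>k\<in>K. \<beta> k \<noteq> 0" using \<alpha>(1) by (auto simp: \<beta>_def K'_def)
    ultimately show ?thesis by blast
  qed
qed

lemma lookup_mconst_mult:
  "Poly_Mapping.lookup (mconst a * p) m = a * Poly_Mapping.lookup p m"
  by (cases "a = 0"; cases "Poly_Mapping.lookup p m = 0")
    (auto simp: mconst_def mult_map_scale_conv_mult[symmetric] map.rep_eq when_def)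

lemma mono_combination_neq_0:
  assumes "finite K" "inj_on g K" "k0 \<in> K" "\<alpha> k0 \<noteq> 0"
  shows "(\<Sum>k\<in>K. mconst (\<alpha> k) * mono_poly (g k)) \<noteq> 0"
proof -
  have "Poly_Mapping.lookup (\<Sum>k\<in>K. mconst (\<alpha> k) * mono_poly (g k)) (g k0)
      = (\<Sum>k\<in>K. if k = k0 then \<alpha> k else 0)"
    unfolding lookup_sum
    by (intro sum.cong) (use assms in \<open>auto simp: mconst_def mono_poly_def mult_single lookup_single when_def inj_on_def\<close>)
  also have "\<dots> = \<alpha> k0" using assms by simp
  finally show ?thesis using assms by auto
qed

definition box_monos :: "'n set \<Rightarrow> nat \<Rightarrow> ('n \<Rightarrow> nat) \<Rightarrow> ('n \<Rightarrow>\<^sub>0 nat) set" where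
  "box_monos B a k = {m. (\<forall>i\<in>B. Poly_Mapping.lookup m i \<le> a) \<and> (\<forall>j. j \<notin> B \<longrightarrow> Poly_Mapping.lookup m j < k j)}"

text \<open>Only the exponents in \<open>B\<close> depend on \<open>a\<close>, so the bound is
  polynomial in \<open>a\<close> of degree \<open>card B\<close>. This growth rate drives the
  counting argument.\<close>

lemma box_monos_card:
  fixes B :: "'n::finite set"
  shows "finite (box_monos B a k)" "card (box_monos B a k) \<le> Suc a ^ card B * (\<Prod>j\<in>-B. k j)"
proof -
  let ?F = "PiE UNIV (\<lambda>i. if i \<in> B then {..a} else {..<k i})"
  have inj: "inj_on Poly_Mapping.lookup (box_monos B a k)"
    by (intro inj_onI) (simp add: lookup_inject)
  have sub: "Poly_Mapping.lookup ` box_monos B a k \<subseteq> ?F"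
    by (auto simp: box_monos_def)
  have fin: "finite ?F" by (intro finite_PiE) auto
  show "finite (box_monos B a k)" by (rule finite_imageD[OF finite_subset[OF sub fin] inj])
  have "card (box_monos B a k) \<le> card ?F" by (rule card_inj_on_le[OF inj sub fin])
  also have "card ?F = (\<Prod>i\<in>UNIV. if i \<in> B then Suc a else k i)"
    by (subst card_PiE) (auto intro!: prod.cong)
  also have "\<dots> = (\<Prod>i\<in>B. Suc a) * (\<Prod>i\<in>-B. k i)"
    by (subst prod.If_cases) (auto simp: Compl_eq)
  finally show "card (box_monos B a k) \<le> Suc a ^ card B * (\<Prod>j\<in>-B. k j)" by simp
qed

text \<open>Modulo \<open>J\<close> and up to powers of \<open>c\<close>, every polynomial reduces to one whose exponents outside
  \<open>B\<close> are bounded, while its exponents in \<open>B\<close> grow linearly in the complexity of the polynomial.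
  Comparing dimensions then yields algebraic relations among any \<open>card B + 1\<close> polynomials.\<close>

locale reduction =
  fixes J :: "'n::finite mpoly set" and B :: "'n set" and c :: "'n mpoly"
    and k :: "'n \<Rightarrow> nat" and u :: "'n \<Rightarrow> nat \<Rightarrow> 'n mpoly" and e :: nat
  assumes ideal: "is_ideal J"
    and c_in: "c \<in> polys_in B"
    and k_pos: "\<And>j. j \<notin> B \<Longrightarrow> k j > 0"
    and u_in: "\<And>j i. j \<notin> B \<Longrightarrow> i < k j \<Longrightarrow> u j i \<in> polys_in B"
    and rel: "\<And>j. j \<notin> B \<Longrightarrow> c * mvar j ^ k j - (\<Sum>i<k j. u j i * mvar j ^ i) \<in> J"
    and c_exp: "\<And>m i. m \<in> Poly_Mapping.keys c \<Longrightarrow> Poly_Mapping.lookup m i \<le> e"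
    and u_exp: "\<And>j l m i. j \<notin> B \<Longrightarrow> l < k j \<Longrightarrow> m \<in> Poly_Mapping.keys (u j l) \<Longrightarrow> Poly_Mapping.lookup m i \<le> e"
begin

text \<open>A factor \<open>c\<close> or \<open>u j i\<close> raises exponents by at most
  \<open>e\<close>, and \<open>c * mvar j\<close> by at most \<open>e + 1\<close>; the scale
  \<open>Suc e\<close> makes each such multiplication cost exactly one level.\<close>

definition W :: "nat \<Rightarrow> 'n mpoly set" where
  "W D = {p. Poly_Mapping.keys p \<subseteq> box_monos B (Suc e * D) k}"

lemma W_0: "0 \<in> W D"
  by (simp add: W_def)

lemma W_add: "p \<in> W D \<Longrightarrow> q \<in> W D \<Longrightarrow> p + q \<in> W D"
  using keys_add[of p q] by (auto simp: W_def)

lemma W_sum: "(\<And>i. i \<in> A \<Longrightarrow> f i \<in> W D) \<Longrightarrow> sum f A \<in> W D"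
  by (induction A rule: infinite_finite_induct) (auto simp: W_0 W_add)

lemma W_mult:
  assumes "p \<in> polys_in B" "\<And>m i. m \<in> Poly_Mapping.keys p \<Longrightarrow> Poly_Mapping.lookup m i \<le> Suc e" "w \<in> W D"
  shows "p * w \<in> W (Suc D)"
proof -
  have "a + b \<in> box_monos B (Suc e * Suc D) k" if "a \<in> Poly_Mapping.keys p" "b \<in> Poly_Mapping.keys w" for a b
  proof -
    have b: "b \<in> box_monos B (Suc e * D) k" using that assms by (auto simp: W_def)
    have "Poly_Mapping.lookup a i \<le> Suc e" for i using assms(2) that by blast
    moreover have "Poly_Mapping.lookup a i = 0" if "i \<notin> B" for i
      using polys_in_keys[OF assms(1) \<open>a \<in> _\<close> that] .
    moreover have "Poly_Mapping.lookup (a + b) i \<le> Suc e * Suc D" if "i \<in> B" for i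
      using add_mono[of "Poly_Mapping.lookup a i" "Suc e" "Poly_Mapping.lookup b i" "Suc e * D"] b that calculation(1)
      by (auto simp: box_monos_def lookup_add)
    ultimately show ?thesis using b by (auto simp: box_monos_def lookup_add)
  qed
  then show ?thesis using keys_mult[of p w] by (auto simp: W_def)
qed

lemma W_c: "w \<in> W D \<Longrightarrow> c * w \<in> W (Suc D)"
  by (rule W_mult) (auto intro: c_in le_SucI c_exp)

lemma W_c_power: "w \<in> W D \<Longrightarrow> c ^ s * w \<in> W (D + s)"
  by (induction s) (auto simp: mult.assoc dest: W_c)

lemma W_u: "j \<notin> B \<Longrightarrow> l < k j \<Longrightarrow> w \<in> W D \<Longrightarrow> u j l * w \<in> W (Suc D)"
  by (rule W_mult) (auto intro: u_in le_SucI u_exp)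

lemma W_mconst: "w \<in> W D \<Longrightarrow> mconst a * w \<in> W D"
  using keys_mult[of "mconst a" w] by (force simp: W_def mconst_def split: if_splits)

lemma W_mono: "mono_poly m \<in> W D \<longleftrightarrow> m \<in> box_monos B (Suc e * D) k"
  by (simp add: W_def mono_poly_def)

text \<open>Multiplication by \<open>q\<close>, cleared by \<open>c ^ s\<close>, raises levels by
  \<open>s\<close> modulo \<open>J\<close>. Quantifying over all \<open>w\<close>, not only
  \<open>w = 1\<close>, lets the costs add up under products.\<close>

definition reducible :: "'n mpoly \<Rightarrow> nat \<Rightarrow> bool" where
  "reducible q s \<longleftrightarrow> (\<forall>D. \<forall>w\<in>W D. \<exists>w'\<in>W (D + s). c ^ s * q * w - w' \<in> J)"

lemma reducible_mono:
  assumes "reducible q s" "s \<le> s'"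
  shows "reducible q s'"
  unfolding reducible_def
proof (intro allI ballI)
  fix D w assume "w \<in> W D"
  then obtain w' where w': "w' \<in> W (D + s)" "c ^ s * q * w - w' \<in> J"
    using assms unfolding reducible_def by blast
  obtain r where r: "s' = s + r" using assms(2) le_Suc_ex by blast
  have "c ^ r * w' \<in> W (D + s')" using W_c_power[OF w'(1), of r] by (simp add: r add.assoc)
  moreover have "c ^ s' * q * w - c ^ r * w' = c ^ r * (c ^ s * q * w - w')"
    by (simp add: r power_add algebra_simps)
  ultimately show "\<exists>w'\<in>W (D + s'). c ^ s' * q * w - w' \<in> J"
    using ideal_mult_left[OF ideal w'(2)] by metis
qed

lemma reducible_mult:
  assumes "reducible q s" "reducible q' s'"
  shows "reducible (q * q') (s + s')"
  unfolding reducible_def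
proof (intro allI ballI)
  fix D w assume "w \<in> W D"
  then obtain w' where w': "w' \<in> W (D + s')" "c ^ s' * q' * w - w' \<in> J"
    using assms unfolding reducible_def by blast
  then obtain w'' where w'': "w'' \<in> W (D + s' + s)" "c ^ s * q * w' - w'' \<in> J"
    using assms unfolding reducible_def by blast
  have "c ^ (s + s') * (q * q') * w - w'' = (c ^ s * q) * (c ^ s' * q' * w - w') + (c ^ s * q * w' - w'')"
    by (simp add: power_add algebra_simps)
  also have "\<dots> \<in> J" using w' w'' ideal by (intro ideal_add ideal_mult_left)
  finally show "\<exists>w'\<in>W (D + (s + s')). c ^ (s + s') * (q * q') * w - w' \<in> J"
    using w''(1) by (intro bexI[of _ w'']) (auto simp: add_ac)
qed

lemma reducible_add:
  assumes "reducible q s" "reducible q' s"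
  shows "reducible (q + q') s"
  unfolding reducible_def
proof (intro allI ballI)
  fix D w assume "w \<in> W D"
  then obtain w' w'' where w': "w' \<in> W (D + s)" "c ^ s * q * w - w' \<in> J"
    "w'' \<in> W (D + s)" "c ^ s * q' * w - w'' \<in> J"
    using assms unfolding reducible_def by meson
  have "c ^ s * (q + q') * w - (w' + w'') = (c ^ s * q * w - w') + (c ^ s * q' * w - w'')"
    by (simp add: algebra_simps)
  also have "\<dots> \<in> J" using w' ideal by (intro ideal_add)
  finally show "\<exists>w'\<in>W (D + s). c ^ s * (q + q') * w - w' \<in> J"
    using W_add[OF w'(1,3)] by blast
qed

lemma reducible_mconst: "reducible (mconst a) 0"
  unfolding reducible_def using W_mconst ideal_0[OF ideal] by (auto intro!: bexI[of _ "mconst a * w" for w])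

text \<open>For \<open>j\<close> in \<open>B\<close> only the level grows. For \<open>j\<close>
  outside \<open>B\<close> the exponent of x_j may reach the forbidden value \<open>k j\<close>, and
  then the one factor \<open>c\<close> pays for one use of \<open>rel\<close>.\<close>

lemma reducible_mvar: "reducible (mvar j) 1"
proof (cases "j \<in> B")
  case True
  have "c * mvar j * w \<in> W (D + 1)" if "w \<in> W D" for w D
  proof -
    have "Poly_Mapping.lookup m i \<le> Suc e" if m: "m \<in> Poly_Mapping.keys (c * mvar j)" for m i
    proof -
      obtain a where "m = a + Poly_Mapping.single j 1" "a \<in> Poly_Mapping.keys c"
        using m keys_mult[of c "mvar j"] by (auto simp: mvar_def)
      then show ?thesis using c_exp[of a i] by (auto simp: lookup_add lookup_single when_def)
    qed
    moreover have "c * mvar j \<in> polys_in B" using True c_in by auto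
    ultimately show ?thesis using W_mult that by fastforce
  qed
  then show ?thesis unfolding reducible_def using ideal_0[OF ideal]
    by (auto intro!: bexI[of _ "c * mvar j * w" for w])
next
  case False
  show ?thesis unfolding reducible_def
  proof (intro allI ballI)
    fix D w assume w: "w \<in> W D"
    have mono: "\<exists>w'\<in>W (D + 1). c * mvar j * mono_poly m - w' \<in> J" if m: "m \<in> box_monos B (Suc e * D) k" for m
    proof (cases "Suc (Poly_Mapping.lookup m j) < k j")
      case True
      let ?m = "m + Poly_Mapping.single j 1"
      have "?m \<in> box_monos B (Suc e * D) k"
        using m True False by (auto simp: box_monos_def lookup_add lookup_single when_def)
      then have "c * mono_poly ?m \<in> W (D + 1)" using W_c W_mono by simp
      moreover have "c * mvar j * mono_poly m - c * mono_poly ?m = 0"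
        using mono_poly_single[of j 1] by (simp add: mono_poly_add)
      ultimately show ?thesis using ideal_0[OF ideal] by metis
    next
      \<comment> \<open>Here the exponent of x_j becomes exactly \<open>k j\<close>, so the leading
        term of the relation is replaced by its lower terms; \<open>m'\<close> is \<open>m\<close>
        with x_j removed.\<close>
      case False2: False
      define m' where "m' = Poly_Mapping.update j 0 m"
      have "Poly_Mapping.lookup m j < k j" using m False by (auto simp: box_monos_def)
      then have mj: "Suc (Poly_Mapping.lookup m j) = k j" using False2 by simp
      have meq: "m = m' + Poly_Mapping.single j (Poly_Mapping.lookup m j)"
        by (rule poly_mapping_eqI) (simp add: m'_def lookup_add lookup_update lookup_single when_def)
      have m'box: "m' + Poly_Mapping.single j i \<in> box_monos B (Suc e * D) k" if "i < k j" for i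
        using m that False by (auto simp: box_monos_def m'_def lookup_add lookup_update lookup_single when_def)
      define w' where "w' = (\<Sum>i<k j. u j i * mono_poly (m' + Poly_Mapping.single j i))"
      have "w' \<in> W (D + 1)"
        unfolding w'_def using W_u[OF False] m'box W_mono by (auto intro!: W_sum)
      moreover have "c * mvar j * mono_poly m - w' \<in> J"
      proof -
        have "mvar j * mono_poly m = mono_poly m' * mvar j ^ k j"
          by (subst meq) (simp add: mono_poly_add mono_poly_single mj[symmetric] algebra_simps)
        then have "c * mvar j * mono_poly m = mono_poly m' * (c * mvar j ^ k j)"
          by (simp add: mult.assoc mult.left_commute)
        moreover have "w' = mono_poly m' * (\<Sum>i<k j. u j i * mvar j ^ i)"
          unfolding w'_def sum_distrib_left by (intro sum.cong) (auto simp: mono_poly_add mono_poly_single algebra_simps)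
        ultimately have "c * mvar j * mono_poly m - w' = mono_poly m' * (c * mvar j ^ k j - (\<Sum>i<k j. u j i * mvar j ^ i))"
          by (simp add: right_diff_distrib)
        then show ?thesis using ideal_mult_left[OF ideal rel[OF False]] by simp
      qed
      ultimately show ?thesis by blast
    qed
    have "\<forall>m\<in>Poly_Mapping.keys w. \<exists>w'\<in>W (D + 1). c * mvar j * mono_poly m - w' \<in> J"
      using w mono by (auto simp: W_def)
    then obtain f where f: "\<And>m. m \<in> Poly_Mapping.keys w \<Longrightarrow> f m \<in> W (D + 1)"
      "\<And>m. m \<in> Poly_Mapping.keys w \<Longrightarrow> c * mvar j * mono_poly m - f m \<in> J" by metis
    let ?w = "\<Sum>m\<in>Poly_Mapping.keys w. mconst (Poly_Mapping.lookup w m) * f m"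
    have "c ^ 1 * mvar j * w - ?w
        = c * mvar j * (\<Sum>m\<in>Poly_Mapping.keys w. mconst (Poly_Mapping.lookup w m) * mono_poly m) - ?w"
      using mpoly_expand[of w] by simp
    also have "\<dots> = (\<Sum>m\<in>Poly_Mapping.keys w. mconst (Poly_Mapping.lookup w m) * (c * mvar j * mono_poly m - f m))"
      unfolding sum_distrib_left sum_subtractf[symmetric] by (intro sum.cong) (auto simp: algebra_simps)
    also have "\<dots> \<in> J" using f ideal by (intro ideal_sum ideal_mult_left)
    finally show "\<exists>w'\<in>W (D + 1). c ^ 1 * mvar j * w - w' \<in> J"
      using f(1) by (intro bexI[of _ ?w] W_sum W_mconst)
  qed
qed

lemma reducible_exists: "\<exists>s. reducible q s"
proof (induction q rule: mpoly_induct)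
  case (add p q)
  then obtain s s' where "reducible p s" "reducible q s'" by blast
  then have "reducible p (s + s')" "reducible q (s + s')" by (auto intro: reducible_mono)
  then show ?case using reducible_add by blast
qed (use reducible_mconst reducible_mvar reducible_mult in blast)+

lemma reducible_power: "reducible q s \<Longrightarrow> reducible (q ^ i) (s * i)"
  by (induction i) (use reducible_mconst[of 1] reducible_mult in auto)

lemma reducible_prod:
  assumes "\<And>t. t \<in> T \<Longrightarrow> reducible (f t) (s t)"
  shows "reducible (prod f T) (sum s T)"
  using assms by (induction T rule: infinite_finite_induct) (use reducible_mconst[of 1] reducible_mult in auto)

text \<open>There are (D+1)^(card T) products with exponents at most \<open>D\<close>. After
  multiplication by \<open>c ^ N\<close> they reduce modulo \<open>J\<close> to a space whose
  dimension grows only like D^(card B), so they are dependent. The power of \<open>c\<close> stays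
  in the conclusion because \<open>J\<close> need not be prime.\<close>

lemma algebraic_relation:
  fixes q :: "'t \<Rightarrow> 'n mpoly"
  assumes "finite T" "card B < card T"
  obtains N D \<alpha> \<beta>0 where "\<beta>0 \<in> PiE T (\<lambda>_. {..D})" "\<alpha> \<beta>0 \<noteq> (0::real)"
    "c ^ N * (\<Sum>\<beta>\<in>PiE T (\<lambda>_. {..D}). mconst (\<alpha> \<beta>) * (\<Prod>t\<in>T. q t ^ \<beta> t)) \<in> J"
proof -
  obtain s where s: "\<And>t. reducible (q t) (s t)" using choice[of "\<lambda>t s. reducible (q t) s"] reducible_exists by auto
  define \<sigma> where "\<sigma> = sum s T"
  define \<kappa> where "\<kappa> = (\<Prod>j\<in>-B. k j)"
  \<comment> \<open>\<open>D\<close> is the constant in the dimension bound, so that the bound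
    becomes \<open>D * Suc D ^ card B\<close>, just below
    \<open>Suc D ^ Suc (card B)\<close>.\<close>
  define D where "D = \<kappa> * (Suc (Suc e * \<sigma>)) ^ card B"
  define N where "N = \<sigma> * D"
  define K where "K = PiE T (\<lambda>_. {..D})"
  have finK: "finite K" using assms(1) unfolding K_def by (intro finite_PiE) auto
  have cardK: "card K = Suc D ^ card T" unfolding K_def by (subst card_PiE[OF assms(1)]) simp
  define M where "M = box_monos B (Suc e * N) k"
  have "card M \<le> Suc (Suc e * N) ^ card B * \<kappa>" using box_monos_card(2) by (simp add: M_def \<kappa>_def)
  also have "Suc (Suc e * N) \<le> Suc (Suc e * \<sigma>) * Suc D" by (simp add: N_def algebra_simps)
  then have "Suc (Suc e * N) ^ card B * \<kappa> \<le> (Suc (Suc e * \<sigma>) * Suc D) ^ card B * \<kappa>"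
    by (intro mult_right_mono power_mono) auto
  also have "\<dots> = D * Suc D ^ card B" by (simp only: D_def power_mult_distrib mult_ac)
  also have "\<dots> < Suc D * Suc D ^ card B" by simp
  also have "\<dots> = Suc D ^ Suc (card B)" by simp
  also have "\<dots> \<le> Suc D ^ card T" using assms(2) by (intro power_increasing) auto
  finally have less: "card M < card K" by (simp add: cardK)
  have "\<exists>w\<in>W N. c ^ N * (\<Prod>t\<in>T. q t ^ \<beta> t) - w \<in> J" if "\<beta> \<in> K" for \<beta>
  proof -
    have "reducible (\<Prod>t\<in>T. q t ^ \<beta> t) (\<Sum>t\<in>T. s t * \<beta> t)"
      by (intro reducible_prod reducible_power s)
    moreover have "(\<Sum>t\<in>T. s t * \<beta> t) \<le> N"
      unfolding N_def \<sigma>_def sum_distrib_right using that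
      by (intro sum_mono mult_left_mono) (auto simp: K_def PiE_iff)
    ultimately have "reducible (\<Prod>t\<in>T. q t ^ \<beta> t) N" by (rule reducible_mono)
    moreover have "1 \<in> W 0" using W_mono[of 0 0] k_pos by (auto simp: box_monos_def)
    ultimately show ?thesis unfolding reducible_def by fastforce
  qed
  then obtain w where w: "\<And>\<beta>. \<beta> \<in> K \<Longrightarrow> w \<beta> \<in> W N"
    "\<And>\<beta>. \<beta> \<in> K \<Longrightarrow> c ^ N * (\<Prod>t\<in>T. q t ^ \<beta> t) - w \<beta> \<in> J" by metis
  have finM: "finite M" using box_monos_card(1) by (simp add: M_def)
  from exists_real_dependence[OF finM finK less, of "\<lambda>\<beta> m. Poly_Mapping.lookup (w \<beta>) m"]
  obtain \<alpha> where \<alpha>: "\<exists>\<beta>\<in>K. \<alpha> \<beta> \<noteq> 0" "\<And>m. m \<in> M \<Longrightarrow> (\<Sum>\<beta>\<in>K. \<alpha> \<beta> * Poly_Mapping.lookup (w \<beta>) m) = 0"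
    by blast
  have "(\<Sum>\<beta>\<in>K. mconst (\<alpha> \<beta>) * w \<beta>) = 0"
  proof (rule poly_mapping_eqI)
    fix m
    show "Poly_Mapping.lookup (\<Sum>\<beta>\<in>K. mconst (\<alpha> \<beta>) * w \<beta>) m = Poly_Mapping.lookup 0 m"
    proof (cases "m \<in> M")
      case True
      then show ?thesis using \<alpha>(2) by (simp add: lookup_sum lookup_mconst_mult)
    next
      case False
      then have "Poly_Mapping.lookup (w \<beta>) m = 0" if "\<beta> \<in> K" for \<beta>
        using w(1)[OF that] by (auto simp: W_def M_def in_keys_iff)
      then show ?thesis by (simp add: lookup_sum lookup_mconst_mult)
    qed
  qed
  then have "c ^ N * (\<Sum>\<beta>\<in>K. mconst (\<alpha> \<beta>) * (\<Prod>t\<in>T. q t ^ \<beta> t))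
      = c ^ N * (\<Sum>\<beta>\<in>K. mconst (\<alpha> \<beta>) * (\<Prod>t\<in>T. q t ^ \<beta> t)) - (\<Sum>\<beta>\<in>K. mconst (\<alpha> \<beta>) * w \<beta>)"
    by simp
  also have "\<dots> = (\<Sum>\<beta>\<in>K. mconst (\<alpha> \<beta>) * (c ^ N * (\<Prod>t\<in>T. q t ^ \<beta> t) - w \<beta>))"
    unfolding sum_distrib_left sum_subtractf[symmetric] by (intro sum.cong) (auto simp: algebra_simps)
  also have "\<dots> \<in> J" using w ideal by (intro ideal_sum ideal_mult_left)
  finally show ?thesis using that \<alpha>(1) unfolding K_def by blast
qed

end

section \<open>Transcendence degree and Krull dimension\<close>

definition alg_indep :: "'n set \<Rightarrow> 'n mpoly set \<Rightarrow> bool" where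
  "alg_indep B J \<longleftrightarrow> (\<forall>p \<in> polys_in B. p \<in> J \<longrightarrow> p = 0)"

definition max_indep :: "'n set \<Rightarrow> 'n mpoly set \<Rightarrow> bool" where
  "max_indep B J \<longleftrightarrow> alg_indep B J \<and> (\<forall>j. j \<notin> B \<longrightarrow> \<not> alg_indep (insert j B) J)"

definition tr_deg :: "'n mpoly set \<Rightarrow> nat" where
  "tr_deg J = Max (card ` {B. alg_indep B J})"

lemma alg_indepD: "alg_indep B J \<Longrightarrow> p \<in> polys_in B \<Longrightarrow> p \<in> J \<Longrightarrow> p = 0"
  by (auto simp: alg_indep_def)

lemma alg_indep_subset: "alg_indep B J \<Longrightarrow> B' \<subseteq> B \<Longrightarrow> alg_indep B' J"
  by (auto simp: alg_indep_def intro: polys_in_mono)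

lemma alg_indep_antimono: "alg_indep B J \<Longrightarrow> J' \<subseteq> J \<Longrightarrow> alg_indep B J'"
  by (auto simp: alg_indep_def)

lemma prime_ideal_is_ideal: "prime_ideal P \<Longrightarrow> is_ideal P"
  by (simp add: prime_ideal_def)

lemma prime_ideal_mult: "prime_ideal P \<Longrightarrow> a * b \<in> P \<Longrightarrow> a \<in> P \<or> b \<in> P"
  by (auto simp: prime_ideal_def)

lemma prime_ideal_one: "prime_ideal P \<Longrightarrow> 1 \<notin> P"
  unfolding prime_ideal_def is_ideal_def by (metis UNIV_eq_I mult.right_neutral)

lemma prime_ideal_power: "prime_ideal P \<Longrightarrow> a ^ k \<in> P \<Longrightarrow> a \<in> P"
  by (induction k) (auto simp: prime_ideal_one dest: prime_ideal_mult)

lemma prime_ideal_prod: "finite A \<Longrightarrow> prime_ideal P \<Longrightarrow> prod f A \<in> P \<Longrightarrow> \<exists>i\<in>A. f i \<in> P"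
  by (induction A rule: finite_induct) (auto simp: prime_ideal_one dest: prime_ideal_mult)

lemma alg_indep_empty:
  assumes "prime_ideal P"
  shows "alg_indep {} P"
  unfolding alg_indep_def
proof (intro ballI impI)
  fix p :: "'a mpoly" assume p: "p \<in> polys_in {}" "p \<in> P"
  have "\<exists>c. p = mconst c"
    using p(1) by (induction rule: polys_in.induct) (auto simp: mconst_add[symmetric] mconst_mult[symmetric])
  then obtain c where c: "p = mconst c" by blast
  show "p = 0"
  proof (rule ccontr)
    assume "p \<noteq> 0"
    then have "c \<noteq> 0" using c by auto
    then have "mconst (1 / c) * p = 1" unfolding c mconst_mult[symmetric] by simp
    then have "1 \<in> P" using ideal_mult_left[OF prime_ideal_is_ideal[OF assms] p(2)] by metis
    then show False using prime_ideal_one[OF assms] by blast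
  qed
qed

lemma max_indep_extend:
  fixes B :: "'n::finite set"
  assumes "alg_indep B J"
  obtains B' where "B \<subseteq> B'" "max_indep B' J"
proof -
  let ?S = "{B'. B \<subseteq> B' \<and> alg_indep B' J}"
  have "finite (card ` ?S)" "card ` ?S \<noteq> {}" using assms by auto
  then obtain B' where B': "B' \<in> ?S" "card B' = Max (card ` ?S)" by (metis (no_types, lifting) Max_in imageE)
  have "\<not> alg_indep (insert j B') J" if "j \<notin> B'" for j
  proof
    assume "alg_indep (insert j B') J"
    then have "insert j B' \<in> ?S" using B'(1) by auto
    then have "card (insert j B') \<le> card B'" unfolding B'(2) by (intro Max_ge) auto
    then show False using that by simp
  qed
  then show ?thesis using that B' by (auto simp: max_indep_def)
qed

lemma tr_deg_ge:
  fixes B :: "'n::finite set"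
  shows "alg_indep B J \<Longrightarrow> card B \<le> tr_deg J"
  unfolding tr_deg_def by (intro Max_ge) auto

lemma tr_deg_attained:
  fixes P :: "'n::finite mpoly set"
  assumes "prime_ideal P"
  obtains B where "alg_indep B P" "card B = tr_deg P"
proof -
  have "card ` {B. alg_indep B P} \<noteq> {}" using alg_indep_empty[OF assms] by blast
  then have "tr_deg P \<in> card ` {B. alg_indep B P}" unfolding tr_deg_def by (intro Max_in) auto
  then show ?thesis using that by auto
qed

section \<open>Algebraic relations over an independent set of variables\<close>

lemma degree_formal_deriv:
  fixes h :: "'n::finite mpoly poly"
  assumes "degree h > 0"
  shows "formal_deriv h \<noteq> 0" "degree (formal_deriv h) < degree h"
proof -
  have "coeff (formal_deriv h) (degree h - 1) = of_nat (degree h) * lead_coeff h"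
    using assms by (simp add: coeff_formal_deriv)
  moreover have "lead_coeff h \<noteq> 0" using assms by auto
  ultimately have "coeff (formal_deriv h) (degree h - 1) \<noteq> 0"
    using assms mpoly_mult_eq_0 by force
  then show "formal_deriv h \<noteq> 0" by auto
  have "degree (formal_deriv h) \<le> degree h - 1"
    by (rule degree_le) (auto simp: coeff_formal_deriv coeff_eq_0)
  then show "degree (formal_deriv h) < degree h" using assms by simp
qed

text \<open>In a relation of least degree the formal derivative is nonzero, by characteristic zero,
  and of smaller degree, so it is not a relation. The statement is about a set \<open>J\<close>
  because \<open>manifold_alg_indep\<close> applies it to a union of vanishing ideals.\<close>

lemma minimal_relation:
  fixes J :: "'n::finite mpoly set"
  assumes "alg_indep B J" "\<not> alg_indep (insert j B) J"
  obtains h where "coeffs_in B h" "degree h > 0" "poly h (mvar j) \<in> J" "poly (formal_deriv h) (mvar j) \<notin> J"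
proof -
  define R where "R h \<longleftrightarrow> coeffs_in B h \<and> h \<noteq> 0 \<and> poly h (mvar j) \<in> J" for h
  obtain p where p: "p \<in> polys_in (insert j B)" "p \<in> J" "p \<noteq> 0" using assms(2) by (auto simp: alg_indep_def)
  obtain h0 where "coeffs_in B h0" "p = poly h0 (mvar j)" using polys_in_insert_poly[OF p(1)] by blast
  then have "R h0" using p by (auto simp: R_def)
  then obtain h where h: "R h" "\<And>g. R g \<Longrightarrow> degree h \<le> degree g"
    using ex_has_least_nat[of R h0 degree] by blast
  have pos: "degree h > 0"
  proof (rule ccontr)
    assume "\<not> ?thesis"
    then obtain a where "h = [:a:]" by (metis degree_eq_zeroE neq0_conv)
    then show False using h(1) alg_indepD[OF assms(1)] by (auto simp: R_def)
  qed
  have "\<not> R (formal_deriv h)" using h(2)[of "formal_deriv h"] degree_formal_deriv(2)[OF pos] by auto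
  then have "poly (formal_deriv h) (mvar j) \<notin> J"
    using degree_formal_deriv(1)[OF pos] h(1) coeffs_in_formal_deriv by (auto simp: R_def)
  then show ?thesis using that h(1) pos by (auto simp: R_def)
qed

lemma exponent_bound:
  fixes F :: "'n::finite mpoly set"
  assumes "finite F"
  obtains e where "\<And>p m i. p \<in> F \<Longrightarrow> m \<in> Poly_Mapping.keys p \<Longrightarrow> Poly_Mapping.lookup m i \<le> e"
proof -
  let ?E = "(\<lambda>(m, i). Poly_Mapping.lookup m i) ` ((\<Union>p\<in>F. Poly_Mapping.keys p) \<times> UNIV)"
  have "finite ?E" using assms by auto
  then obtain e where e: "\<forall>x\<in>?E. x \<le> e" using finite_nat_set_iff_bounded_le by blast
  show ?thesis
  proof (rule that)
    fix p m i assume "p \<in> F" "m \<in> Poly_Mapping.keys p"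
    then have "Poly_Mapping.lookup m i \<in> ?E" by (intro image_eqI[of _ _ "(m, i)"]) auto
    then show "Poly_Mapping.lookup m i \<le> e" using e by blast
  qed
qed

text \<open>Multiplying each relation by the leading coefficients of all the others gives them the
  common leading coefficient \<open>c\<close>.\<close>

lemma reduction_exists:
  fixes h :: "'n::finite \<Rightarrow> 'n mpoly poly"
  assumes "is_ideal J"
    and h: "\<And>j. j \<notin> B \<Longrightarrow> coeffs_in B (h j)" "\<And>j. j \<notin> B \<Longrightarrow> degree (h j) > 0"
      "\<And>j. j \<notin> B \<Longrightarrow> poly (h j) (mvar j) \<in> J"
  obtains c k u e where "reduction J B c k u e" "c \<noteq> 0"
proof -
  define c where "c = (\<Prod>j\<in>-B. lead_coeff (h j))"
  define r where "r j = (\<Prod>l\<in>-B-{j}. lead_coeff (h l))" for j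
  define u where "u j i = - (r j * coeff (h j) i)" for j i
  define k where "k j = degree (h j)" for j
  have c_eq: "c = lead_coeff (h j) * r j" if "j \<notin> B" for j
    unfolding c_def r_def using that by (intro prod.remove) auto
  have r_in: "r j \<in> polys_in B" for j unfolding r_def using h(1) by (intro polys_in_prod) (auto simp: coeffs_in_def)
  have c_in: "c \<in> polys_in B" unfolding c_def using h(1) by (intro polys_in_prod) (auto simp: coeffs_in_def)
  obtain e where e: "\<And>p m i. p \<in> insert c (\<Union>j. u j ` {..<k j}) \<Longrightarrow> m \<in> Poly_Mapping.keys p \<Longrightarrow> Poly_Mapping.lookup m i \<le> e"
    by (rule exponent_bound[of "insert c (\<Union>j. u j ` {..<k j})"]) auto
  have "reduction J B c k u e"
  proof
    show "is_ideal J" by fact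
    show "c \<in> polys_in B" by (rule c_in)
    show "k j > 0" if "j \<notin> B" for j using h(2) that by (simp add: k_def)
    show "u j i \<in> polys_in B" if "j \<notin> B" for i j
      using h(1)[OF that] r_in by (auto simp: u_def coeffs_in_def)
    show "c * mvar j ^ k j - (\<Sum>i<k j. u j i * mvar j ^ i) \<in> J" if "j \<notin> B" for j
    proof -
      have "r j * poly (h j) (mvar j) = r j * ((\<Sum>i<k j. coeff (h j) i * mvar j ^ i) + lead_coeff (h j) * mvar j ^ k j)"
        unfolding poly_altdef k_def by (simp add: lessThan_Suc_atMost[symmetric])
      also have "\<dots> = c * mvar j ^ k j - (\<Sum>i<k j. u j i * mvar j ^ i)"
        by (simp add: u_def c_eq[OF that] algebra_simps sum_distrib_left sum_negf)
      finally show ?thesis using ideal_mult_left[OF assms(1) h(3)[OF that]] by metis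
    qed
    show "Poly_Mapping.lookup m i \<le> e" if "m \<in> Poly_Mapping.keys c" for m i using e that by blast
    show "Poly_Mapping.lookup m i \<le> e" if "j \<notin> B" "l < k j" "m \<in> Poly_Mapping.keys (u j l)" for j l m i
      using e[of "u j l"] that by blast
  qed
  moreover have "c \<noteq> 0" unfolding c_def using h(2) by (intro mpoly_prod_neq_0) fastforce
  ultimately show ?thesis using that by blast
qed

lemma prod_mvar_power:
  "(\<Prod>b\<in>S. mvar b ^ \<beta> b) = mono_poly (\<Sum>b\<in>S. Poly_Mapping.single b (\<beta> b))"
  by (simp add: mono_poly_sum mono_poly_single)

lemma lookup_sum_single:
  "finite S \<Longrightarrow> Poly_Mapping.lookup (\<Sum>b\<in>S. Poly_Mapping.single b (\<beta> b)) i = (if i \<in> S then \<beta> i else 0)"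
  by (simp add: lookup_sum lookup_single when_def)

text \<open>The \<open>card B + 1\<close> polynomials are \<open>q\<close>, indexed by
  \<open>None\<close>, and the variables of \<open>B\<close>; their relation is then sorted by
  powers of \<open>q\<close>.\<close>

lemma (in reduction) algebraic_over:
  assumes "c \<noteq> 0"
  obtains g where "coeffs_in B g" "g \<noteq> 0" "poly g q \<in> J"
proof -
  define T :: "'n option set" where "T = insert None (Some ` B)"
  define qq where "qq t = (case t of None \<Rightarrow> q | Some b \<Rightarrow> mvar b)" for t
  have "card T = Suc (card B)" unfolding T_def by (subst card_insert_disjoint) (auto simp: card_image)
  then have "finite T" "card B < card T" by (auto simp: T_def)
  then obtain N D \<alpha> \<beta>0 where r: "\<beta>0 \<in> PiE T (\<lambda>_. {..D})" "\<alpha> \<beta>0 \<noteq> (0::real)"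
    "c ^ N * (\<Sum>\<beta>\<in>PiE T (\<lambda>_. {..D}). mconst (\<alpha> \<beta>) * (\<Prod>t\<in>T. qq t ^ \<beta> t)) \<in> J"
    by (rule algebraic_relation[where q = qq])
  define K where "K = PiE T (\<lambda>_. {..D})"
  define g where "g \<beta> = (\<Sum>b\<in>B. Poly_Mapping.single b (\<beta> (Some b)))" for \<beta> :: "'n option \<Rightarrow> nat"
  have finK: "finite K" unfolding K_def by (intro finite_PiE) auto
  have prod: "(\<Prod>t\<in>T. qq t ^ \<beta> t) = q ^ \<beta> None * mono_poly (g \<beta>)" for \<beta>
  proof -
    have "(\<Prod>t\<in>T. qq t ^ \<beta> t) = qq None ^ \<beta> None * (\<Prod>t\<in>Some ` B. qq t ^ \<beta> t)"
      unfolding T_def by (subst prod.insert) auto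
    also have "(\<Prod>t\<in>Some ` B. qq t ^ \<beta> t) = (\<Prod>b\<in>B. mvar b ^ \<beta> (Some b))"
      by (subst prod.reindex) (auto simp: qq_def)
    finally show ?thesis by (simp add: qq_def g_def mono_poly_sum mono_poly_single)
  qed
  define G where "G = (\<Sum>\<beta>\<in>K. monom (c ^ N * (mconst (\<alpha> \<beta>) * mono_poly (g \<beta>))) (\<beta> None))"
  have "poly G q = c ^ N * (\<Sum>\<beta>\<in>K. mconst (\<alpha> \<beta>) * (\<Prod>t\<in>T. qq t ^ \<beta> t))"
    unfolding G_def poly_sum poly_monom prod sum_distrib_left by (intro sum.cong) (auto simp: mult_ac)
  then have "poly G q \<in> J" using r(3) by (simp add: K_def)
  moreover have "coeffs_in B G"
    unfolding coeffs_in_def G_def coeff_sum coeff_monom g_def prod_mvar_power[symmetric]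
    using c_in by (intro allI polys_in_sum) (auto intro!: polys_in.mult polys_in_power polys_in_prod)
  moreover have "G \<noteq> 0"
  proof
    assume "G = 0"
    \<comment> \<open>Terms with the same power of \<open>q\<close> carry distinct monomials in
      \<open>B\<close>, so the coefficient of \<open>q ^ \<beta>0 None\<close> cannot
      cancel.\<close>
    define K0 where "K0 = {\<beta> \<in> K. \<beta> None = \<beta>0 None}"
    have "0 = coeff G (\<beta>0 None)" using \<open>G = 0\<close> by simp
    also have "\<dots> = (\<Sum>\<beta>\<in>K. if \<beta> None = \<beta>0 None then c ^ N * (mconst (\<alpha> \<beta>) * mono_poly (g \<beta>)) else 0)"
      unfolding G_def coeff_sum coeff_monom by (intro sum.cong) auto
    also have "\<dots> = (\<Sum>\<beta>\<in>K0. c ^ N * (mconst (\<alpha> \<beta>) * mono_poly (g \<beta>)))"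
      unfolding K0_def using finK by (subst sum.inter_filter) auto
    also have "\<dots> = c ^ N * (\<Sum>\<beta>\<in>K0. mconst (\<alpha> \<beta>) * mono_poly (g \<beta>))" by (simp add: sum_distrib_left)
    finally have "(\<Sum>\<beta>\<in>K0. mconst (\<alpha> \<beta>) * mono_poly (g \<beta>)) = 0"
      using mpoly_mult_eq_0 mpoly_power_neq_0[OF assms] by metis
    moreover have "(\<Sum>\<beta>\<in>K0. mconst (\<alpha> \<beta>) * mono_poly (g \<beta>)) \<noteq> 0"
    proof (rule mono_combination_neq_0)
      show "finite K0" using finK by (simp add: K0_def)
      show "\<beta>0 \<in> K0" "\<alpha> \<beta>0 \<noteq> 0" using r by (auto simp: K0_def K_def)
      show "inj_on g K0"
      proof (rule inj_onI)
        fix \<beta> \<gamma> assume *: "\<beta> \<in> K0" "\<gamma> \<in> K0" "g \<beta> = g \<gamma>"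
        have "\<beta> (Some b) = \<gamma> (Some b)" if "b \<in> B" for b
          using arg_cong[OF *(3), of "\<lambda>m. Poly_Mapping.lookup m b"] that by (simp add: g_def lookup_sum_single)
        then show "\<beta> = \<gamma>"
          using * unfolding K0_def K_def by (intro PiE_ext[of \<beta> T "\<lambda>_. {..D}" \<gamma>]) (auto simp: T_def)
      qed
    qed
    ultimately show False by blast
  qed
  ultimately show ?thesis using that by blast
qed

text \<open>Splitting off the power of \<open>q\<close> forces a nonzero constant term, which is
  what later meets the independence of \<open>B\<close>.\<close>

lemma lowest_coefficient:
  fixes h :: "'n::finite mpoly poly"
  assumes "h \<noteq> 0" "coeffs_in B h"
  obtains N g where "coeffs_in B g" "coeff g 0 \<noteq> 0" "\<And>q. poly h q = q ^ N * poly g q"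
proof -
  have "\<exists>N g. coeffs_in B g \<and> coeff g 0 \<noteq> 0 \<and> (\<forall>q. poly h q = q ^ N * poly g q)"
    using assms
  proof (induction h)
    case (pCons a h)
    show ?case
    proof (cases "a = 0")
      case False
      then show ?thesis using pCons.prems by (intro exI[of _ 0] exI[of _ "pCons a h"]) auto
    next
      case True
      then obtain N g where "coeffs_in B g" "coeff g 0 \<noteq> 0" "\<forall>q. poly h q = q ^ N * poly g q"
        using pCons by auto
      then show ?thesis using True by (intro exI[of _ "Suc N"] exI[of _ g]) (auto simp: mult.assoc)
    qed
  qed simp
  then show ?thesis using that by blast
qed

lemma max_indep_reduction:
  fixes P :: "'n::finite mpoly set"
  assumes "is_ideal P" "max_indep B P"
  obtains c k u e where "reduction P B c k u e" "c \<noteq> 0"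
proof -
  have "\<forall>j. \<exists>h. j \<notin> B \<longrightarrow> coeffs_in B h \<and> degree h > 0 \<and> poly h (mvar j) \<in> P"
    using assms(2) minimal_relation[of B P] unfolding max_indep_def by metis
  then obtain h where "\<And>j. j \<notin> B \<Longrightarrow> coeffs_in B (h j)" "\<And>j. j \<notin> B \<Longrightarrow> degree (h j) > 0"
    "\<And>j. j \<notin> B \<Longrightarrow> poly (h j) (mvar j) \<in> P" by metis
  then show ?thesis using reduction_exists[OF assms(1), of B h] that by metis
qed

text \<open>The point is the constant term: it differs from \<open>poly g q\<close> by a multiple of
  \<open>q\<close>, so it lies in every ideal that contains \<open>P\<close> and \<open>q\<close>,
  and vanishes at every common zero of them. The factor \<open>q ^ N\<close> cancels because
  \<open>P\<close> is prime.\<close>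

lemma algebraic_mod_prime:
  fixes P :: "'n::finite mpoly set"
  assumes P: "prime_ideal P" and B: "max_indep B P" and q: "q \<notin> P"
  obtains g where "coeffs_in B g" "coeff g 0 \<noteq> 0" "poly g q \<in> P"
proof -
  obtain c k u e where red: "reduction P B c k u e" "c \<noteq> 0"
    using max_indep_reduction[OF prime_ideal_is_ideal[OF P] B] by blast
  obtain h where h: "coeffs_in B h" "h \<noteq> 0" "poly h q \<in> P"
    using reduction.algebraic_over[OF red] by blast
  obtain N g where g: "coeffs_in B g" "coeff g 0 \<noteq> 0" "\<And>q. poly h q = q ^ N * poly g q"
    using lowest_coefficient[OF h(2,1)] by blast
  have "poly g q \<in> P" using h(3) g(3) prime_ideal_mult[OF P] prime_ideal_power[OF P] q by metis
  then show ?thesis using that g by blast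
qed

text \<open>Counting replaces the exchange property: a larger \<open>B'\<close> would satisfy a
  relation with factor \<open>c ^ N\<close>, which cancels because \<open>c\<close> is a nonzero
  element of \<real>[B].\<close>

lemma card_alg_indep_le:
  fixes P :: "'n::finite mpoly set"
  assumes P: "prime_ideal P" and B: "max_indep B P" and B': "alg_indep B' P"
  shows "card B' \<le> card B"
proof (rule ccontr)
  assume less: "\<not> ?thesis"
  obtain c k u e where red: "reduction P B c k u e" "c \<noteq> 0"
    using max_indep_reduction[OF prime_ideal_is_ideal[OF P] B] by blast
  have cP: "c \<notin> P" using red B reduction.c_in[OF red(1)] alg_indepD by (auto simp: max_indep_def)
  have "finite B'" "card B < card B'" using less by auto
  then obtain N D \<alpha> \<beta>0 where r: "\<beta>0 \<in> PiE B' (\<lambda>_. {..D})" "\<alpha> \<beta>0 \<noteq> (0::real)"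
    "c ^ N * (\<Sum>\<beta>\<in>PiE B' (\<lambda>_. {..D}). mconst (\<alpha> \<beta>) * (\<Prod>t\<in>B'. mvar t ^ \<beta> t)) \<in> P"
    by (rule reduction.algebraic_relation[OF red(1), where q = mvar])
  define f where "f = (\<Sum>\<beta>\<in>PiE B' (\<lambda>_. {..D}). mconst (\<alpha> \<beta>) * (\<Prod>t\<in>B'. mvar t ^ \<beta> t))"
  have "c ^ N \<notin> P" using prime_ideal_power[OF P] cP by blast
  then have "f \<in> P" using prime_ideal_mult[OF P r(3)] unfolding f_def by blast
  moreover have "f \<in> polys_in B'" unfolding f_def by (auto intro!: polys_in_sum polys_in.mult polys_in_prod polys_in_power)
  moreover have "f \<noteq> 0"
    unfolding f_def prod_mvar_power
  proof (rule mono_combination_neq_0)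
    show "finite (PiE B' (\<lambda>_. {..D}))" by (intro finite_PiE) auto
    show "\<beta>0 \<in> PiE B' (\<lambda>_. {..D})" "\<alpha> \<beta>0 \<noteq> 0" using r by auto
    show "inj_on (\<lambda>\<beta>. \<Sum>b\<in>B'. Poly_Mapping.single b (\<beta> b)) (PiE B' (\<lambda>_. {..D}))"
    proof (rule inj_onI)
      fix \<beta> \<gamma> assume *: "\<beta> \<in> PiE B' (\<lambda>_. {..D})" "\<gamma> \<in> PiE B' (\<lambda>_. {..D})"
        "(\<Sum>b\<in>B'. Poly_Mapping.single b (\<beta> b)) = (\<Sum>b\<in>B'. Poly_Mapping.single b (\<gamma> b))"
      have "\<beta> b = \<gamma> b" if "b \<in> B'" for b
        using arg_cong[OF *(3), of "\<lambda>m. Poly_Mapping.lookup m b"] that by (simp add: lookup_sum_single)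
      then show "\<beta> = \<gamma>" using * by (intro PiE_ext[of \<beta> B' "\<lambda>_. {..D}" \<gamma>]) auto
    qed
  qed
  ultimately show False using alg_indepD[OF B'] by blast
qed

lemma card_max_indep:
  fixes P :: "'n::finite mpoly set"
  assumes "prime_ideal P" "max_indep B P"
  shows "card B = tr_deg P"
  using tr_deg_attained[OF assms(1)] card_alg_indep_le[OF assms] tr_deg_ge[of B P] assms(2)
  by (metis antisym max_indep_def)

lemma max_indep_if_card:
  fixes P :: "'n::finite mpoly set"
  assumes "alg_indep B P" "card B = tr_deg P"
  shows "max_indep B P"
  unfolding max_indep_def
proof (intro conjI allI impI notI)
  fix j assume "j \<notin> B" "alg_indep (insert j B) P"
  then show False using tr_deg_ge[of "insert j B" P] assms by simp
qed (fact assms(1))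

text \<open>If the degrees agreed, a set \<open>B\<close> independent modulo \<open>Q\<close> would
  be maximal for \<open>P\<close>. For \<open>q\<close> in \<open>Q\<close> but not in
  \<open>P\<close>, the constant term of its relation would then be a nonzero element of \<real>[B]
  in \<open>Q\<close>.\<close>

lemma tr_deg_strict:
  fixes P Q :: "'n::finite mpoly set"
  assumes P: "prime_ideal P" and Q: "prime_ideal Q" and PQ: "P \<subset> Q"
  shows "tr_deg Q < tr_deg P"
proof -
  obtain B where B: "alg_indep B Q" "card B = tr_deg Q" using tr_deg_attained[OF Q] .
  have BP: "alg_indep B P" using B(1) PQ alg_indep_antimono by blast
  have "tr_deg P \<noteq> card B"
  proof
    assume "tr_deg P = card B"
    then have max: "max_indep B P" using max_indep_if_card BP by metis
    obtain q where q: "q \<in> Q" "q \<notin> P" using PQ by blast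
    obtain g where g: "coeffs_in B g" "coeff g 0 \<noteq> 0" "poly g q \<in> P"
      using algebraic_mod_prime[OF P max q(2)] .
    obtain a g' where "g = pCons a g'" by (cases g) auto
    then have "a = poly g q - q * poly g' q" "a \<noteq> 0" "a \<in> polys_in B" using g by auto
    then have "a \<in> Q" using g(3) q(1) PQ prime_ideal_is_ideal[OF Q]
      by (auto intro!: ideal_diff ideal_mult_right)
    then show False using alg_indepD[OF B(1)] \<open>a \<noteq> 0\<close> \<open>a \<in> polys_in B\<close> by blast
  qed
  then show ?thesis using tr_deg_ge[OF BP] B(2) by simp
qed

text \<open>Krull's argument: by Zorn there is an ideal maximal among those containing
  \<open>J\<close> and disjoint from the multiplicative set \<open>T\<close>, and such an ideal is
  prime.\<close>

lemma prime_ideal_avoiding: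
  fixes J T :: "'a::comm_ring_1 set"
  assumes J: "is_ideal J" "J \<inter> T = {}" and T: "1 \<in> T" "\<And>a b. a \<in> T \<Longrightarrow> b \<in> T \<Longrightarrow> a * b \<in> T"
  obtains Q where "prime_ideal Q" "J \<subseteq> Q" "Q \<inter> T = {}"
proof -
  define \<A> where "\<A> = {Q. is_ideal Q \<and> J \<subseteq> Q \<and> Q \<inter> T = {}}"
  have "\<exists>M\<in>\<A>. \<forall>X\<in>\<A>. M \<subseteq> X \<longrightarrow> X = M"
  proof (rule subset_Zorn_nonempty)
    show "\<A> \<noteq> {}" using J by (auto simp: \<A>_def)
    fix \<C> assume C: "\<C> \<noteq> {}" "subset.chain \<A> \<C>"
    then have sub: "\<C> \<subseteq> \<A>" and lin: "\<And>X Y. X \<in> \<C> \<Longrightarrow> Y \<in> \<C> \<Longrightarrow> X \<subseteq> Y \<or> Y \<subseteq> X"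
      by (auto simp: subset.chain_def)
    have "is_ideal (\<Union>\<C>)"
      unfolding is_ideal_def
    proof (intro conjI ballI allI)
      show "0 \<in> \<Union>\<C>" using C(1) sub by (force simp: \<A>_def is_ideal_def)
    next
      fix a b assume "a \<in> \<Union>\<C>" "b \<in> \<Union>\<C>"
      then obtain X Y where XY: "X \<in> \<C>" "Y \<in> \<C>" "a \<in> X" "b \<in> Y" by blast
      then obtain Z where "Z \<in> \<C>" "a \<in> Z" "b \<in> Z" using lin[of X Y] by blast
      moreover have "is_ideal Z" using \<open>Z \<in> \<C>\<close> sub by (auto simp: \<A>_def)
      ultimately show "a + b \<in> \<Union>\<C>" using ideal_add by blast
    next
      fix a r assume "a \<in> \<Union>\<C>"
      then obtain Z where Z: "Z \<in> \<C>" "a \<in> Z" by blast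
      then have "is_ideal Z" using sub by (auto simp: \<A>_def)
      then show "r * a \<in> \<Union>\<C>" using ideal_mult_left Z by blast
    qed
    then show "\<Union>\<C> \<in> \<A>" using C(1) sub by (auto simp: \<A>_def)
  qed
  then obtain M where M: "is_ideal M" "J \<subseteq> M" "M \<inter> T = {}"
    and max: "\<And>X. is_ideal X \<Longrightarrow> M \<subseteq> X \<Longrightarrow> X \<inter> T = {} \<Longrightarrow> X = M"
    by (auto simp: \<A>_def)
  \<comment> \<open>By maximality, the ideal generated by \<open>M\<close> and \<open>a\<close>
    meets \<open>T\<close>.\<close>
  have key: "\<exists>m\<in>M. \<exists>r. m + r * a \<in> T" if "a \<notin> M" for a
  proof -
    define X where "X = {m + r * a | m r. m \<in> M}"
    have "is_ideal X"
      unfolding is_ideal_def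
    proof (intro conjI ballI allI)
      show "0 \<in> X" unfolding X_def using ideal_0[OF M(1)] by (intro CollectI exI[of _ 0]) auto
    next
      fix x y assume "x \<in> X" "y \<in> X"
      then obtain m r m' r' where "x = m + r * a" "y = m' + r' * a" "m \<in> M" "m' \<in> M" by (auto simp: X_def)
      then show "x + y \<in> X" unfolding X_def using ideal_add[OF M(1)]
        by (intro CollectI exI[of _ "m + m'"] exI[of _ "r + r'"]) (auto simp: algebra_simps)
    next
      fix x s assume "x \<in> X"
      then obtain m r where "x = m + r * a" "m \<in> M" by (auto simp: X_def)
      then show "s * x \<in> X" unfolding X_def using ideal_mult_left[OF M(1)]
        by (intro CollectI exI[of _ "s * m"] exI[of _ "s * r"]) (auto simp: algebra_simps)
    qed
    moreover have "M \<subseteq> X" unfolding X_def by (force intro: exI[of _ 0])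
    moreover have "a \<in> X" unfolding X_def using ideal_0[OF M(1)] by (intro CollectI exI[of _ 0] exI[of _ 1]) auto
    ultimately have "X \<inter> T \<noteq> {}" using max[of X] that by blast
    then show ?thesis by (auto simp: X_def)
  qed
  have "prime_ideal M"
    unfolding prime_ideal_def
  proof (intro conjI allI impI)
    show "M \<noteq> UNIV" using M(3) T(1) by blast
    fix a b assume ab: "a * b \<in> M"
    show "a \<in> M \<or> b \<in> M"
    proof (rule ccontr)
      assume "\<not> ?thesis"
      then obtain m r m' r' where mr: "m \<in> M" "m' \<in> M" "m + r * a \<in> T" "m' + r' * b \<in> T"
        using key by blast
      have "(m + r * a) * (m' + r' * b) = m * (m' + r' * b) + (r * a) * m' + (r * r') * (a * b)"
        by (simp add: algebra_simps)
      also have "\<dots> \<in> M" using ideal_add[OF M(1)] ideal_mult_left[OF M(1)] ideal_mult_right[OF M(1)] mr(1,2) ab by simp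
      finally show False using T(2)[OF mr(3,4)] M(3) by blast
    qed
  qed (fact M(1))
  then show ?thesis using that M by blast
qed

text \<open>If every \<open>x\<^sub>b - \<nu>\<close> became a unit modulo \<open>P\<close> after inverting the polynomials in
  \<open>B - {b}\<close>, there would be uncountably many linearly independent inverses in a space of
  countable dimension.\<close>

lemma exists_hyperplane:
  fixes P :: "'n::finite mpoly set"
  assumes P: "is_ideal P" and B: "alg_indep B P" "b \<in> B"
  obtains \<nu> :: real where "\<And>s g. s \<in> polys_in (B - {b}) \<Longrightarrow> s - (mvar b - mconst \<nu>) * g \<in> P \<Longrightarrow> s = 0"
proof (rule ccontr)
  assume neg: "\<not> thesis"
  have "\<exists>s g. s \<in> polys_in (B - {b}) \<and> s - (mvar b - mconst \<nu>) * g \<in> P \<and> s \<noteq> 0" for \<nu>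
    using neg that[of \<nu>] by blast
  then obtain s g where sg: "\<And>\<nu>. s \<nu> \<in> polys_in (B - {b})"
    "\<And>\<nu>. s \<nu> - (mvar b - mconst \<nu>) * g \<nu> \<in> P" "\<And>\<nu>. s \<nu> \<noteq> 0" by metis
  have "\<exists>D. \<forall>m\<in>Poly_Mapping.keys (g \<nu>). \<forall>i. Poly_Mapping.lookup m i \<le> D" for \<nu>
    using exponent_bound[of "{g \<nu>}"] by (metis finite.emptyI finite_insert singletonI)
  then obtain D where D: "\<And>\<nu> m i. m \<in> Poly_Mapping.keys (g \<nu>) \<Longrightarrow> Poly_Mapping.lookup m i \<le> D \<nu>" by metis
  \<comment> \<open>Uncountably many \<nu> share countably many exponent bounds, so one bound serves
    infinitely many of them.\<close>
  have "\<exists>d. infinite {\<nu>. D \<nu> = d}"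
  proof (rule ccontr)
    assume "\<nexists>d. infinite {\<nu>. D \<nu> = d}"
    then have "countable (\<Union>d. {\<nu>. D \<nu> = d})" by (intro countable_UN) (auto intro: countable_finite)
    moreover have "(\<Union>d. {\<nu>. D \<nu> = d}) = (UNIV :: real set)" by auto
    ultimately show False using uncountable_UNIV_real by simp
  qed
  then obtain d where d: "infinite {\<nu>. D \<nu> = d}" by blast
  define M :: "('n \<Rightarrow>\<^sub>0 nat) set" where "M = box_monos UNIV d (\<lambda>_. 0)"
  have finM: "finite M" using box_monos_card(1) by (simp add: M_def)
  obtain L where L: "finite L" "card L = Suc (card M)" "L \<subseteq> {\<nu>. D \<nu> = d}"
    using infinite_arbitrarily_large[OF d] by blast
  obtain \<alpha> where \<alpha>: "\<exists>\<nu>\<in>L. \<alpha> \<nu> \<noteq> 0" "\<And>m. m \<in> M \<Longrightarrow> (\<Sum>\<nu>\<in>L. \<alpha> \<nu> * Poly_Mapping.lookup (g \<nu>) m) = 0"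
    using exists_real_dependence[OF finM L(1), of "\<lambda>\<nu> m. Poly_Mapping.lookup (g \<nu>) m"] L(2) by auto
  have zero: "(\<Sum>\<nu>\<in>L. mconst (\<alpha> \<nu>) * g \<nu>) = 0"
  proof (rule poly_mapping_eqI)
    fix m
    show "Poly_Mapping.lookup (\<Sum>\<nu>\<in>L. mconst (\<alpha> \<nu>) * g \<nu>) m = Poly_Mapping.lookup 0 m"
    proof (cases "m \<in> M")
      case True
      then show ?thesis using \<alpha>(2) by (simp add: lookup_sum lookup_mconst_mult)
    next
      case False
      then have "Poly_Mapping.lookup (g \<nu>) m = 0" if "\<nu> \<in> L" for \<nu>
        using that L(3) D[of m \<nu>] by (force simp: M_def box_monos_def in_keys_iff)
      then show ?thesis by (simp add: lookup_sum lookup_mconst_mult)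
    qed
  qed
  define l where "l \<mu> = mvar b - mconst \<mu>" for \<mu> :: real
  \<comment> \<open>Modulo \<open>P\<close>, \<open>g \<nu>\<close> plays the role of the fraction
    of \<open>s \<nu>\<close> by \<open>l \<nu>\<close>. The dependence of the
    \<open>g \<nu>\<close>, multiplied by all \<open>l \<mu>\<close>, becomes a polynomial relation
    with value in \<real>[B].\<close>
  define f where "f = (\<Sum>\<nu>\<in>L. mconst (\<alpha> \<nu>) * s \<nu> * (\<Prod>\<mu>\<in>L-{\<nu>}. l \<mu>))"
  have "f = f - (\<Prod>\<mu>\<in>L. l \<mu>) * (\<Sum>\<nu>\<in>L. mconst (\<alpha> \<nu>) * g \<nu>)" by (simp add: zero)
  also have "\<dots> = (\<Sum>\<nu>\<in>L. mconst (\<alpha> \<nu>) * (\<Prod>\<mu>\<in>L-{\<nu>}. l \<mu>) * (s \<nu> - l \<nu> * g \<nu>))"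
    unfolding f_def sum_distrib_left sum_subtractf[symmetric]
    by (intro sum.cong) (auto simp: prod.remove[OF L(1)] algebra_simps)
  also have "\<dots> \<in> P" using sg(2) P by (intro ideal_sum ideal_mult_left) (auto simp: l_def)
  finally have "f \<in> P" .
  moreover have "f \<in> polys_in B"
  proof -
    have "s \<nu> \<in> polys_in B" for \<nu> using sg(1) polys_in_mono by blast
    then show ?thesis unfolding f_def l_def using B(2) by (auto intro!: polys_in_sum polys_in.mult polys_in_prod polys_in_diff)
  qed
  ultimately have f0: "f = 0" using alg_indepD[OF B(1)] by blast
  obtain \<nu> where \<nu>: "\<nu> \<in> L" "\<alpha> \<nu> \<noteq> 0" using \<alpha>(1) by blast
  have "s \<nu> = 0"
  proof (rule peval_eq_0_imp)
    fix x :: "real^'n"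
    \<comment> \<open>At x_b = \<nu> only the term of \<nu> survives in \<open>f\<close>, and
      \<open>s \<nu>\<close> does not involve x_b.\<close>
    define y :: "real^'n" where "y = (\<chi> i. if i = b then \<nu> else x $ i)"
    have "0 = peval f y" using f0 by simp
    also have "\<dots> = (\<Sum>\<kappa>\<in>L. if \<kappa> = \<nu> then \<alpha> \<nu> * peval (s \<nu>) y * (\<Prod>\<mu>\<in>L-{\<nu>}. \<nu> - \<mu>) else 0)"
      unfolding f_def peval_sum
    proof (intro sum.cong refl)
      fix \<kappa> assume \<kappa>: "\<kappa> \<in> L"
      show "peval (mconst (\<alpha> \<kappa>) * s \<kappa> * (\<Prod>\<mu>\<in>L-{\<kappa>}. l \<mu>)) y
        = (if \<kappa> = \<nu> then \<alpha> \<nu> * peval (s \<nu>) y * (\<Prod>\<mu>\<in>L-{\<nu>}. \<nu> - \<mu>) else 0)"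
        using L(1) \<nu>(1) by (auto simp: l_def y_def)
    qed
    also have "\<dots> = \<alpha> \<nu> * peval (s \<nu>) y * (\<Prod>\<mu>\<in>L-{\<nu>}. \<nu> - \<mu>)" using L(1) \<nu>(1) by simp
    finally have "peval (s \<nu>) y = 0" using \<nu>(2) L(1) by auto
    moreover have "peval (s \<nu>) x = peval (s \<nu>) y" by (rule peval_cong[OF sg(1)]) (auto simp: y_def)
    ultimately show "peval (s \<nu>) x = 0" by simp
  qed
  then show False using sg(3) by blast
qed

text \<open>The zero set is cut with the hyperplane x_b = \<nu>. The set \<open>J\<close> below is
  the ideal P + (x_b - \<nu>), and a prime above it that avoids the nonzero polynomials in
  \<open>B - {b}\<close> keeps these variables independent.\<close>

lemma exists_larger_prime:
  fixes P :: "'n::finite mpoly set"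
  assumes P: "prime_ideal P" and B: "alg_indep B P" "b \<in> B"
  obtains Q where "prime_ideal Q" "P \<subset> Q" "alg_indep (B - {b}) Q"
proof -
  note iP = prime_ideal_is_ideal[OF P]
  obtain \<nu> where \<nu>: "\<And>s g. s \<in> polys_in (B - {b}) \<Longrightarrow> s - (mvar b - mconst \<nu>) * g \<in> P \<Longrightarrow> s = 0"
    using exists_hyperplane[OF iP B] by blast
  define l where "l = mvar b - mconst \<nu>"
  define J where "J = {p. \<exists>g. p - l * g \<in> P}"
  have "is_ideal J"
    unfolding is_ideal_def
  proof (intro conjI ballI allI)
    show "0 \<in> J" unfolding J_def using ideal_0[OF iP] by (intro CollectI exI[of _ 0]) simp
  next
    fix x y assume "x \<in> J" "y \<in> J"
    then obtain g h where "x - l * g \<in> P" "y - l * h \<in> P" by (auto simp: J_def)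
    then have "(x - l * g) + (y - l * h) \<in> P" by (rule ideal_add[OF iP])
    then show "x + y \<in> J" unfolding J_def by (intro CollectI exI[of _ "g + h"]) (simp add: algebra_simps)
  next
    fix x r assume "x \<in> J"
    then obtain g where "x - l * g \<in> P" by (auto simp: J_def)
    then have "r * (x - l * g) \<in> P" by (rule ideal_mult_left[OF iP])
    then show "r * x \<in> J" unfolding J_def by (intro CollectI exI[of _ "r * g"]) (simp add: algebra_simps)
  qed
  moreover define T where "T = polys_in (B - {b}) - {0}"
  have "J \<inter> T = {}" using \<nu> by (auto simp: J_def T_def l_def)
  moreover have "1 \<in> T" "\<And>x y. x \<in> T \<Longrightarrow> y \<in> T \<Longrightarrow> x * y \<in> T"
    by (auto simp: T_def dest: mpoly_mult_eq_0)
  ultimately obtain Q where Q: "prime_ideal Q" "J \<subseteq> Q" "Q \<inter> T = {}"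
    by (rule prime_ideal_avoiding)
  have "P \<subseteq> J" unfolding J_def by (auto intro: exI[of _ 0])
  moreover have "l \<in> J" unfolding J_def using ideal_0[OF iP] by (intro CollectI exI[of _ 1]) simp
  moreover have "l \<notin> P"
  proof
    assume "l \<in> P"
    moreover have "l \<in> polys_in B" using B(2) by (auto simp: l_def)
    ultimately have "l = 0" using alg_indepD[OF B(1)] by blast
    then have "peval l (\<chi> i. \<nu> + 1) = 0" by simp
    then show False by (simp add: l_def)
  qed
  ultimately have "P \<subset> Q" using Q(2) by blast
  moreover have "alg_indep (B - {b}) Q" using Q(3) by (auto simp: alg_indep_def T_def)
  ultimately show ?thesis using that Q(1) by blast
qed

text \<open>Along a chain \<open>tr_deg\<close> drops strictly, which bounds the length and makes
  the supremum a maximum; conversely each use of \<open>exists_larger_prime\<close> spends only one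
  variable of a basis.\<close>

theorem krull_dim_eq_tr_deg:
  fixes P :: "'n::finite mpoly set"
  assumes P: "prime_ideal P"
  shows "krull_dim P = tr_deg P"
proof -
  define chain where "chain P d Q \<longleftrightarrow> (\<forall>i\<le>d. prime_ideal (Q i)) \<and> P \<subseteq> Q 0 \<and> (\<forall>i<d. Q i \<subset> Q (Suc i))"
    for P :: "'n mpoly set" and d :: nat and Q
  have le: "d \<le> tr_deg P" if "chain P d Q" for d Q
  proof -
    have "tr_deg (Q i) + i \<le> tr_deg (Q 0)" if "i \<le> d" for i
      using that
    proof (induction i)
      case (Suc i)
      then have "tr_deg (Q (Suc i)) < tr_deg (Q i)" using \<open>chain P d Q\<close> by (intro tr_deg_strict) (auto simp: chain_def)
      then show ?case using Suc by simp
    qed simp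
    from this[of d] have "d \<le> tr_deg (Q 0)" by simp
    also have "\<dots> \<le> tr_deg P"
    proof (cases "P = Q 0")
      case False
      then have "P \<subset> Q 0" "prime_ideal (Q 0)" using that by (auto simp: chain_def)
      then show ?thesis using tr_deg_strict[OF P] by (simp add: less_imp_le)
    qed simp
    finally show ?thesis .
  qed
  have ex: "\<exists>Q. chain P d Q" if "prime_ideal P" "alg_indep B P" "card B = d" for P B d
    using that
  proof (induction d arbitrary: P B)
    case 0
    then show ?case by (intro exI[of _ "\<lambda>_. P"]) (auto simp: chain_def)
  next
    case (Suc d)
    then obtain b where b: "b \<in> B" by fastforce
    obtain P' where P': "prime_ideal P'" "P \<subset> P'" "alg_indep (B - {b}) P'"
      using exists_larger_prime[OF Suc.prems(1,2) b] .
    have "card (B - {b}) = d" using b Suc.prems by simp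
    then obtain Q where Q: "chain P' d Q" using Suc.IH[OF P'(1,3)] by blast
    define Q' where "Q' i = (case i of 0 \<Rightarrow> P | Suc j \<Rightarrow> Q j)" for i
    have "chain P (Suc d) Q'"
      unfolding chain_def
    proof (intro conjI allI impI)
      fix i assume "i \<le> Suc d"
      then show "prime_ideal (Q' i)" using Q Suc.prems(1) by (cases i) (auto simp: Q'_def chain_def)
    next
      fix i assume "i < Suc d"
      then show "Q' i \<subset> Q' (Suc i)" using Q P'(2) by (cases i) (auto simp: Q'_def chain_def)
    qed (simp add: Q'_def)
    then show ?case by blast
  qed
  obtain B where "alg_indep B P" "card B = tr_deg P" using tr_deg_attained[OF P] .
  then have "\<exists>Q. chain P (tr_deg P) Q" using ex P by blast
  then have "Sup {d. \<exists>Q. chain P d Q} = tr_deg P" by (intro cSup_eq_maximum) (auto dest: le)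
  then show ?thesis by (simp add: krull_dim_def chain_def)
qed

section \<open>Derivations\<close>

lemma peval_mvar_has_derivative:
  fixes x :: "real^'n::finite"
  shows "(peval (mvar j) has_derivative (\<lambda>v. \<Sum>i\<in>UNIV. peval (if i = j then 1 else 0) x * v $ i)) (at x)"
proof -
  have "(\<lambda>v. \<Sum>i\<in>UNIV. peval (if i = j then 1 else 0) x * v $ i) = (\<lambda>v. v $ j)"
  proof
    fix v :: "real^'n"
    have "(\<Sum>i\<in>UNIV. peval (if i = j then 1 else 0) x * v $ i) = (\<Sum>i\<in>UNIV. if i = j then v $ i else 0)"
      by (intro sum.cong) auto
    then show "(\<Sum>i\<in>UNIV. peval (if i = j then 1 else 0) x * v $ i) = v $ j" by simp
  qed
  then show ?thesis
    by (simp add: peval_mvar[abs_def] bounded_linear_imp_has_derivative bounded_linear_vec_nth)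
qed

lemma peval_has_derivative_exists:
  fixes p :: "'n::finite mpoly"
  shows "\<exists>G. \<forall>x. (peval p has_derivative (\<lambda>v. \<Sum>i\<in>UNIV. peval (G i) x * v $ i)) (at x)"
proof (induction p rule: mpoly_induct)
  case (const c)
  show ?case by (rule exI[of _ "\<lambda>_. 0"]) (simp add: peval_mconst[abs_def])
next
  case (var j)
  show ?case by (intro exI[of _ "\<lambda>i. if i = j then 1 else 0"] allI peval_mvar_has_derivative)
next
  case (add p q)
  then obtain G H where G: "\<And>x. (peval p has_derivative (\<lambda>v. \<Sum>i\<in>UNIV. peval (G i) x * v $ i)) (at x)"
    and H: "\<And>x. (peval q has_derivative (\<lambda>v. \<Sum>i\<in>UNIV. peval (H i) x * v $ i)) (at x)" by blast
  have "(peval (p + q) has_derivative (\<lambda>v. \<Sum>i\<in>UNIV. peval (G i + H i) x * v $ i)) (at x)" for x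
    using has_derivative_add[OF G H, of x] by (simp add: sum.distrib algebra_simps peval_add[abs_def])
  then show ?case by (intro exI[of _ "\<lambda>i. G i + H i"]) blast
next
  case (mult p q)
  then obtain G H where G: "\<And>x. (peval p has_derivative (\<lambda>v. \<Sum>i\<in>UNIV. peval (G i) x * v $ i)) (at x)"
    and H: "\<And>x. (peval q has_derivative (\<lambda>v. \<Sum>i\<in>UNIV. peval (H i) x * v $ i)) (at x)" by blast
  have "(peval (p * q) has_derivative (\<lambda>v. \<Sum>i\<in>UNIV. peval (G i * q + p * H i) x * v $ i)) (at x)" for x
  proof -
    have "(\<lambda>v. \<Sum>i\<in>UNIV. peval (G i * q + p * H i) x * v $ i) =
       (\<lambda>v. peval p x * (\<Sum>i\<in>UNIV. peval (H i) x * v $ i) + (\<Sum>i\<in>UNIV. peval (G i) x * v $ i) * peval q x)"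
      by (rule ext) (simp add: sum.distrib algebra_simps sum_distrib_left)
    moreover have "peval (p * q) = (\<lambda>x. peval p x * peval q x)" by (rule ext) simp
    ultimately show ?thesis using has_derivative_mult[OF G H, of x] by simp
  qed
  then show ?case by (intro exI[of _ "\<lambda>i. G i * q + p * H i"]) blast
qed

text \<open>The polynomials representing the Frechet derivative. They are unique because polynomials
  are determined by their values, so the rules of differentiation carry over through
  \<open>pd_eqI\<close>.\<close>

definition pd :: "'n::finite \<Rightarrow> 'n mpoly \<Rightarrow> 'n mpoly" where
  "pd i p = (SOME G. \<forall>x. (peval p has_derivative (\<lambda>v. \<Sum>i\<in>UNIV. peval (G i) x * v $ i)) (at x)) i"

lemma peval_has_derivative:
  "(peval p has_derivative (\<lambda>v. \<Sum>i\<in>UNIV. peval (pd i p) x * v $ i)) (at x)"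
  using someI_ex[OF peval_has_derivative_exists[of p]] unfolding pd_def by blast

lemma sum_axis: "(\<Sum>i\<in>UNIV. f i * axis k (1::real) $ i) = (f k :: real)"
proof -
  have "(\<Sum>i\<in>UNIV. f i * axis k (1::real) $ i) = (\<Sum>i\<in>UNIV. if i = k then f i else 0)"
    by (intro sum.cong) (auto simp: axis_def)
  then show ?thesis by simp
qed

lemma pd_eqI:
  assumes "\<And>x. (peval p has_derivative (\<lambda>v. \<Sum>i\<in>UNIV. peval (G i) x * v $ i)) (at x)"
  shows "pd i p = G i"
proof (rule peval_inject)
  fix x
  have "(\<lambda>v. \<Sum>i\<in>UNIV. peval (pd i p) x * v $ i) = (\<lambda>v. \<Sum>i\<in>UNIV. peval (G i) x * v $ i)"
    using has_derivative_unique[OF peval_has_derivative assms] .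
  from fun_cong[OF this, of "axis i 1"] show "peval (pd i p) x = peval (G i) x"
    by (simp only: sum_axis)
qed

lemma pd_mconst [simp]: "pd i (mconst c) = 0"
  by (rule pd_eqI[where G = "\<lambda>_. 0"]) (simp add: peval_mconst[abs_def])

lemma pd_mvar: "pd i (mvar j) = (if i = j then 1 else 0)"
  by (rule pd_eqI[where G = "\<lambda>i. if i = j then 1 else 0", OF peval_mvar_has_derivative])

lemma pd_add: "pd i (p + q) = pd i p + pd i q"
proof (rule pd_eqI[where G = "\<lambda>i. pd i p + pd i q"])
  show "(peval (p + q) has_derivative (\<lambda>v. \<Sum>i\<in>UNIV. peval (pd i p + pd i q) x * v $ i)) (at x)" for x
    using has_derivative_add[OF peval_has_derivative[of p x] peval_has_derivative[of q x]]
    by (simp add: sum.distrib algebra_simps peval_add[abs_def])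
qed

lemma pd_mult: "pd i (p * q) = pd i p * q + p * pd i q"
proof (rule pd_eqI[where G = "\<lambda>i. pd i p * q + p * pd i q"])
  fix x
  have "(\<lambda>v. \<Sum>i\<in>UNIV. peval (pd i p * q + p * pd i q) x * v $ i) =
     (\<lambda>v. peval p x * (\<Sum>i\<in>UNIV. peval (pd i q) x * v $ i) + (\<Sum>i\<in>UNIV. peval (pd i p) x * v $ i) * peval q x)"
    by (rule ext) (simp add: sum.distrib algebra_simps sum_distrib_left)
  moreover have "peval (p * q) = (\<lambda>x. peval p x * peval q x)" by (rule ext) simp
  ultimately show "(peval (p * q) has_derivative (\<lambda>v. \<Sum>i\<in>UNIV. peval (pd i p * q + p * pd i q) x * v $ i)) (at x)"
    using has_derivative_mult[OF peval_has_derivative[of p x] peval_has_derivative[of q x]] by simp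
qed

lemma pgrad_eq: "pgrad p x = (\<chi> i. peval (pd i p) x)"
proof -
  have "deriv (\<lambda>s. peval p (x + s *\<^sub>R axis i 1)) 0 = peval (pd i p) x" for i
  proof (rule DERIV_imp_deriv)
    have "((\<lambda>s. x + s *\<^sub>R axis i 1) has_derivative (\<lambda>s. s *\<^sub>R axis i 1)) (at (0::real))"
      by (auto intro!: derivative_eq_intros)
    moreover have "(peval p has_derivative (\<lambda>v. \<Sum>l\<in>UNIV. peval (pd l p) x * v $ l)) (at (x + 0 *\<^sub>R axis i 1))"
      using peval_has_derivative[of p x] by simp
    ultimately have "((\<lambda>s. peval p (x + s *\<^sub>R axis i 1)) has_derivative
        (\<lambda>s. \<Sum>l\<in>UNIV. peval (pd l p) x * (s *\<^sub>R axis i 1) $ l)) (at 0)"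
      using has_derivative_compose[of "\<lambda>s. x + s *\<^sub>R axis i 1"] by blast
    moreover have "(\<Sum>l\<in>UNIV. peval (pd l p) x * (s *\<^sub>R axis i 1) $ l) = peval (pd i p) x * s" for s
    proof -
      have "(\<Sum>l\<in>UNIV. peval (pd l p) x * (s *\<^sub>R axis i 1) $ l) = s * (\<Sum>l\<in>UNIV. peval (pd l p) x * axis i 1 $ l)"
        by (simp add: sum_distrib_left algebra_simps)
      then show ?thesis by (simp only: sum_axis mult.commute)
    qed
    ultimately show "((\<lambda>s. peval p (x + s *\<^sub>R axis i 1)) has_field_derivative peval (pd i p) x) (at 0)"
      by (simp add: has_field_derivative_def)
  qed
  then show ?thesis by (simp add: pgrad_def)
qed

lemma pd_polys_in: "p \<in> polys_in B \<Longrightarrow> i \<notin> B \<Longrightarrow> pd i p = 0"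
  by (induction rule: polys_in.induct) (auto simp: pd_mvar pd_add pd_mult)

lemma pd_poly_mvar:
  assumes "coeffs_in B h" "j \<notin> B"
  shows "pd j (poly h (mvar j)) = poly (formal_deriv h) (mvar j)"
  using assms(1)
proof (induction h)
  case 0
  then show ?case using pd_mconst[of j 0] by (simp add: formal_deriv_def)
next
  case (pCons a h)
  then have "pd j a = 0" using pd_polys_in assms(2) by auto
  then show ?case using pCons by (simp add: pd_add pd_mult pd_mvar formal_deriv_pCons)
qed

section \<open>Polynomial vector fields acting on ideals\<close>

definition vf :: "('n \<Rightarrow> 'n mpoly) \<Rightarrow> 'n::finite mpoly \<Rightarrow> 'n mpoly" where
  "vf v p = (\<Sum>i\<in>UNIV. v i * pd i p)"

lemma vf_add: "vf v (p + q) = vf v p + vf v q"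
  by (simp add: vf_def pd_add algebra_simps sum.distrib)

lemma vf_mult: "vf v (p * q) = vf v p * q + p * vf v q"
  by (simp add: vf_def pd_mult algebra_simps sum.distrib sum_distrib_left)

lemma vf_0: "vf v 0 = 0"
  using vf_add[of v 0 0] by simp

lemma vf_mvar: "vf v (mvar j) = v j"
proof -
  have "vf v (mvar j) = (\<Sum>i\<in>UNIV. if i = j then v i else 0)"
    unfolding vf_def by (intro sum.cong) (auto simp: pd_mvar)
  then show ?thesis by simp
qed

lemma vf_power: "vf v (p ^ Suc N) = of_nat (Suc N) * p ^ N * vf v p"
proof (induction N)
  case 0
  then show ?case by simp
next
  case (Suc N)
  have "vf v (p ^ Suc (Suc N)) = vf v p * p ^ Suc N + p * vf v (p ^ Suc N)"
    by (simp add: vf_mult power_Suc[of p "Suc N"] del: power_Suc)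
  also have "\<dots> = of_nat (Suc (Suc N)) * p ^ Suc N * vf v p"
    by (simp only: Suc) (simp add: algebra_simps)
  finally show ?case .
qed

lemma of_nat_mult_in_ideal:
  assumes "is_ideal P" "of_nat (Suc N) * (a :: 'n mpoly) \<in> P"
  shows "a \<in> P"
proof -
  have "mconst (1 / real (Suc N)) * of_nat (Suc N) = 1"
    unfolding mconst_of_nat[symmetric] mconst_mult[symmetric] by simp
  then have "a = mconst (1 / real (Suc N)) * (of_nat (Suc N) * a)" by (metis mult.assoc mult_1)
  then show ?thesis using ideal_mult_left[OF assms] by metis
qed

text \<open>In characteristic zero a derivation that maps \<open>J\<close> into itself also preserves the
  minimal primes over \<open>J\<close>; the last hypothesis expresses minimality of \<open>P\<close> locally.\<close>

lemma vf_preserves_minimal_prime: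
  fixes P :: "'n::finite mpoly set"
  assumes P: "prime_ideal P" and J: "is_ideal J" "J \<subseteq> P" "\<And>q. q \<in> J \<Longrightarrow> vf v q \<in> J"
    and s: "s \<notin> P" "s * p ^ N \<in> J"
  shows "vf v p \<in> P"
  using s
proof (induction N arbitrary: s)
  case 0
  then show ?case using J(2) by auto
next
  case (Suc N)
  \<comment> \<open>The extra factor \<open>s\<close> turns the term containing
    \<open>vf v s\<close> into a multiple of \<open>s * p ^ Suc N\<close>. What remains has exponent
    \<open>N\<close> and the new multiplier \<open>s * s * vf v p\<close>.\<close>
  have "s * (vf v (s * p ^ Suc N)) \<in> J" using Suc.prems(2) J by (intro ideal_mult_left) auto
  moreover have "s * vf v (s * p ^ Suc N) = vf v s * (s * p ^ Suc N) + of_nat (Suc N) * (s * s * vf v p * p ^ N)"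
    unfolding vf_mult vf_power by (simp add: algebra_simps)
  moreover have "vf v s * (s * p ^ Suc N) \<in> J" by (rule ideal_mult_left[OF J(1) Suc.prems(2)])
  ultimately have "of_nat (Suc N) * (s * s * vf v p * p ^ N) \<in> J"
    using ideal_diff[OF J(1)] by (metis add_diff_cancel_left')
  then have *: "s * s * vf v p * p ^ N \<in> J" by (rule of_nat_mult_in_ideal[OF J(1)])
  show ?case
  proof (rule ccontr)
    assume "vf v p \<notin> P"
    then have "s * s * vf v p \<notin> P" using Suc.prems(1) prime_ideal_mult[OF P] by blast
    then show False using Suc.IH[of "s * s * vf v p"] * \<open>vf v p \<notin> P\<close> by blast
  qed
qed

lemma ideal_gen_is_ideal: "is_ideal (ideal_gen G)"
  unfolding ideal_gen_def by (auto simp: is_ideal_def)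

lemma ideal_gen_superset: "G \<subseteq> ideal_gen G"
  unfolding ideal_gen_def by auto

lemma ideal_gen_least: "is_ideal J \<Longrightarrow> G \<subseteq> J \<Longrightarrow> ideal_gen G \<subseteq> J"
  unfolding ideal_gen_def by auto

lemma vf_ideal_gen:
  assumes "\<And>g. g \<in> G \<Longrightarrow> vf v g = 0" "q \<in> ideal_gen G"
  shows "vf v q \<in> ideal_gen G"
proof -
  let ?J = "{q \<in> ideal_gen G. vf v q \<in> ideal_gen G}"
  note I = ideal_gen_is_ideal[of G]
  have "is_ideal ?J"
    unfolding is_ideal_def
    by (auto simp: vf_0 vf_add vf_mult intro!: ideal_add[OF I] ideal_mult_left[OF I] ideal_0[OF I])
  moreover have "G \<subseteq> ?J" using assms(1) ideal_gen_superset[of G] ideal_0[OF I] by auto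
  ultimately show ?thesis using ideal_gen_least[of ?J G] assms(2) by blast
qed

text \<open>The vector fields \<open>field b\<close> are the coordinate derivations \<open>\<partial>/\<partial>x\<^sub>b\<close> of the function field of \<open>P\<close>
  with respect to the transcendence basis \<open>B\<close>, cleared of denominators.\<close>

locale relations =
  fixes P :: "'n::finite mpoly set" and B :: "'n set" and h :: "'n \<Rightarrow> 'n mpoly poly"
  assumes prime: "prime_ideal P" and indep: "alg_indep B P"
    and h_in: "\<And>j. j \<notin> B \<Longrightarrow> coeffs_in B (h j)"
    and h_deg: "\<And>j. j \<notin> B \<Longrightarrow> degree (h j) > 0"
    and h_rel: "\<And>j. j \<notin> B \<Longrightarrow> poly (h j) (mvar j) \<in> P"
    and h_sep: "\<And>j. j \<notin> B \<Longrightarrow> poly (formal_deriv (h j)) (mvar j) \<notin> P"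
begin

definition H where "H j = poly (h j) (mvar j)"
definition dd where "dd j = pd j (H j)"
definition \<delta> where "\<delta> = (\<Prod>j\<in>-B. dd j)"
text \<open>Implicit differentiation of \<open>H i = 0\<close> gives dx_i/dx_b = -
  \<open>pd b (H i)\<close> / \<open>dd i\<close>, since \<open>H i\<close> involves only x_i
  besides the variables of \<open>B\<close>; all components are multiplied by \<delta>.\<close>

definition field where
  "field b i = (if i = b then \<delta> else if i \<in> B then 0 else - (pd b (H i) * (\<Prod>l\<in>-B-{i}. dd l)))"

lemma H_in: "j \<notin> B \<Longrightarrow> H j \<in> polys_in (insert j B)"
  unfolding H_def using h_in by (intro polys_in_poly) (auto intro: coeffs_in_mono)

lemma dd_notin: "j \<notin> B \<Longrightarrow> dd j \<notin> P"
  unfolding dd_def H_def using pd_poly_mvar[OF h_in] h_sep by simp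

lemma \<delta>_notin: "\<delta> \<notin> P"
  unfolding \<delta>_def using prime_ideal_prod[OF _ prime, of "-B" dd] dd_notin by auto

lemma field_H:
  assumes "b \<in> B" "j \<notin> B"
  shows "vf (field b) (H j) = 0"
proof -
  have "field b i * pd i (H j) = 0" if "i \<notin> {b, j}" for i
    using that pd_polys_in[OF H_in[OF assms(2)], of i] by (cases "i \<in> B") (auto simp: field_def)
  then have "vf (field b) (H j) = (\<Sum>i\<in>{b, j}. field b i * pd i (H j))"
    unfolding vf_def by (intro sum.mono_neutral_right) auto
  also have "\<dots> = \<delta> * pd b (H j) - pd b (H j) * (\<Prod>l\<in>-B-{j}. dd l) * dd j"
  proof -
    have "b \<noteq> j" using assms by auto
    moreover from this have "(\<Sum>i\<in>{b, j}. field b i * pd i (H j)) = field b b * pd b (H j) + field b j * dd j"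
      by (simp add: dd_def)
    ultimately show ?thesis using assms by (simp add: field_def)
  qed
  also have "\<delta> = dd j * (\<Prod>l\<in>-B-{j}. dd l)"
    unfolding \<delta>_def using assms by (intro prod.remove) auto
  finally show ?thesis by (simp add: algebra_simps)
qed

text \<open>The field kills the generators \<open>H j\<close> of \<open>J\<close>, so it preserves
  \<open>J\<close>. Counting modulo \<open>J\<close> instead of \<open>P\<close> puts
  \<open>poly g p * p ^ N\<close> into \<open>J\<close>, and its first factor is outside
  \<open>P\<close>, so \<open>vf_preserves_minimal_prime\<close> passes from \<open>J\<close> to
  \<open>P\<close>.\<close>

lemma field_preserves:
  assumes "b \<in> B" "p \<in> P"
  shows "vf (field b) p \<in> P"
proof -
  define J where "J = ideal_gen (H ` (-B))"
  have "H ` (-B) \<subseteq> P" using h_rel by (auto simp: H_def)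
  then have J: "is_ideal J" "J \<subseteq> P"
    using ideal_gen_is_ideal ideal_gen_least[OF prime_ideal_is_ideal[OF prime]] by (auto simp only: J_def)
  have HJ: "poly (h j) (mvar j) \<in> J" if "j \<notin> B" for j
    using that ideal_gen_superset[of "H ` (-B)"] by (auto simp: J_def H_def)
  obtain c k u e where red: "reduction J B c k u e" "c \<noteq> 0"
    using reduction_exists[OF J(1) h_in h_deg HJ] by blast
  obtain f where f: "coeffs_in B f" "f \<noteq> 0" "poly f p \<in> J"
    using reduction.algebraic_over[OF red] by blast
  obtain N g where g: "coeffs_in B g" "coeff g 0 \<noteq> 0" "\<And>q. poly f q = q ^ N * poly g q"
    using lowest_coefficient[OF f(2,1)] by blast
  obtain a g' where ag: "g = pCons a g'" by (cases g) auto
  \<comment> \<open>Since \<open>p\<close> is in \<open>P\<close>, \<open>poly g p\<close> is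
    congruent modulo \<open>P\<close> to the constant term of \<open>g\<close>, a nonzero element of
    \<real>[B].\<close>
  have "poly g p \<notin> P"
  proof
    assume "poly g p \<in> P"
    then have "poly g p - p * poly g' p \<in> P"
      using assms(2) prime_ideal_is_ideal[OF prime] by (intro ideal_diff ideal_mult_right)
    then have "a \<in> P" by (simp add: ag)
    then show False using alg_indepD[OF indep] g by (auto simp: ag)
  qed
  moreover have "poly g p * p ^ N \<in> J" using f(3) g(3) by (simp add: mult.commute)
  moreover have "vf (field b) q \<in> J" if "q \<in> J" for q
    using that field_H[OF assms(1)] unfolding J_def by (intro vf_ideal_gen) auto
  ultimately show ?thesis using vf_preserves_minimal_prime[OF prime J] by blast
qed

end

lemma relations_exist:
  fixes P :: "'n::finite mpoly set"
  assumes "prime_ideal P" "max_indep B P"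
  obtains h where "relations P B h"
proof -
  have B: "alg_indep B P" "\<And>j. j \<notin> B \<Longrightarrow> \<not> alg_indep (insert j B) P" using assms(2) by (auto simp: max_indep_def)
  have "\<exists>h. j \<notin> B \<longrightarrow> coeffs_in B h \<and> degree h > 0 \<and> poly h (mvar j) \<in> P \<and> poly (formal_deriv h) (mvar j) \<notin> P" for j
  proof (cases "j \<in> B")
    case False
    then obtain h where "coeffs_in B h" "degree h > 0" "poly h (mvar j) \<in> P" "poly (formal_deriv h) (mvar j) \<notin> P"
      using minimal_relation[OF B(1) B(2)] by blast
    then show ?thesis by blast
  qed auto
  then obtain h where h: "\<forall>j. j \<notin> B \<longrightarrow> coeffs_in B (h j) \<and> degree (h j) > 0 \<and> poly (h j) (mvar j) \<in> P
      \<and> poly (formal_deriv (h j)) (mvar j) \<notin> P" by metis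
  show ?thesis by (rule that[of h]) (use h assms(1) B(1) in \<open>simp add: relations_def\<close>)
qed

section \<open>The Jacobian criterion\<close>

text \<open>\<open>C\<close> is the adjugate, with cofactors written as determinants in which row
  \<open>k\<close> is a unit vector. Linearity in that row restores row \<open>k'\<close>, giving
  two equal rows unless \<open>k' = k\<close>. It is needed over the polynomial ring, where
  \<open>M\<close> need not be invertible.\<close>

lemma adjugate_right:
  fixes M :: "'a::comm_ring_1^'n^'n"
  shows "\<exists>C. \<forall>k k'. (\<Sum>l\<in>UNIV. M $ k' $ l * C l k) = (if k' = k then det M else 0)"
proof -
  define C where "C l k = det (\<chi> i. if i = k then axis l 1 else M $ i)" for l k
  have "(\<Sum>l\<in>UNIV. M $ k' $ l * C l k) = (if k' = k then det M else 0)" for k k'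
  proof -
    have row: "(\<Sum>l\<in>UNIV. M $ k' $ l *s axis l 1) = M $ k'"
      by (simp add: vec_eq_iff axis_def if_distrib cong: if_cong)
    have "(\<Sum>l\<in>UNIV. M $ k' $ l * C l k) = (\<Sum>l\<in>UNIV. det (\<chi> i. if i = k then M $ k' $ l *s axis l 1 else M $ i))"
      unfolding C_def by (simp add: det_row_mul)
    also have "\<dots> = det (\<chi> i. if i = k then M $ k' else M $ i)"
      by (subst det_linear_row_sum[symmetric]) (auto simp: row cong: if_cong)
    also have "\<dots> = (if k' = k then det M else 0)"
    proof (cases "k' = k")
      case True
      then have "(\<chi> i. if i = k then M $ k' else M $ i) = M" by (simp add: vec_eq_iff)
      then show ?thesis using True by simp
    next
      case False
      then have "det (\<chi> i. if i = k then M $ k' else M $ i) = 0"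
        by (intro det_identical_rows[of k k']) (auto simp: row_def)
      then show ?thesis using False by simp
    qed
    finally show ?thesis .
  qed
  then show ?thesis by blast
qed

lemma adjugate_left:
  fixes M :: "'a::comm_ring_1^'n^'n"
  shows "\<exists>C. \<forall>j l. (\<Sum>k\<in>UNIV. C j k * M $ k $ l) = (if j = l then det M else 0)"
proof -
  obtain C where C: "\<And>k k'. (\<Sum>l\<in>UNIV. transpose M $ k' $ l * C l k) = (if k' = k then det (transpose M) else 0)"
    using adjugate_right[of "transpose M"] by blast
  show ?thesis
  proof (intro exI allI)
    show "(\<Sum>k\<in>UNIV. C k j * M $ k $ l) = (if j = l then det M else 0)" for j l
      using C[of l j] unfolding det_transpose by (cases "j = l") (simp_all add: transpose_def mult.commute)
  qed
qed

lemma card_plus_card_Compl: "card Y + card (-Y) = CARD('n)" for Y :: "'n::finite set"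
  using card_Un_disjoint[of Y "-Y"] by (simp add: Compl_partition)

text \<open>Elements of \<open>P\<close> indexed by \<open>Y\<close> are completed by the remaining
  coordinates to a square system. Its Jacobian determinant is the minor of these elements in the
  columns \<open>Y\<close>, and where it is nonzero \<open>F\<close> gives local
  coordinates.\<close>

locale jacobian_chart =
  fixes P :: "'n::finite mpoly set" and Y :: "'n set" and F :: "'n \<Rightarrow> 'n mpoly"
  assumes prime: "prime_ideal P" and F_Y: "\<And>j. j \<in> Y \<Longrightarrow> F j \<in> P" and F_var: "\<And>j. j \<notin> Y \<Longrightarrow> F j = mvar j"
    and nonsing: "det ((\<chi> k l. pd l (F k)) :: 'n mpoly^'n^'n) \<notin> P"
begin

definition \<Delta> where "\<Delta> = det ((\<chi> k l. pd l (F k)) :: 'n mpoly^'n^'n)"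

lemma ideal: "is_ideal P"
  using prime by (rule prime_ideal_is_ideal)

text \<open>Cramer's rule modulo \<open>P\<close>: each \<Delta> times \<open>v l\<close> is a
  combination of the \<open>vf v (F k)\<close>, and \<Delta> is outside \<open>P\<close>.\<close>

lemma field_determined:
  assumes "\<And>k. k \<notin> Y \<Longrightarrow> v k \<in> P" "\<And>k. k \<in> Y \<Longrightarrow> vf v (F k) \<in> P"
  shows "v l \<in> P"
proof -
  let ?M = "(\<chi> k l. pd l (F k)) :: 'n mpoly^'n^'n"
  obtain C where "\<And>j l. (\<Sum>k\<in>UNIV. C j k * ?M $ k $ l) = (if j = l then det ?M else 0)"
    using adjugate_left[of ?M] by blast
  then have C: "(\<Sum>k\<in>UNIV. C j k * pd l (F k)) = (if j = l then \<Delta> else 0)" for j l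
    by (simp add: \<Delta>_def)
  have vF: "vf v (F k) \<in> P" for k
    using assms by (cases "k \<in> Y") (auto simp: F_var vf_mvar)
  have "(\<Sum>k\<in>UNIV. C l k * vf v (F k)) = (\<Sum>i\<in>UNIV. v i * (\<Sum>k\<in>UNIV. C l k * pd i (F k)))"
    unfolding vf_def sum_distrib_left by (subst sum.swap) (simp add: algebra_simps)
  also have "\<dots> = (\<Sum>i\<in>UNIV. if i = l then v i * \<Delta> else 0)" by (intro sum.cong) (auto simp: C)
  also have "\<dots> = v l * \<Delta>" by simp
  finally have "v l * \<Delta> = (\<Sum>k\<in>UNIV. C l k * vf v (F k))" ..
  also have "\<dots> \<in> P" using vF ideal by (intro ideal_sum ideal_mult_left)
  finally have "v l * \<Delta> \<in> P" .
  then show ?thesis using prime_ideal_mult[OF prime] nonsing by (auto simp: \<Delta>_def)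
qed

text \<open>Extend a maximal independent subset of the variables outside \<open>Y\<close> to a transcendence basis.
  A basis element in \<open>Y\<close> would give a derivation that kills \<open>F\<close>, hence vanishes modulo \<open>P\<close>.\<close>

lemma max_indep_subset: "\<exists>B. B \<subseteq> -Y \<and> max_indep B P"
proof -
  let ?S = "{B. B \<subseteq> -Y \<and> alg_indep B P}"
  have "finite (card ` ?S)" "card ` ?S \<noteq> {}" using alg_indep_empty[OF prime] by auto
  then have "Max (card ` ?S) \<in> card ` ?S" by (rule Max_in)
  then obtain B0 where B0: "B0 \<subseteq> -Y" "alg_indep B0 P" "card B0 = Max (card ` ?S)" by auto
  have max0: "\<not> alg_indep (insert j B0) P" if "j \<in> -Y" "j \<notin> B0" for j
  proof
    assume "alg_indep (insert j B0) P"
    then have "insert j B0 \<in> ?S" using B0 that by auto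
    then have "card (insert j B0) \<le> card B0" unfolding B0(3) by (intro Max_ge) auto
    then show False using that by simp
  qed
  obtain B where B: "B0 \<subseteq> B" "max_indep B P" using max_indep_extend[OF B0(2)] .
  have indB: "alg_indep B P" using B(2) by (simp add: max_indep_def)
  have BY: "j \<in> B0" if "j \<in> B" "j \<notin> Y" for j
    using max0[of j] that alg_indep_subset[OF indB, of "insert j B0"] B(1) by blast
  have "B \<inter> Y = {}"
  proof (rule ccontr)
    assume "B \<inter> Y \<noteq> {}"
    then obtain y where y: "y \<in> B" "y \<in> Y" by blast
    obtain h1 where h1: "relations P B h1" using relations_exist[OF prime B(2)] .
    have "\<exists>h. j \<notin> Y \<longrightarrow> j \<notin> B \<longrightarrow> coeffs_in B0 h \<and> degree h > 0 \<and> poly h (mvar j) \<in> P \<and> poly (formal_deriv h) (mvar j) \<notin> P" for j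
    proof (cases "j \<in> Y \<or> j \<in> B")
      case False
      then have "j \<in> -Y" "j \<notin> B0" using B(1) by auto
      then obtain h where "coeffs_in B0 h" "degree h > 0" "poly h (mvar j) \<in> P" "poly (formal_deriv h) (mvar j) \<notin> P"
        using minimal_relation[OF B0(2) max0] by blast
      then show ?thesis by blast
    qed auto
    then obtain h0 where h0: "\<forall>j. j \<notin> Y \<longrightarrow> j \<notin> B \<longrightarrow> coeffs_in B0 (h0 j) \<and> degree (h0 j) > 0 \<and> poly (h0 j) (mvar j) \<in> P
        \<and> poly (formal_deriv (h0 j)) (mvar j) \<notin> P" by metis
    \<comment> \<open>Outside \<open>Y\<close> the relations are taken over \<open>B0\<close>, which
      does not contain \<open>y\<close>. Hence \<open>field y\<close> has no component outside
      \<open>Y\<close>.\<close>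
    define h where "h j = (if j \<in> Y then h1 j else h0 j)" for j
    interpret relations P B h
      by unfold_locales (use h0 h1 B(1) indB prime in \<open>auto simp: h_def relations_def intro: coeffs_in_mono\<close>)
    have "field y k \<in> P" if "k \<notin> Y" for k
    proof (cases "k \<in> B")
      case True
      then show ?thesis using that y ideal_0[OF ideal] by (auto simp: field_def)
    next
      case False
      have "H k \<in> polys_in (insert k B0)"
        unfolding H_def using h0 that False by (intro polys_in_poly) (auto simp: h_def intro: coeffs_in_mono)
      moreover have "y \<notin> insert k B0" using y that B0(1) by auto
      ultimately have "pd y (H k) = 0" by (rule pd_polys_in)
      then show ?thesis using that y ideal_0[OF ideal] False by (auto simp: field_def)
    qed
    \<comment> \<open>Now \<open>field y\<close> annihilates every \<open>F k\<close> modulo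
      \<open>P\<close>, so it vanishes modulo \<open>P\<close>, although its \<open>y\<close>
      component is \<delta>.\<close>
    then have "field y y \<in> P" by (rule field_determined) (auto intro: field_preserves y F_Y)
    then show False using \<delta>_notin by (simp add: field_def)
  qed
  then show ?thesis using B(2) by blast
qed

lemma tr_deg_bound: "card Y + tr_deg P \<le> CARD('n)"
proof -
  obtain B where B: "B \<subseteq> -Y" "max_indep B P" using max_indep_subset by blast
  have "tr_deg P = card B" using card_max_indep[OF prime B(2)] by simp
  also have "card B \<le> card (-Y)" using B(1) by (intro card_mono) auto
  finally show ?thesis using card_plus_card_Compl[of Y] by simp
qed

lemma max_indep_if_eq:
  assumes "card Y + tr_deg P = CARD('n)"
  shows "max_indep (-Y) P"
proof -
  obtain B where B: "B \<subseteq> -Y" "max_indep B P" using max_indep_subset by blast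
  have "card B = card (-Y)" using card_max_indep[OF prime B(2)] assms card_plus_card_Compl[of Y] by simp
  then have "B = -Y" using B(1) by (simp add: card_subset_eq)
  then show ?thesis using B by simp
qed

text \<open>\<open>E z\<close> is a column of the adjugate, that is, \<Delta> times the coordinate
  field of direction \<open>z\<close> in the chart \<open>F\<close>. By
  \<open>field_determined\<close>, \<delta> times \<open>E z\<close> and \<Delta> times
  \<open>field z\<close> agree modulo \<open>P\<close>, and \<open>field z\<close> is known to
  preserve \<open>P\<close>.\<close>

lemma tangent_fields:
  assumes "card Y + tr_deg P = CARD('n)"
  obtains E where "\<And>z k. z \<notin> Y \<Longrightarrow> vf (E z) (F k) = (if k = z then \<Delta> else 0)"
    "\<And>z p. z \<notin> Y \<Longrightarrow> p \<in> P \<Longrightarrow> vf (E z) p \<in> P"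
proof -
  let ?M = "(\<chi> k l. pd l (F k)) :: 'n mpoly^'n^'n"
  obtain C where "\<And>k k'. (\<Sum>l\<in>UNIV. ?M $ k' $ l * C l k) = (if k' = k then det ?M else 0)"
    using adjugate_right[of ?M] by blast
  then have C: "(\<Sum>l\<in>UNIV. pd l (F k') * C l k) = (if k' = k then \<Delta> else 0)" for k k'
    by (simp add: \<Delta>_def)
  define E where "E z l = C l z" for z l
  have EF: "vf (E z) (F k) = (if k = z then \<Delta> else 0)" for z k
    using C[of k z] by (simp add: vf_def E_def mult.commute)
  obtain h where "relations P (-Y) h" using relations_exist[OF prime max_indep_if_eq[OF assms]] .
  then interpret relations P "-Y" h .
  have "vf (E z) p \<in> P" if z: "z \<notin> Y" and p: "p \<in> P" for z p
  proof -
    define v where "v l = \<delta> * E z l - \<Delta> * field z l" for l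
    have vf_v: "vf v q = \<delta> * vf (E z) q - \<Delta> * vf (field z) q" for q
      by (simp add: vf_def v_def left_diff_distrib sum_subtractf sum_distrib_left mult.assoc)
    have "v l \<in> P" for l
    proof (rule field_determined)
      fix k assume "k \<notin> Y"
      then have "E z k = (if k = z then \<Delta> else 0)" using EF[of z k] by (simp add: F_var vf_mvar)
      then show "v k \<in> P" using \<open>k \<notin> Y\<close> ideal_0[OF ideal] by (auto simp: v_def field_def)
    next
      fix k assume k: "k \<in> Y"
      then have "vf (E z) (F k) = 0" using EF z by auto
      then have "vf v (F k) = - (\<Delta> * vf (field z) (F k))" by (simp add: vf_v)
      then show "vf v (F k) \<in> P"
        using field_preserves[of z] F_Y[OF k] z ideal by (auto intro!: ideal_uminus ideal_mult_left)
    qed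
    then have "vf v p \<in> P" unfolding vf_def by (intro ideal_sum[OF ideal] ideal_mult_right[OF ideal])
    moreover have "\<Delta> * vf (field z) p \<in> P" using field_preserves[of z p] z p ideal by (auto intro: ideal_mult_left)
    ultimately have "vf v p + \<Delta> * vf (field z) p \<in> P" by (rule ideal_add[OF ideal])
    then have "\<delta> * vf (E z) p \<in> P" by (simp add: vf_v)
    then show ?thesis using prime_ideal_mult[OF prime] \<delta>_notin by blast
  qed
  then show ?thesis using that EF by blast
qed

end

section \<open>Local structure at nonsingular points\<close>

definition pmap :: "('n \<Rightarrow> 'n mpoly) \<Rightarrow> real^'n \<Rightarrow> real^'n::finite" where
  "pmap F x = (\<chi> k. peval (F k) x)"

definition jac :: "('n \<Rightarrow> 'n mpoly) \<Rightarrow> real^'n \<Rightarrow> real^'n^'n::finite" where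
  "jac F x = (\<chi> k l. peval (pd l (F k)) x)"

lemma peval_of_int [simp]: "peval (of_int z) x = of_int z"
proof -
  have "peval (of_nat k) x = of_nat k" for k by (induction k) auto
  then show ?thesis by (cases z) auto
qed

lemma peval_det: "peval (det ((\<chi> k l. pd l (F k)) :: 'n::finite mpoly^'n^'n)) x = det (jac F x)"
  by (simp add: det_def jac_def)

lemma has_derivative_pmap: "(pmap F has_derivative (\<lambda>v. jac F x *v v)) (at x)"
proof -
  have "((\<lambda>x. pmap F x \<bullet> i) has_derivative (\<lambda>v. (jac F x *v v) \<bullet> i)) (at x)" if "i \<in> Basis" for i :: "real^'a"
  proof -
    have "\<exists>k. i = axis k 1" using that by (auto simp: Basis_vec_def)
    then obtain k where "i = axis k 1" ..
    then show ?thesis using peval_has_derivative[of "F k" x]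
      by (simp add: inner_axis pmap_def jac_def matrix_vector_mult_def)
  qed
  then show ?thesis by (subst has_derivative_componentwise_within) auto
qed

lemma continuous_on_pmap: "continuous_on S (pmap F)"
  unfolding pmap_def by (intro continuous_on_vec_lambda continuous_on_peval)

lemma pmap_local_inverse:
  fixes F :: "'n::finite \<Rightarrow> 'n mpoly"
  assumes "open U" "x0 \<in> U" "invertible (jac F x0)"
  obtains U' V g g' where "open U'" "U' \<subseteq> U" "x0 \<in> U'" "open V" "pmap F x0 \<in> V"
    "homeomorphism U' V (pmap F) g"
    "\<And>y. y \<in> V \<Longrightarrow> (g has_derivative g' y) (at y)"
    "\<And>y w. y \<in> V \<Longrightarrow> jac F (g y) *v g' y w = w"
    "\<And>y v v'. y \<in> V \<Longrightarrow> jac F (g y) *v v = jac F (g y) *v v' \<Longrightarrow> v = v'"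
proof -
  define f' where "f' x = Blinfun (\<lambda>v. jac F x *v v)" for x
  have f': "blinfun_apply (f' x) = (\<lambda>v. jac F x *v v)" for x
    unfolding f'_def by (rule bounded_linear_Blinfun_apply) (rule matrix_vector_mul_bounded_linear)
  have der: "(pmap F has_derivative blinfun_apply (f' x)) (at x)" for x
    unfolding f' by (rule has_derivative_pmap)
  have cont: "continuous_on U f'"
  proof (rule continuous_on_blinfun_componentwise)
    fix i :: "real^'n"
    show "continuous_on U (\<lambda>x. blinfun_apply (f' x) i)"
      unfolding f' matrix_vector_mult_def jac_def
      by (simp, intro continuous_on_vec_lambda continuous_intros)
  qed
  obtain A where A: "A ** jac F x0 = mat 1" using assms(3) by (auto simp: invertible_def)
  define invf where "invf = Blinfun (\<lambda>v. A *v v)"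
  have invf: "blinfun_apply invf = (\<lambda>v. A *v v)"
    unfolding invf_def by (rule bounded_linear_Blinfun_apply) (rule matrix_vector_mul_bounded_linear)
  have inv: "invf o\<^sub>L f' x0 = id_blinfun"
    by (rule blinfun_eqI) (simp add: invf f' matrix_vector_mul_assoc A)
  obtain U' V g g' where *: "open U'" "U' \<subseteq> U" "x0 \<in> U'" "open V" "pmap F x0 \<in> V" "homeomorphism U' V (pmap F) g"
    "\<And>y. y \<in> V \<Longrightarrow> (g has_derivative (g' y)) (at y)"
    "\<And>y. y \<in> V \<Longrightarrow> g' y = inv (blinfun_apply (f'(g y)))"
    "\<And>y. y \<in> V \<Longrightarrow> bij (blinfun_apply (f'(g y)))"
    using inverse_function_theorem[OF assms(1) der cont assms(2) inv] by blast
  have "jac F (g y) *v g' y w = w" if "y \<in> V" for y w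
    using *(8,9)[OF that] surj_f_inv_f[of "blinfun_apply (f' (g y))" w] by (simp add: f' bij_is_surj)
  moreover have "v = v'" if "y \<in> V" "jac F (g y) *v v = jac F (g y) *v v'" for y v v'
    using *(9)[OF that(1)] that(2) by (simp add: f' bij_def inj_def)
  ultimately show ?thesis using that[OF *(1-7)] by blast
qed

text \<open>The integrating factor exp(-L t) turns \<open>u\<close> into a nonincreasing
  function.\<close>

lemma gronwall_zero:
  fixes u :: "real \<Rightarrow> real"
  assumes der: "\<And>t. 0 \<le> t \<Longrightarrow> t \<le> 1 \<Longrightarrow> (u has_real_derivative u' t) (at t)"
    and le: "\<And>t. 0 \<le> t \<Longrightarrow> t \<le> 1 \<Longrightarrow> u' t \<le> L * u t" and u0: "u 0 = 0"
  shows "u 1 \<le> 0"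
proof -
  have "exp (- L * 0) * u 0 \<ge> exp (- L * 1) * u 1"
  proof (rule DERIV_nonpos_imp_nonincreasing[where f = "\<lambda>t. exp (- L * t) * u t"])
    fix t :: real assume t: "0 \<le> t" "t \<le> 1"
    have "((\<lambda>t. exp (- L * t) * u t) has_real_derivative exp (- L * t) * (u' t - L * u t)) (at t)"
      by (auto intro!: derivative_eq_intros der t simp: algebra_simps)
    moreover have "exp (- L * t) * (u' t - L * u t) \<le> 0" using le[OF t] by (simp add: mult_nonneg_nonpos)
    ultimately show "\<exists>y. ((\<lambda>t. exp (- L * t) * u t) has_real_derivative y) (at t) \<and> y \<le> 0" by blast
  qed simp
  then have "exp (- L) * u 1 \<le> 0" by (simp add: u0)
  then show ?thesis by (simp add: mult_le_0_iff)
qed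

lemma ideal_gen_combination:
  assumes "finite G" "q \<in> ideal_gen G"
  obtains a where "q = (\<Sum>g\<in>G. a g * g)"
proof -
  let ?J = "{q. \<exists>a. q = (\<Sum>g\<in>G. a g * g)}"
  have "is_ideal ?J"
    unfolding is_ideal_def
  proof (intro conjI ballI allI)
    show "0 \<in> ?J" by (intro CollectI exI[of _ "\<lambda>_. 0"]) simp
  next
    fix p q assume "p \<in> ?J" "q \<in> ?J"
    then obtain a b where "p = (\<Sum>g\<in>G. a g * g)" "q = (\<Sum>g\<in>G. b g * g)" by blast
    then show "p + q \<in> ?J" by (intro CollectI exI[of _ "\<lambda>g. a g + b g"]) (simp add: algebra_simps sum.distrib)
  next
    fix p r assume "p \<in> ?J"
    then obtain a where "p = (\<Sum>g\<in>G. a g * g)" by blast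
    then show "r * p \<in> ?J" by (intro CollectI exI[of _ "\<lambda>g. r * a g"]) (simp add: mult.assoc sum_distrib_left)
  qed
  moreover have "G \<subseteq> ?J"
  proof
    fix g assume "g \<in> G"
    have "(\<Sum>l\<in>G. (if l = g then 1 else 0) * l) = (\<Sum>l\<in>G. if l = g then l else 0)" by (intro sum.cong) auto
    also have "\<dots> = g" using \<open>g \<in> G\<close> assms(1) by simp
    finally show "g \<in> ?J" by (intro CollectI exI[of _ "\<lambda>l. if l = g then 1 else 0"]) simp
  qed
  ultimately show ?thesis using ideal_gen_least[of ?J G] assms(2) that by blast
qed

text \<open>Uniqueness by an energy estimate: bounded coefficients make the sum of squares satisfy a
  Gronwall inequality.\<close>

lemma linear_ode_zero:
  fixes y :: "'g \<Rightarrow> real \<Rightarrow> real" and A :: "'g \<Rightarrow> 'g \<Rightarrow> real \<Rightarrow> real"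
  assumes fin: "finite G"
    and der: "\<And>g t. g \<in> G \<Longrightarrow> 0 \<le> t \<Longrightarrow> t \<le> 1 \<Longrightarrow> (y g has_real_derivative (\<Sum>k\<in>G. A g k t * y k t)) (at t)"
    and cont: "\<And>g k. g \<in> G \<Longrightarrow> k \<in> G \<Longrightarrow> continuous_on {0..1} (A g k)"
    and y0: "\<And>g. g \<in> G \<Longrightarrow> y g 0 = 0" and g: "g \<in> G"
  shows "y g 1 = 0"
proof -
  have "\<exists>K. \<forall>t\<in>{0..1}. \<bar>A a b t\<bar> \<le> K" if "a \<in> G" "b \<in> G" for a b
  proof -
    have "bounded (A a b ` {0..1})"
      using cont[OF that] by (intro compact_imp_bounded compact_continuous_image) auto
    then show ?thesis by (auto simp: bounded_iff)
  qed
  then obtain K where K: "\<And>a b t. a \<in> G \<Longrightarrow> b \<in> G \<Longrightarrow> t \<in> {0..1} \<Longrightarrow> \<bar>A a b t\<bar> \<le> K a b" by metis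
  define C where "C = (\<Sum>a\<in>G. \<Sum>b\<in>G. \<bar>K a b\<bar>)"
  have C: "\<bar>A a b t\<bar> \<le> C" if "a \<in> G" "b \<in> G" "t \<in> {0..1}" for a b t
  proof -
    have "\<bar>A a b t\<bar> \<le> \<bar>K a b\<bar>" using K[OF that] by simp
    also have "\<dots> \<le> (\<Sum>b\<in>G. \<bar>K a b\<bar>)" using fin that by (intro member_le_sum) auto
    also have "\<dots> \<le> C" unfolding C_def using fin that
      by (intro member_le_sum[where f = "\<lambda>a. \<Sum>b\<in>G. \<bar>K a b\<bar>"]) (auto intro: sum_nonneg)
    finally show ?thesis .
  qed
  have C0: "C \<ge> 0" unfolding C_def by (intro sum_nonneg) auto
  define u where "u t = (\<Sum>a\<in>G. y a t ^ 2)" for t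
  define u' where "u' t = (\<Sum>a\<in>G. 2 * y a t * (\<Sum>k\<in>G. A a k t * y k t))" for t
  have "u 1 \<le> 0"
  proof (rule gronwall_zero)
    fix t :: real assume t: "0 \<le> t" "t \<le> 1"
    show "(u has_real_derivative u' t) (at t)"
      unfolding u_def u'_def by (rule DERIV_sum) (auto intro!: derivative_eq_intros der t)
    have "u' t = (\<Sum>a\<in>G. \<Sum>k\<in>G. A a k t * (2 * y a t * y k t))"
      unfolding u'_def sum_distrib_left by (simp add: algebra_simps)
    also have "\<dots> \<le> (\<Sum>a\<in>G. \<Sum>k\<in>G. C * (y a t ^ 2 + y k t ^ 2))"
    proof (intro sum_mono)
      fix a k assume ak: "a \<in> G" "k \<in> G"
      have "A a k t * (2 * y a t * y k t) \<le> \<bar>A a k t\<bar> * \<bar>2 * y a t * y k t\<bar>"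
        by (metis abs_ge_self abs_mult)
      also have "\<dots> \<le> C * (y a t ^ 2 + y k t ^ 2)"
      proof (intro mult_mono)
        show "\<bar>A a k t\<bar> \<le> C" using C ak t by auto
        have "\<bar>2 * y a t * y k t\<bar> = 2 * \<bar>y a t\<bar> * \<bar>y k t\<bar>" by (simp add: abs_mult)
        also have "\<dots> \<le> \<bar>y a t\<bar>\<^sup>2 + \<bar>y k t\<bar>\<^sup>2" by (rule sum_squares_bound)
        finally show "\<bar>2 * y a t * y k t\<bar> \<le> y a t ^ 2 + y k t ^ 2" by simp
      qed (use C0 in auto)
      finally show "A a k t * (2 * y a t * y k t) \<le> C * (y a t ^ 2 + y k t ^ 2)" .
    qed
    \<comment> \<open>Each square occurs \<open>card G\<close> times in either position of the
      double sum.\<close>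
    also have "\<dots> = C * (2 * real (card G)) * u t"
    proof -
      have "(\<Sum>a\<in>G. \<Sum>k\<in>G. y a t ^ 2 + y k t ^ 2) = 2 * real (card G) * u t"
        by (simp add: sum.distrib u_def sum_distrib_left[symmetric])
      then show ?thesis by (simp add: sum_distrib_left[symmetric] mult.assoc)
    qed
    finally show "u' t \<le> C * (2 * real (card G)) * u t" .
  next
    show "u 0 = 0" using y0 by (simp add: u_def)
  qed
  moreover have "y g 1 ^ 2 \<le> u 1" unfolding u_def using fin g by (intro member_le_sum) auto
  ultimately have "y g 1 ^ 2 \<le> 0" by linarith
  then show ?thesis by simp
qed

context jacobian_chart
begin

text \<open>Along the curve \<open>t \<mapsto> F\<^sup>-\<^sup>1 (F x0 + t w)\<close> the generators of \<open>P\<close> satisfy a homogeneous linear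
  differential equation, because the tangent fields map \<open>P\<close> into itself.\<close>

lemma local_zero_set:
  assumes G: "finite G" "P = ideal_gen G" and dim: "card Y + tr_deg P = CARD('n)"
    and x0: "x0 \<in> zero_set P" "peval \<Delta> x0 \<noteq> 0" and U: "open U" "x0 \<in> U"
  obtains r g where "r > 0" "continuous_on (ball (pmap F x0) r) g"
    "\<And>w. norm w < r \<Longrightarrow> pmap F (g (pmap F x0 + w)) = pmap F x0 + w"
    "\<And>w. norm w < r \<Longrightarrow> (\<And>k. k \<in> Y \<Longrightarrow> w $ k = 0) \<Longrightarrow> g (pmap F x0 + w) \<in> zero_set P \<inter> U"
proof -
  define y0 where "y0 = pmap F x0"
  have "open (U \<inter> {x. peval \<Delta> x \<noteq> 0})"
    using U(1) continuous_on_peval[of UNIV \<Delta>] by (intro open_Int open_Collect_neq) auto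
  moreover have "x0 \<in> U \<inter> {x. peval \<Delta> x \<noteq> 0}" using U x0 by simp
  moreover have "invertible (jac F x0)"
    using x0(2) by (simp add: invertible_det_nz peval_det[symmetric] \<Delta>_def)
  ultimately obtain U' V g g' where inv: "open U'" "U' \<subseteq> U \<inter> {x. peval \<Delta> x \<noteq> 0}" "x0 \<in> U'" "open V" "pmap F x0 \<in> V"
    "homeomorphism U' V (pmap F) g"
    "\<And>y. y \<in> V \<Longrightarrow> (g has_derivative g' y) (at y)"
    "\<And>y w. y \<in> V \<Longrightarrow> jac F (g y) *v g' y w = w"
    "\<And>y v v'. y \<in> V \<Longrightarrow> jac F (g y) *v v = jac F (g y) *v v' \<Longrightarrow> v = v'"
    by (rule pmap_local_inverse) blast
  obtain r where r: "r > 0" "ball y0 r \<subseteq> V" using inv(4,5) unfolding open_contains_ball y0_def by blast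
  have gU: "g y \<in> U'" if "y \<in> V" for y using inv(6) that by (auto simp: homeomorphism_def)
  obtain E where E: "\<And>z k. z \<notin> Y \<Longrightarrow> vf (E z) (F k) = (if k = z then \<Delta> else 0)"
    "\<And>z p. z \<notin> Y \<Longrightarrow> p \<in> P \<Longrightarrow> vf (E z) p \<in> P"
    using tangent_fields[OF dim] by blast
  define a where "a z p = (SOME a. vf (E z) p = (\<Sum>q\<in>G. a q * q))" for z p
  have a: "vf (E z) p = (\<Sum>q\<in>G. a z p q * q)" if "z \<notin> Y" "p \<in> G" for z p
  proof -
    have "vf (E z) p \<in> ideal_gen G" using E(2)[of z p] that ideal_gen_superset[of G] G(2) by auto
    then have "\<exists>a. vf (E z) p = (\<Sum>q\<in>G. a q * q)" using ideal_gen_combination[OF G(1)] by metis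
    then show ?thesis unfolding a_def by (rule someI_ex)
  qed
  have "g (y0 + w) \<in> zero_set P" if w: "norm w < r" "\<And>k. k \<in> Y \<Longrightarrow> w $ k = 0" for w
  proof -
    define \<gamma> where "\<gamma> t = g (y0 + t *\<^sub>R w)" for t :: real
    have inV: "y0 + t *\<^sub>R w \<in> V" if "0 \<le> t" "t \<le> 1" for t :: real
    proof -
      have "norm (t *\<^sub>R w) \<le> norm w" using that by (simp add: mult_left_le_one_le)
      then have "y0 + t *\<^sub>R w \<in> ball y0 r" using w(1) by (simp add: dist_norm)
      then show ?thesis using r(2) by blast
    qed
    have \<Delta>_nz: "peval \<Delta> (\<gamma> t) \<noteq> 0" if "0 \<le> t" "t \<le> 1" for t
      using gU[OF inV[OF that]] inv(2) by (auto simp: \<gamma>_def)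
    have \<gamma>_der: "(\<gamma> has_derivative (\<lambda>s. g' (y0 + t *\<^sub>R w) (s *\<^sub>R w))) (at t)" if t: "0 \<le> t" "t \<le> 1" for t
      unfolding \<gamma>_def
      by (rule has_derivative_compose[where f = "\<lambda>t. y0 + t *\<^sub>R w", OF _ inv(7)[OF inV[OF t]]])
        (auto intro!: derivative_eq_intros)
    \<comment> \<open>Both sides have the same image under the injective Jacobian: \<Delta> times
      the velocity maps to \<Delta> times \<open>w\<close>, and so does the combination of the
      fields \<open>E z\<close>, because \<open>w\<close> has no components in
      \<open>Y\<close>.\<close>
    have velocity: "peval \<Delta> (\<gamma> t) * g' (y0 + t *\<^sub>R w) w $ l = (\<Sum>z\<in>-Y. w $ z * peval (E z l) (\<gamma> t))" if t: "0 \<le> t" "t \<le> 1" for t l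
    proof -
      let ?x = "\<gamma> t" and ?y = "y0 + t *\<^sub>R w"
      define v where "v = peval \<Delta> ?x *\<^sub>R g' ?y w"
      define v' where "v' = (\<chi> l. \<Sum>z\<in>-Y. w $ z * peval (E z l) ?x)"
      have "jac F ?x *v v = peval \<Delta> ?x *\<^sub>R w"
        using inv(8)[OF inV[OF t], of w] by (simp add: v_def \<gamma>_def matrix_vector_mult_scaleR)
      moreover have "jac F ?x *v v' = peval \<Delta> ?x *\<^sub>R w"
      proof (subst vec_eq_iff, intro allI)
        fix k
        have "(jac F ?x *v v') $ k = (\<Sum>l\<in>UNIV. peval (pd l (F k)) ?x * (\<Sum>z\<in>-Y. w $ z * peval (E z l) ?x))"
          by (simp add: jac_def matrix_vector_mult_def v'_def)
        also have "\<dots> = (\<Sum>z\<in>-Y. \<Sum>l\<in>UNIV. w $ z * (peval (E z l) ?x * peval (pd l (F k)) ?x))"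
          unfolding sum_distrib_left by (subst sum.swap) (simp add: algebra_simps)
        also have "\<dots> = (\<Sum>z\<in>-Y. w $ z * peval (vf (E z) (F k)) ?x)"
          by (simp add: vf_def sum_distrib_left)
        also have "\<dots> = (\<Sum>z\<in>-Y. if z = k then w $ z * peval \<Delta> ?x else 0)"
          by (intro sum.cong) (auto simp: E(1))
        also have "\<dots> = peval \<Delta> ?x * w $ k" using w(2)[of k] by auto
        finally show "(jac F ?x *v v') $ k = (peval \<Delta> ?x *\<^sub>R w) $ k" by simp
      qed
      ultimately have "v = v'" using inv(9)[OF inV[OF t], of v v'] by (simp add: \<gamma>_def)
      then have "v $ l = v' $ l" by simp
      then show ?thesis by (simp add: v_def v'_def)
    qed
    have der: "((\<lambda>t. peval p (\<gamma> t)) has_real_derivative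
        (\<Sum>z\<in>-Y. w $ z * peval (vf (E z) p) (\<gamma> t)) / peval \<Delta> (\<gamma> t)) (at t)" if t: "0 \<le> t" "t \<le> 1" for t p
    proof -
      let ?x = "\<gamma> t" and ?y = "y0 + t *\<^sub>R w"
      have lin: "linear (g' ?y)" using inv(7)[OF inV[OF t]] by (rule has_derivative_linear)
      have "((\<lambda>t. peval p (\<gamma> t)) has_derivative (\<lambda>s. \<Sum>l\<in>UNIV. peval (pd l p) ?x * g' ?y (s *\<^sub>R w) $ l)) (at t)"
        by (rule has_derivative_compose[OF \<gamma>_der[OF t] peval_has_derivative])
      moreover have "(\<lambda>s. \<Sum>l\<in>UNIV. peval (pd l p) ?x * g' ?y (s *\<^sub>R w) $ l)
          = (*) ((\<Sum>z\<in>-Y. w $ z * peval (vf (E z) p) ?x) / peval \<Delta> ?x)"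
      proof
        fix s
        have "(\<Sum>l\<in>UNIV. peval (pd l p) ?x * g' ?y (s *\<^sub>R w) $ l) = s * (\<Sum>l\<in>UNIV. peval (pd l p) ?x * g' ?y w $ l)"
          by (simp add: linear_cmul[OF lin] sum_distrib_left algebra_simps)
        moreover have "peval \<Delta> ?x * (\<Sum>l\<in>UNIV. peval (pd l p) ?x * g' ?y w $ l)
            = (\<Sum>l\<in>UNIV. peval (pd l p) ?x * (peval \<Delta> ?x * g' ?y w $ l))"
          by (simp add: sum_distrib_left algebra_simps)
        moreover have "\<dots> = (\<Sum>l\<in>UNIV. \<Sum>z\<in>-Y. w $ z * (peval (E z l) ?x * peval (pd l p) ?x))"
          unfolding velocity[OF t] by (simp add: sum_distrib_left algebra_simps)
        moreover have "\<dots> = (\<Sum>z\<in>-Y. w $ z * peval (vf (E z) p) ?x)"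
          by (subst sum.swap) (simp add: vf_def sum_distrib_left)
        ultimately show "(\<Sum>l\<in>UNIV. peval (pd l p) ?x * g' ?y (s *\<^sub>R w) $ l)
          = (\<Sum>z\<in>-Y. w $ z * peval (vf (E z) p) ?x) / peval \<Delta> ?x * s"
          using \<Delta>_nz[OF t] by (simp add: field_simps)
      qed
      ultimately show ?thesis by (simp only: has_field_derivative_def)
    qed
    have cont_\<gamma>: "continuous_on {0..1} \<gamma>"
    proof (rule continuous_at_imp_continuous_on, intro ballI)
      fix t :: real assume "t \<in> {0..1}"
      then show "isCont \<gamma> t" using has_derivative_continuous[OF \<gamma>_der[of t]] by simp
    qed
    have cont_p: "continuous_on {0..1} (\<lambda>t. peval p (\<gamma> t))" for p
      using continuous_on_compose2[OF continuous_on_peval[of UNIV p] cont_\<gamma>] by simp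
    \<comment> \<open>The generators along the curve form a closed linear system, with coefficients
      read off from \<open>a\<close>, and they all vanish at the starting point
      \<open>x0\<close>.\<close>
    have "peval p (\<gamma> 1) = 0" if "p \<in> G" for p
    proof (rule linear_ode_zero[OF G(1), where y = "\<lambda>p t. peval p (\<gamma> t)"
          and A = "\<lambda>p q t. (\<Sum>z\<in>-Y. w $ z * peval (a z p q) (\<gamma> t)) / peval \<Delta> (\<gamma> t)"])
      fix p t assume p: "p \<in> G" and t: "0 \<le> t" "t \<le> (1::real)"
      have "(\<Sum>z\<in>-Y. w $ z * peval (vf (E z) p) (\<gamma> t)) = (\<Sum>z\<in>-Y. w $ z * (\<Sum>q\<in>G. peval (a z p q) (\<gamma> t) * peval q (\<gamma> t)))"
        by (intro sum.cong) (auto simp: a p)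
      also have "\<dots> = (\<Sum>q\<in>G. (\<Sum>z\<in>-Y. w $ z * peval (a z p q) (\<gamma> t)) * peval q (\<gamma> t))"
        unfolding sum_distrib_left sum_distrib_right by (subst sum.swap) (simp add: mult.assoc)
      finally have "(\<Sum>z\<in>-Y. w $ z * peval (vf (E z) p) (\<gamma> t)) / peval \<Delta> (\<gamma> t)
        = (\<Sum>q\<in>G. (\<Sum>z\<in>-Y. w $ z * peval (a z p q) (\<gamma> t)) / peval \<Delta> (\<gamma> t) * peval q (\<gamma> t))"
        by (simp only: sum_divide_distrib[of _ G] times_divide_eq_left)
      then show "((\<lambda>t. peval p (\<gamma> t)) has_real_derivative
        (\<Sum>q\<in>G. (\<Sum>z\<in>-Y. w $ z * peval (a z p q) (\<gamma> t)) / peval \<Delta> (\<gamma> t) * peval q (\<gamma> t))) (at t)"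
        using der[OF t, of p] by simp
    next
      show "continuous_on {0..1} (\<lambda>t. (\<Sum>z\<in>-Y. w $ z * peval (a z p q) (\<gamma> t)) / peval \<Delta> (\<gamma> t))" for p q
        by (intro continuous_on_divide continuous_on_sum continuous_on_mult continuous_on_const cont_p) (use \<Delta>_nz in auto)
    next
      fix p assume "p \<in> G"
      moreover have "\<gamma> 0 = x0" using inv(3,6) by (simp add: \<gamma>_def y0_def homeomorphism_def)
      ultimately show "peval p (\<gamma> 0) = 0" using x0(1) ideal_gen_superset[of G] G(2) by (auto simp: zero_set_def)
    qed (rule that)
    then have "peval p (\<gamma> 1) = 0" if "p \<in> P" for p
      using ideal_gen_combination[OF G(1), of p] that G(2) by force
    then show ?thesis by (simp add: zero_set_def \<gamma>_def)
  qed
  moreover have ball: "y0 + w \<in> V" if "norm w < r" for w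
  proof -
    have "y0 + w \<in> ball y0 r" using that by (simp add: dist_norm)
    then show ?thesis using r(2) by blast
  qed
  moreover have "g (y0 + w) \<in> U" if "norm w < r" for w using gU[OF ball[OF that]] inv(2) by blast
  moreover have "pmap F (g (y0 + w)) = y0 + w" if "norm w < r" for w
    using inv(6) ball[OF that] by (auto simp: homeomorphism_def)
  moreover have "continuous_on (ball y0 r) g"
    using inv(6) r(2) by (auto simp: homeomorphism_def intro: continuous_on_subset)
  ultimately show ?thesis using that[of r g] r(1) unfolding y0_def by blast
qed

end

section \<open>Parametrized pieces of the zero set and the polynomials vanishing on them\<close>

lemma subspace_coords: "subspace {v :: real^'n. \<forall>k. k \<notin> B \<longrightarrow> v $ k = 0}"
  by (auto simp: subspace_def)

lemma dim_coords: "dim {v :: real^'n. \<forall>k. k \<notin> B \<longrightarrow> v $ k = 0} = card B"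
proof -
  let ?d = "(\<lambda>k. axis k 1) ` B :: (real^'n) set"
  have inj: "inj (\<lambda>k. axis k (1::real) :: real^'n)" by (auto simp: inj_def axis_eq_axis)
  have "(\<forall>i\<in>Basis. i \<notin> ?d \<longrightarrow> v \<bullet> i = 0) \<longleftrightarrow> (\<forall>k. k \<notin> B \<longrightarrow> v $ k = 0)" for v :: "real^'n"
    using inj by (auto simp: Basis_vec_def inner_axis inj_image_mem_iff axis_eq_axis image_iff)
  then have "{v :: real^'n. \<forall>k. k \<notin> B \<longrightarrow> v $ k = 0} = {v. \<forall>i\<in>Basis. i \<notin> ?d \<longrightarrow> v \<bullet> i = 0}" by auto
  moreover have "dim {v :: real^'n. \<forall>i\<in>Basis. i \<notin> ?d \<longrightarrow> v \<bullet> i = 0} = card ?d"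
    by (rule dim_substandard) (auto simp: Basis_vec_def)
  moreover have "card ?d = card B" using inj by (intro card_image) (auto simp: inj_on_def)
  ultimately show ?thesis by simp
qed

context jacobian_chart
begin

lemma chart_manifold:
  assumes G: "finite G" "P = ideal_gen G" and dim: "card Y + tr_deg P = CARD('n)"
    and x0: "x0 \<in> zero_set P" "peval \<Delta> x0 \<noteq> 0" and U: "open U" "x0 \<in> U"
  shows "\<exists>M. M \<subseteq> zero_set P \<inter> U \<and> M \<noteq> {} \<and> is_manifold (tr_deg P) M"
proof -
  obtain r g where g: "r > 0" "continuous_on (ball (pmap F x0) r) g"
    "\<And>w. norm w < r \<Longrightarrow> pmap F (g (pmap F x0 + w)) = pmap F x0 + w"
    "\<And>w. norm w < r \<Longrightarrow> (\<And>k. k \<in> Y \<Longrightarrow> w $ k = 0) \<Longrightarrow> g (pmap F x0 + w) \<in> zero_set P \<inter> U"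
    using local_zero_set[OF assms] by blast
  define y0 where "y0 = pmap F x0"
  define L where "L = {v :: real^'n. \<forall>k. k \<notin> -Y \<longrightarrow> v $ k = 0}"
  define O' where "O' = L \<inter> ball 0 r"
  define M where "M = (\<lambda>w. g (y0 + w)) ` O'"
  have L: "subspace L" "dim L = tr_deg P"
    using subspace_coords[of "-Y"] dim_coords[of "-Y"] dim card_plus_card_Compl[of Y] by (auto simp: L_def)
  have "homeomorphism O' M (\<lambda>w. g (y0 + w)) (\<lambda>x. pmap F x - y0)"
  proof (rule homeomorphismI)
    show "continuous_on O' (\<lambda>w. g (y0 + w))"
      by (rule continuous_on_compose2[OF g(2)]) (auto simp: O'_def y0_def dist_norm intro!: continuous_intros)
    show "continuous_on M (\<lambda>x. pmap F x - y0)" by (intro continuous_intros continuous_on_pmap)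
    show "(\<lambda>w. g (y0 + w)) ` O' \<subseteq> M" by (simp add: M_def)
    have "pmap F (g (y0 + w)) = y0 + w" if "w \<in> O'" for w using g(3)[of w] that by (auto simp: O'_def y0_def)
    then show "(\<lambda>x. pmap F x - y0) ` M \<subseteq> O'" "\<And>w. w \<in> O' \<Longrightarrow> pmap F (g (y0 + w)) - y0 = w"
      "\<And>y. y \<in> M \<Longrightarrow> g (y0 + (pmap F y - y0)) = y" by (auto simp: M_def)
  qed
  then have "M homeomorphic O'" using homeomorphic_def homeomorphic_sym by blast
  moreover have "openin (top_of_set L) O'" unfolding O'_def by (simp add: openin_open_Int)
  ultimately have "is_manifold (tr_deg P) M"
    unfolding is_manifold_def using L by (intro ballI exI[of _ M] exI[of _ O'] exI[of _ L]) auto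
  moreover have "0 \<in> O'" using g(1) L(1) by (simp add: O'_def subspace_0)
  then have "M \<noteq> {}" by (auto simp: M_def)
  moreover have "M \<subseteq> zero_set P \<inter> U" using g(4) by (auto simp: M_def O'_def L_def y0_def)
  ultimately show ?thesis by blast
qed

text \<open>For \<open>q\<close> outside \<open>P\<close> the constant term of its relation over the
  variables outside \<open>Y\<close> would vanish on the graph. The graph projects onto an open set
  of these variables, so the constant term would be zero.\<close>

lemma chart_vanishing:
  assumes G: "finite G" "P = ideal_gen G" and dim: "card Y + tr_deg P = CARD('n)"
    and x0: "x0 \<in> zero_set P" "peval \<Delta> x0 \<noteq> 0" and U: "open U" "x0 \<in> U"
    and q: "q \<in> vanishing_ideal (zero_set P \<inter> U)"
  shows "q \<in> P"
proof (rule ccontr)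
  assume "q \<notin> P"
  obtain r g where g: "r > 0" "continuous_on (ball (pmap F x0) r) g"
    "\<And>w. norm w < r \<Longrightarrow> pmap F (g (pmap F x0 + w)) = pmap F x0 + w"
    "\<And>w. norm w < r \<Longrightarrow> (\<And>k. k \<in> Y \<Longrightarrow> w $ k = 0) \<Longrightarrow> g (pmap F x0 + w) \<in> zero_set P \<inter> U"
    using local_zero_set[OF G dim x0 U] by blast
  obtain f where f: "coeffs_in (-Y) f" "coeff f 0 \<noteq> 0" "poly f q \<in> P"
    using algebraic_mod_prime[OF prime max_indep_if_eq[OF dim] \<open>q \<notin> P\<close>] .
  obtain a f' where af: "f = pCons a f'" by (cases f) auto
  have "a = 0"
  proof (rule peval_eq_0_on_ball[OF g(1), of "pmap F x0"])
    fix y assume y: "y \<in> ball (pmap F x0) r"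
    \<comment> \<open>Dropping the \<open>Y\<close> components of the displacement leads to a point
      of the zero set without changing the coordinates on which \<open>a\<close> depends.\<close>
    define w where "w = (\<chi> k. if k \<in> Y then 0 else (y - pmap F x0) $ k)"
    have "norm w \<le> norm (y - pmap F x0)" by (rule norm_le_componentwise_cart) (auto simp: w_def)
    then have w: "norm w < r" using y by (simp add: dist_norm norm_minus_commute)
    let ?x = "g (pmap F x0 + w)"
    have x: "?x \<in> zero_set P \<inter> U" using g(4)[OF w] by (simp add: w_def)
    then have "peval q ?x = 0" using q by (auto simp: vanishing_ideal_def)
    moreover have "peval (poly f q) ?x = 0" using f(3) x by (auto simp: zero_set_def)
    ultimately have "peval a ?x = 0" by (simp add: af)
    moreover have "peval a y = peval a ?x"
    proof (rule peval_cong)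
      show "a \<in> polys_in (-Y)" using f(1) by (simp add: af)
      fix k assume k: "k \<in> -Y"
      have "?x $ k = pmap F ?x $ k" using k by (simp add: pmap_def F_var)
      also have "\<dots> = (pmap F x0 + w) $ k" using g(3)[OF w] by simp
      also have "\<dots> = y $ k" using k by (simp add: w_def)
      finally show "y $ k = ?x $ k" by simp
    qed
    ultimately show "peval a y = 0" by simp
  qed
  then show False using f(2) by (simp add: af)
qed

end

section \<open>Manifolds and algebraic independence\<close>

lemma vanishing_ideal_antimono: "N \<subseteq> N' \<Longrightarrow> vanishing_ideal N' \<subseteq> vanishing_ideal N"
  by (auto simp: vanishing_ideal_def)

text \<open>Besides \<open>B\<close>, each \<open>H j\<close> involves only x_j, so the matrix is
  block triangular: identity on \<open>B\<close> and a diagonal block with entries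
  \<open>pd j (H j)\<close>.\<close>

lemma graph_jac_invertible:
  fixes H :: "'n::finite \<Rightarrow> 'n mpoly"
  assumes H: "\<And>j. j \<notin> B \<Longrightarrow> H j \<in> polys_in (insert j B)" "\<And>j. j \<notin> B \<Longrightarrow> peval (pd j (H j)) y \<noteq> 0"
  shows "invertible (jac (\<lambda>k. if k \<in> B then mvar k else H k) y)"
proof -
  define F where "F k = (if k \<in> B then mvar k else H k)" for k
  have "v = 0" if "jac F y *v v = 0" for v
  proof -
    have comp: "(\<Sum>l\<in>UNIV. peval (pd l (F k)) y * v $ l) = 0" for k
      using arg_cong[OF that, of "\<lambda>u. u $ k"] by (simp add: jac_def matrix_vector_mult_def)
    have vB: "v $ k = 0" if "k \<in> B" for k
    proof -
      have "(\<Sum>l\<in>UNIV. peval (pd l (F k)) y * v $ l) = (\<Sum>l\<in>UNIV. if l = k then v $ l else 0)"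
        using that by (intro sum.cong) (auto simp: F_def pd_mvar)
      then show ?thesis using comp[of k] by simp
    qed
    have "v $ k = 0" if "k \<notin> B" for k
    proof -
      have "(\<Sum>l\<in>UNIV. peval (pd l (F k)) y * v $ l) = (\<Sum>l\<in>UNIV. if l = k then peval (pd k (H k)) y * v $ l else 0)"
      proof (intro sum.cong refl)
        fix l
        show "peval (pd l (F k)) y * v $ l = (if l = k then peval (pd k (H k)) y * v $ l else 0)"
          using that vB[of l] pd_polys_in[OF H(1)[OF that], of l] by (cases "l \<in> B") (auto simp: F_def)
      qed
      then show ?thesis using comp[of k] H(2)[OF that] by simp
    qed
    with vB show ?thesis by (auto simp: vec_eq_iff)
  qed
  then show ?thesis unfolding F_def[symmetric, abs_def]
    using matrix_left_invertible_ker[of "jac F y"] invertible_left_inverse[of "jac F y"] by auto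
qed

text \<open>On a sufficiently small open piece \<open>N\<close> of \<open>M\<close> the independent sets of variables no longer
  change under shrinking. For a maximal one \<open>B\<close>, the other coordinates are locally functions of
  those in \<open>B\<close>, so the projection to the coordinates in \<open>B\<close> is injective near a point of \<open>N\<close>.\<close>

lemma manifold_alg_indep:
  fixes M :: "(real^'n::finite) set"
  assumes M: "M \<noteq> {}" "is_manifold e M"
  obtains B where "e \<le> card B" "alg_indep B (vanishing_ideal M)"
proof -
  define \<O> where "\<O> N \<longleftrightarrow> openin (top_of_set M) N \<and> N \<noteq> {}" for N
  define \<B> where "\<B> N = {B. alg_indep B (vanishing_ideal N)}" for N :: "(real^'n) set"
  have "\<O> M" using M(1) by (simp add: \<O>_def)
  \<comment> \<open>Shrinking a piece enlarges its vanishing ideal and can only lose independent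
    sets; a piece with the fewest of them is therefore stable.\<close>
  then obtain N0 where N0: "\<O> N0" "\<And>N. \<O> N \<Longrightarrow> card (\<B> N0) \<le> card (\<B> N)"
    using ex_has_least_nat[of \<O> M "\<lambda>N. card (\<B> N)"] by blast
  have same: "\<B> N = \<B> N0" if "\<O> N" "N \<subseteq> N0" for N
  proof (rule card_subset_eq)
    show "\<B> N \<subseteq> \<B> N0" unfolding \<B>_def using alg_indep_antimono vanishing_ideal_antimono[OF that(2)] by blast
    then show "card (\<B> N) = card (\<B> N0)" using N0(2)[OF that(1)] by (simp add: card_mono le_antisym)
  qed simp
  have "alg_indep {} (vanishing_ideal N0)"
    unfolding alg_indep_def
  proof (intro ballI impI)
    fix p :: "'n mpoly" assume p: "p \<in> polys_in {}" "p \<in> vanishing_ideal N0"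
    obtain a where "a \<in> N0" using N0(1) by (auto simp: \<O>_def)
    then have "peval p x = 0" for x using p peval_cong[OF p(1), of x a] by (auto simp: vanishing_ideal_def)
    then show "p = 0" by (rule peval_eq_0_imp)
  qed
  then obtain B where B: "max_indep B (vanishing_ideal N0)" using max_indep_extend by blast
  have ind: "alg_indep B (vanishing_ideal N)" if "\<O> N" "N \<subseteq> N0" for N
    using same[OF that] B by (auto simp: \<B>_def max_indep_def)
  have dep: "\<not> alg_indep (insert j B) (vanishing_ideal N)" if "\<O> N" "N \<subseteq> N0" "j \<notin> B" for N j
    using same[OF that(1,2)] B that(3) by (auto simp: \<B>_def max_indep_def)
  have step: "\<exists>N' H. \<O> N' \<and> N' \<subseteq> N \<and> H \<in> polys_in (insert j B) \<and> H \<in> vanishing_ideal N' \<and>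
      (\<forall>x\<in>N'. peval (pd j H) x \<noteq> 0)" if N: "\<O> N" "N \<subseteq> N0" and j: "j \<notin> B" for N j
  proof -
    \<comment> \<open>The least degree of a relation is taken over all smaller pieces at once. Then
      the derivative of the chosen relation vanishes identically on none of them, and shrinking once
      more makes it nonzero everywhere.\<close>
    define J where "J = \<Union>{vanishing_ideal N' | N'. \<O> N' \<and> N' \<subseteq> N}"
    have "alg_indep B J" using ind N(2) unfolding alg_indep_def J_def by blast
    moreover have "vanishing_ideal N \<subseteq> J" using N by (auto simp: J_def)
    then have "\<not> alg_indep (insert j B) J" using dep[OF N j] alg_indep_antimono by blast
    ultimately obtain h where h: "coeffs_in B h" "poly h (mvar j) \<in> J" "poly (formal_deriv h) (mvar j) \<notin> J"
      using minimal_relation[of B J j] by blast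
    define H where "H = poly h (mvar j)"
    obtain N1 where N1: "\<O> N1" "N1 \<subseteq> N" "H \<in> vanishing_ideal N1" using h(2) by (auto simp: J_def H_def)
    define N' where "N' = N1 \<inter> {x. peval (pd j H) x \<noteq> 0}"
    have "pd j H \<notin> J" using h(3) pd_poly_mvar[OF h(1) j] by (simp add: H_def)
    then have "pd j H \<notin> vanishing_ideal N1" using N1 by (auto simp: J_def)
    then have "N' \<noteq> {}" by (auto simp: N'_def vanishing_ideal_def)
    moreover have "open {x. peval (pd j H) x \<noteq> 0}"
      using continuous_on_peval[of UNIV "pd j H"] by (intro open_Collect_neq) auto
    then have "openin (top_of_set M) N'"
      using N1(1) unfolding N'_def \<O>_def by (simp add: openin_Int_open)
    ultimately have "\<O> N'" by (simp add: \<O>_def)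
    moreover have "H \<in> polys_in (insert j B)"
      unfolding H_def using h(1) by (intro polys_in_poly) (auto intro: coeffs_in_mono)
    moreover have "H \<in> vanishing_ideal N'" using N1(3) by (auto simp: N'_def vanishing_ideal_def)
    ultimately show ?thesis using N1(2) by (intro exI[of _ N'] exI[of _ H]) (auto simp: N'_def)
  qed
  have "\<exists>N H. \<O> N \<and> N \<subseteq> N0 \<and> (\<forall>j\<in>T. H j \<in> polys_in (insert j B) \<and> H j \<in> vanishing_ideal N \<and>
      (\<forall>x\<in>N. peval (pd j (H j)) x \<noteq> 0))" if "T \<subseteq> -B" for T
    using finite[of T] that
  proof (induction T rule: finite_induct)
    case empty
    then show ?case using N0(1) by blast
  next
    case (insert j T)
    then obtain N H where NH: "\<O> N" "N \<subseteq> N0" "\<forall>j\<in>T. H j \<in> polys_in (insert j B) \<and> H j \<in> vanishing_ideal N \<and>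
      (\<forall>x\<in>N. peval (pd j (H j)) x \<noteq> 0)" by blast
    then obtain N' H' where N': "\<O> N'" "N' \<subseteq> N" "H' \<in> polys_in (insert j B)" "H' \<in> vanishing_ideal N'"
      "\<forall>x\<in>N'. peval (pd j H') x \<noteq> 0" using step[of N j] insert by auto
    have "\<forall>i\<in>insert j T. (H(j := H')) i \<in> polys_in (insert i B) \<and> (H(j := H')) i \<in> vanishing_ideal N' \<and>
      (\<forall>x\<in>N'. peval (pd i ((H(j := H')) i)) x \<noteq> 0)"
      using NH(3) N' insert.hyps vanishing_ideal_antimono[OF N'(2)] by auto
    then show ?case using N'(1,2) NH(2) by (intro exI[of _ N'] exI[of _ "H(j := H')"]) auto
  qed
  from this[of "-B"] obtain N H where N: "\<O> N" "N \<subseteq> N0"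
    and H0: "\<forall>j\<in>-B. H j \<in> polys_in (insert j B) \<and> H j \<in> vanishing_ideal N \<and> (\<forall>x\<in>N. peval (pd j (H j)) x \<noteq> 0)"
    by auto
  then have H: "\<And>j. j \<notin> B \<Longrightarrow> H j \<in> polys_in (insert j B)" "\<And>j. j \<notin> B \<Longrightarrow> H j \<in> vanishing_ideal N"
      "\<And>j x. j \<notin> B \<Longrightarrow> x \<in> N \<Longrightarrow> peval (pd j (H j)) x \<noteq> 0" by blast+
  define F where "F k = (if k \<in> B then mvar k else H k)" for k
  obtain y where y: "y \<in> N" using N(1) by (auto simp: \<O>_def)
  have inv: "invertible (jac F y)"
    using graph_jac_invertible[OF H(1,3)] y unfolding F_def by blast
  obtain U' V g where U': "open U'" "y \<in> U'" "homeomorphism U' V (pmap F) g"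
    by (rule pmap_local_inverse[OF open_UNIV UNIV_I inv]) blast
  have "y \<in> M" using y N(1) openin_imp_subset by (auto simp: \<O>_def)
  then obtain V1 U1 L where V1: "y \<in> V1" "openin (top_of_set M) V1" "subspace (L :: (real^'n) set)" "dim L = e"
    "openin (top_of_set L) U1" "V1 homeomorphic U1"
    using M(2) unfolding is_manifold_def by blast
  then obtain \<phi> \<psi> where hom: "homeomorphism V1 U1 \<phi> \<psi>" by (auto simp: homeomorphic_def)
  define W where "W = V1 \<inter> (N \<inter> U')"
  have "openin (top_of_set M) W"
    using V1(2) N(1) U'(1) unfolding W_def \<O>_def by (intro openin_Int openin_Int_open) auto
  then have "openin (top_of_set V1) W"
    using openin_imp_subset[OF V1(2)] by (intro openin_subset_trans[of M W V1]) (auto simp: W_def)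
  then have "openin (top_of_set U1) (\<phi> ` W)" by (rule homeomorphism_imp_open_map[OF hom])
  then have op: "openin (top_of_set L) (\<phi> ` W)" using V1(5) openin_trans by blast
  have WV: "W \<subseteq> V1" by (auto simp: W_def)
  have \<psi>\<phi>: "\<psi> (\<phi> x) = x" if "x \<in> W" for x using hom WV that by (auto simp: homeomorphism_def)
  \<comment> \<open>A chart of \<open>M\<close> followed by \<open>pmap F\<close> is injective near
    \<open>y\<close> and lands in the coordinate subspace of \<open>B\<close>, because the
    components \<open>H k\<close> vanish on \<open>N\<close>.\<close>
  have "dim L \<le> dim {v :: real^'n. \<forall>k. k \<notin> B \<longrightarrow> v $ k = 0}"
  proof (rule invariance_of_dimension_subspaces[OF op V1(3) subspace_coords])
    have "continuous_on (\<phi> ` W) \<psi>"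
      using hom WV by (auto simp: homeomorphism_def intro: continuous_on_subset)
    then show "continuous_on (\<phi> ` W) (\<lambda>u. pmap F (\<psi> u))"
      by (rule continuous_on_compose2[OF continuous_on_pmap[of UNIV]]) auto
    show "(\<lambda>u. pmap F (\<psi> u)) \<in> \<phi> ` W \<rightarrow> {v. \<forall>k. k \<notin> B \<longrightarrow> v $ k = 0}"
    proof (intro funcsetI CollectI allI impI)
      fix u k assume "u \<in> \<phi> ` W" "k \<notin> B"
      then show "pmap F (\<psi> u) $ k = 0"
        using \<psi>\<phi> H(2)[of k] by (auto simp: pmap_def F_def W_def vanishing_ideal_def)
    qed
    have injF: "inj_on (pmap F) U'" using U'(3) by (intro inj_on_inverseI[of _ g]) (simp add: homeomorphism_def)
    show "inj_on (\<lambda>u. pmap F (\<psi> u)) (\<phi> ` W)"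
    proof (rule inj_onI)
      fix u u' assume "u \<in> \<phi> ` W" "u' \<in> \<phi> ` W" and eq: "pmap F (\<psi> u) = pmap F (\<psi> u')"
      then obtain x x' where x: "x \<in> W" "x' \<in> W" "u = \<phi> x" "u' = \<phi> x'" by blast
      then have "x = x'" using eq \<psi>\<phi> inj_onD[OF injF, of x x'] by (auto simp: W_def)
      then show "u = u'" using x by simp
    qed
    show "\<phi> ` W \<noteq> {}" using y U'(2) V1(1) by (auto simp: W_def)
  qed
  then have "e \<le> card B" using V1(4) by (simp add: dim_coords)
  moreover have "N0 \<subseteq> M" using N0(1) openin_imp_subset unfolding \<O>_def by blast
  then have "alg_indep B (vanishing_ideal M)"
    using B alg_indep_antimono[OF _ vanishing_ideal_antimono[of N0 M]] by (simp add: max_indep_def)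
  ultimately show ?thesis using that by blast
qed

section \<open>The equivalences for a prime ideal\<close>

lemma row_jac: "row k (jac F x) = pgrad (F k) x"
  by (simp add: row_def jac_def pgrad_eq vec_eq_iff)

lemma pgrad_mvar: "pgrad (mvar k) x = axis k 1"
  by (auto simp: pgrad_eq pd_mvar vec_eq_iff axis_def)

lemma invertible_iff_span_rows: "invertible (A :: real^'n^'n) \<longleftrightarrow> span (rows A) = UNIV"
  using invertible_left_inverse[of A] matrix_left_invertible_span_rows[of A] by simp

lemma jacobian_rank_chart:
  fixes x :: "real^'n::finite"
  obtains Y F where "card Y = jacobian_rank gs x" "\<And>j. j \<in> Y \<Longrightarrow> F j \<in> set gs"
    "\<And>j. j \<notin> Y \<Longrightarrow> F j = mvar j" "invertible (jac F x)"
proof -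
  define S where "S = (\<lambda>f. pgrad f x) ` set gs"
  define A where "A = range (\<lambda>k. axis k (1::real) :: real^'n)"
  have inj: "inj (\<lambda>k. axis k (1::real) :: real^'n)" by (auto simp: inj_def axis_eq_axis)
  obtain S0 where S0: "S0 \<subseteq> S" "independent S0" "S \<subseteq> span S0" "card S0 = dim S"
    using basis_exists[of S] by blast
  obtain T where T: "S0 \<subseteq> T" "T \<subseteq> S0 \<union> A" "independent T" "S0 \<union> A \<subseteq> span T"
    using maximal_independent_subset_extend[of S0 "S0 \<union> A"] S0(2) by blast
  have "Basis \<subseteq> A" by (auto simp: A_def Basis_vec_def)
  then have "span A = UNIV" by (metis span_Basis span_mono top.extremum_uniqueI)
  moreover have "span A \<subseteq> span T" using T(4) by (intro span_minimal) auto
  ultimately have spanT: "span T = UNIV" by blast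
  have finT: "finite T" using T(3) by (rule independent_imp_finite)
  have cardT: "card T = CARD('n)"
    using dim_eq_card_independent[OF T(3)] dim_span[of T] spanT by simp
  \<comment> \<open>Removing \<open>S0\<close> matters: a gradient may itself be a unit vector, and
    then its index belongs to \<open>Y\<close>.\<close>
  define Y where "Y = {k. axis k 1 \<notin> T - S0}"
  have "(\<lambda>k. axis k 1) ` (-Y) = T - S0" using T(2) by (auto simp: Y_def A_def)
  then have "card (-Y) = card (T - S0)" using card_image[of "\<lambda>k. axis k 1 :: real^'n" "-Y"] inj
    by (metis inj_on_subset subset_UNIV)
  also have "\<dots> = card T - card S0" using T(1) finT by (simp add: card_Diff_subset finite_subset)
  finally have "card Y = card S0"
    using card_plus_card_Compl[of Y] cardT card_mono[OF finT T(1)] by simp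
  then obtain \<sigma> where \<sigma>: "bij_betw \<sigma> Y S0"
    using finite_same_card_bij[of Y S0] finite_subset[OF T(1) finT] by auto
  have "\<forall>j\<in>Y. \<exists>f\<in>set gs. pgrad f x = \<sigma> j" using \<sigma> S0(1) by (force simp: S_def bij_betw_def)
  then obtain F0 where F0: "\<And>j. j \<in> Y \<Longrightarrow> F0 j \<in> set gs" "\<And>j. j \<in> Y \<Longrightarrow> pgrad (F0 j) x = \<sigma> j" by metis
  define F where "F j = (if j \<in> Y then F0 j else mvar j)" for j
  have "T \<subseteq> rows (jac F x)"
  proof
    fix v assume v: "v \<in> T"
    show "v \<in> rows (jac F x)"
    proof (cases "v \<in> S0")
      case True
      then obtain j where "j \<in> Y" "v = \<sigma> j" using \<sigma> by (auto simp: bij_betw_def)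
      then have "v = row j (jac F x)" using F0 by (simp add: row_jac F_def)
      then show ?thesis by (auto simp: rows_def)
    next
      case False
      then obtain k where k: "v = axis k 1" "k \<notin> Y" using T(2) v by (auto simp: A_def Y_def)
      then have "v = row k (jac F x)" by (simp add: row_jac F_def pgrad_mvar)
      then show ?thesis by (auto simp: rows_def)
    qed
  qed
  then have "span (rows (jac F x)) = UNIV" using span_mono spanT by blast
  then have "invertible (jac F x)" by (simp add: invertible_iff_span_rows)
  moreover have "card Y = jacobian_rank gs x"
    using \<open>card Y = card S0\<close> S0(4) by (simp add: jacobian_rank_def S_def dim_span)
  ultimately show ?thesis using that[of Y F] F0 by (auto simp: F_def)
qed

lemma jacobian_chart_at:
  fixes P :: "'n::finite mpoly set"
  assumes P: "prime_ideal P" "ideal_gen (set gs) = P" and x: "x \<in> zero_set P"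
  obtains Y F where "card Y = jacobian_rank gs x" "jacobian_chart P Y F" "peval (jacobian_chart.\<Delta> F) x \<noteq> 0"
proof -
  obtain Y F where YF: "card Y = jacobian_rank gs x" "\<And>j. j \<in> Y \<Longrightarrow> F j \<in> set gs"
    "\<And>j. j \<notin> Y \<Longrightarrow> F j = mvar j" "invertible (jac F x)"
    using jacobian_rank_chart[of gs x] by blast
  let ?D = "det ((\<chi> k l. pd l (F k)) :: 'n mpoly^'n^'n)"
  have nz: "peval ?D x \<noteq> 0" using YF(4) by (simp add: peval_det invertible_det_nz)
  then have "?D \<notin> P" using x by (auto simp: zero_set_def)
  then have chart: "jacobian_chart P Y F"
    using P YF ideal_gen_superset[of "set gs"] by unfold_locales auto
  then show ?thesis using that[OF YF(1) chart] nz by (simp add: jacobian_chart.\<Delta>_def[OF chart])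
qed

lemma jacobian_rank_le:
  fixes P :: "'n::finite mpoly set"
  assumes "prime_ideal P" "ideal_gen (set gs) = P" "x \<in> zero_set P"
  shows "jacobian_rank gs x + tr_deg P \<le> CARD('n)"
  using jacobian_chart_at[OF assms] jacobian_chart.tr_deg_bound by metis

text \<open>At a zero of \<open>P\<close> the product rule loses one term, so the elements of
  \<open>P\<close> with gradient in the span form an ideal. Hence the rank does not depend on the
  choice of generators.\<close>

lemma pgrad_in_span:
  assumes "ideal_gen (set gs) = P" "x \<in> zero_set P" "p \<in> P"
  shows "pgrad p x \<in> span ((\<lambda>f. pgrad f x) ` set gs)"
proof -
  let ?V = "span ((\<lambda>f. pgrad f x) ` set gs)"
  let ?J = "{p \<in> P. pgrad p x \<in> ?V}"
  have I: "is_ideal P" using ideal_gen_is_ideal assms(1) by auto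
  have add: "pgrad (p + q) x = pgrad p x + pgrad q x" for p q
    by (simp add: pgrad_eq pd_add vec_eq_iff)
  have mult: "pgrad (r * p) x = peval r x *\<^sub>R pgrad p x" if "p \<in> P" for r p
    using that assms(2) by (simp add: pgrad_eq pd_mult vec_eq_iff zero_set_def)
  have "is_ideal ?J"
    unfolding is_ideal_def
  proof (intro conjI ballI allI)
    show "0 \<in> ?J" using mult[OF ideal_0[OF I], of 0] ideal_0[OF I] by (simp add: span_zero)
  next
    fix a b assume "a \<in> ?J" "b \<in> ?J"
    then show "a + b \<in> ?J" using ideal_add[OF I] by (auto simp: add intro: span_add)
  next
    fix a r assume "a \<in> ?J"
    then show "r * a \<in> ?J" using ideal_mult_left[OF I] by (auto simp: mult intro: span_scale)
  qed
  moreover have "set gs \<subseteq> ?J" using ideal_gen_superset[of "set gs"] assms(1) by (auto intro: span_base)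
  ultimately show ?thesis using ideal_gen_least[of ?J "set gs"] assms(1,3) by blast
qed

text \<open>Where \<delta> is nonzero, the gradients of the \<open>H k\<close> and the unit vectors
  of \<open>B\<close> span the whole space; the former lie in the span of the gradients of the
  generators.\<close>

lemma (in relations) jacobian_rank_ge:
  assumes "ideal_gen (set gs) = P" "x \<in> zero_set P" "peval \<delta> x \<noteq> 0"
  shows "CARD('n) \<le> jacobian_rank gs x + card B"
proof -
  let ?F = "\<lambda>k. if k \<in> B then mvar k else H k"
  let ?S = "(\<lambda>f. pgrad f x) ` set gs"
  have "peval (dd j) x \<noteq> 0" if "j \<notin> B" for j
    using assms(3) that by (auto simp: \<delta>_def)
  then have "invertible (jac ?F x)"
    using H_in by (intro graph_jac_invertible) (auto simp: dd_def)
  then have span: "span (rows (jac ?F x)) = UNIV" by (simp add: invertible_iff_span_rows)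
  obtain S0 where S0: "S0 \<subseteq> ?S" "independent S0" "?S \<subseteq> span S0" "card S0 = dim ?S"
    using basis_exists[of ?S] by blast
  let ?T = "S0 \<union> (\<lambda>k. axis k 1) ` B"
  have "pgrad (?F k) x \<in> span ?T" for k
  proof (cases "k \<in> B")
    case True
    then show ?thesis by (auto simp: pgrad_mvar intro: span_base)
  next
    case False
    then have "H k \<in> P" using h_rel by (simp add: H_def)
    then have "pgrad (H k) x \<in> span ?S" using pgrad_in_span assms by blast
    moreover have "span ?S \<subseteq> span S0" using S0(3) by (intro span_minimal) auto
    moreover have "span S0 \<subseteq> span ?T" by (intro span_mono) auto
    ultimately show ?thesis using False by auto
  qed
  then have "row k (jac ?F x) \<in> span ?T" for k by (simp only: row_jac)
  then have "rows (jac ?F x) \<subseteq> span ?T" unfolding rows_def by blast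
  then have "span (rows (jac ?F x)) \<subseteq> span ?T" by (intro span_minimal) auto
  then have "(UNIV :: (real^'n) set) \<subseteq> span ?T" by (simp only: span)
  moreover have "finite ?T" using finite_subset[OF S0(1)] by auto
  ultimately have "dim (UNIV :: (real^'n) set) \<le> card ?T" by (rule dim_le_card)
  also have "\<dots> \<le> card S0 + card ((\<lambda>k. axis k 1 :: real^'n) ` B)" by (rule card_Un_le)
  also have "\<dots> \<le> card S0 + card B" by (simp add: card_image_le)
  finally show ?thesis using S0(4) by (simp add: jacobian_rank_def dim_span)
qed

text \<open>The common end of two arguments: \<open>A\<close> is the open part of the zero set in
  \<open>vanishing_imp_rank\<close> and a manifold in \<open>dim_top_imp_rank\<close>. The one
  polynomial tested by \<open>meets\<close> is \<delta>.\<close>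

lemma jacobian_rank_eq_exists:
  fixes P :: "'n::finite mpoly set"
  assumes P: "prime_ideal P" "ideal_gen (set gs) = P"
    and A: "A \<subseteq> zero_set P" and B: "alg_indep B P" "card B = tr_deg P"
    and meets: "\<And>q. q \<notin> P \<Longrightarrow> \<exists>x\<in>A. peval q x \<noteq> 0"
  shows "\<exists>x\<in>A. jacobian_rank gs x + tr_deg P = CARD('n)"
proof -
  obtain h where "relations P B h" using relations_exist[OF P(1) max_indep_if_card[OF B]] .
  then interpret relations P B h .
  obtain x where x: "x \<in> A" "peval \<delta> x \<noteq> 0" using meets[OF \<delta>_notin] by blast
  have "CARD('n) \<le> jacobian_rank gs x + tr_deg P"
    using jacobian_rank_ge[OF P(2)] x A B(2) by auto
  moreover have "jacobian_rank gs x + tr_deg P \<le> CARD('n)"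
    using jacobian_rank_le[OF P] x A by auto
  ultimately show ?thesis using x(1) by (intro bexI[of _ x]) auto
qed

section \<open>Topological dimension of subsets of the zero set\<close>

lemma manifold_dim_le_tr_deg:
  fixes P :: "'n::finite mpoly set"
  assumes "M \<noteq> {}" "is_manifold e M" "M \<subseteq> zero_set P"
  shows "e \<le> tr_deg P"
proof -
  obtain B where B: "e \<le> card B" "alg_indep B (vanishing_ideal M)" using manifold_alg_indep[OF assms(1,2)] .
  have "P \<subseteq> vanishing_ideal M" using assms(3) by (auto simp: vanishing_ideal_def zero_set_def)
  then have "alg_indep B P" using B(2) alg_indep_antimono by blast
  then show ?thesis using tr_deg_ge B(1) le_trans by blast
qed

lemma is_manifold_point: "is_manifold 0 {a :: real^'n::finite}"
proof -
  have "homeomorphism {a} {0 :: real^'n} (\<lambda>_. 0) (\<lambda>_. a)" by (auto simp: homeomorphism_def)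
  then have "{a} homeomorphic {0 :: real^'n}" by (auto simp: homeomorphic_def)
  then show ?thesis unfolding is_manifold_def
    by (intro ballI exI[of _ "{a}"] exI[of _ "{0}"] exI[of _ "{0}"]) (auto simp: subspace_single_0)
qed

text \<open>For nonempty \<open>A\<close>, points give dimension 0 and \<open>tr_deg P\<close>
  bounds all dimensions, so the supremum is attained. For empty \<open>A\<close> the value -1 is
  never a transcendence degree.\<close>

lemma dim_top_eq_tr_deg_iff:
  fixes P :: "'n::finite mpoly set"
  assumes "A \<subseteq> zero_set P"
  shows "dim_top A = int (tr_deg P) \<longleftrightarrow> (\<exists>M. M \<subseteq> A \<and> M \<noteq> {} \<and> is_manifold (tr_deg P) M)"
proof (cases "A = {}")
  case True
  then show ?thesis by (simp add: dim_top_def)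
next
  case False
  let ?D = "{d. \<exists>M. M \<subseteq> A \<and> M \<noteq> {} \<and> is_manifold d M}"
  have le: "d \<le> tr_deg P" if "d \<in> ?D" for d using that manifold_dim_le_tr_deg assms by blast
  obtain a where "a \<in> A" using False by blast
  then have "0 \<in> ?D" using is_manifold_point[of a] by blast
  moreover have "finite ?D" using le by (meson atMost_iff finite_atMost finite_subset subsetI)
  ultimately have "Sup ?D \<in> ?D" by (metis (no_types, lifting) Max_in Sup_nat_def empty_iff)
  moreover have "Sup ?D = tr_deg P" if "tr_deg P \<in> ?D"
    by (rule cSup_eq_maximum[OF that le])
  ultimately have "Sup ?D = tr_deg P \<longleftrightarrow> tr_deg P \<in> ?D" by auto
  then show ?thesis using False by (simp add: dim_top_def)
qed

lemma full_rank_imp: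
  fixes P :: "'n::finite mpoly set"
  assumes P: "prime_ideal P" "ideal_gen (set gs) = P" and U: "open U"
    and x: "x \<in> zero_set P \<inter> U" "jacobian_rank gs x + tr_deg P = CARD('n)"
  shows "vanishing_ideal (zero_set P \<inter> U) \<subseteq> P" "dim_top (zero_set P \<inter> U) = int (tr_deg P)"
proof -
  obtain Y F where YF: "card Y = jacobian_rank gs x" "jacobian_chart P Y F" "peval (jacobian_chart.\<Delta> F) x \<noteq> 0"
    using jacobian_chart_at[OF P] x(1) by blast
  interpret jacobian_chart P Y F by (rule YF(2))
  have *: "finite (set gs)" "P = ideal_gen (set gs)" "card Y + tr_deg P = CARD('n)" "x \<in> zero_set P"
    "peval \<Delta> x \<noteq> 0" "open U" "x \<in> U"
    using P YF x U by auto
  show "vanishing_ideal (zero_set P \<inter> U) \<subseteq> P" using chart_vanishing[OF *] by blast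
  show "dim_top (zero_set P \<inter> U) = int (tr_deg P)"
    using chart_manifold[OF *] by (subst dim_top_eq_tr_deg_iff) auto
qed

lemma vanishing_imp_rank:
  fixes P :: "'n::finite mpoly set"
  assumes P: "prime_ideal P" "ideal_gen (set gs) = P"
    and van: "vanishing_ideal (zero_set P \<inter> U) \<subseteq> P"
  shows "\<exists>x\<in>zero_set P \<inter> U. jacobian_rank gs x + tr_deg P = CARD('n)"
proof -
  obtain B where "alg_indep B P" "card B = tr_deg P" using tr_deg_attained[OF P(1)] .
  moreover have "\<exists>x\<in>zero_set P \<inter> U. peval q x \<noteq> 0" if "q \<notin> P" for q
    using that van by (auto simp: vanishing_ideal_def)
  ultimately show ?thesis using jacobian_rank_eq_exists[OF P, of "zero_set P \<inter> U" B] by blast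
qed

lemma dim_top_imp_rank:
  fixes P :: "'n::finite mpoly set"
  assumes P: "prime_ideal P" "ideal_gen (set gs) = P"
    and dim: "dim_top (zero_set P \<inter> U) = int (tr_deg P)"
  shows "\<exists>x\<in>zero_set P \<inter> U. jacobian_rank gs x + tr_deg P = CARD('n)"
proof -
  obtain M where M: "M \<subseteq> zero_set P \<inter> U" "M \<noteq> {}" "is_manifold (tr_deg P) M"
    using dim dim_top_eq_tr_deg_iff[of "zero_set P \<inter> U" P] by auto
  obtain B where B: "tr_deg P \<le> card B" "alg_indep B (vanishing_ideal M)"
    using manifold_alg_indep[OF M(2,3)] .
  have PM: "P \<subseteq> vanishing_ideal M" using M(1) by (auto simp: vanishing_ideal_def zero_set_def)
  then have BP: "alg_indep B P" using B(2) alg_indep_antimono by blast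
  then have card: "card B = tr_deg P" using tr_deg_ge[of B P] B(1) by simp
  \<comment> \<open>If \<open>q\<close> vanished on \<open>M\<close>, so would the constant term of
    its relation over \<real>[B], against the independence of \<open>B\<close> on \<open>M\<close>
    itself.\<close>
  have "\<exists>x\<in>M. peval q x \<noteq> 0" if q: "q \<notin> P" for q
  proof (rule ccontr)
    assume neg: "\<not> ?thesis"
    obtain g where g: "coeffs_in B g" "coeff g 0 \<noteq> 0" "poly g q \<in> P"
      using algebraic_mod_prime[OF P(1) max_indep_if_card[OF BP card] q] .
    obtain a g' where ag: "g = pCons a g'" by (cases g) auto
    have "peval a x = 0" if "x \<in> M" for x
      using neg that g(3) PM by (force simp: ag vanishing_ideal_def)
    then have "a = 0" using alg_indepD[OF B(2), of a] g(1) by (simp add: ag vanishing_ideal_def)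
    then show False using g(2) by (simp add: ag)
  qed
  then have "\<exists>x\<in>M. jacobian_rank gs x + tr_deg P = CARD('n)"
    using M(1) by (intro jacobian_rank_eq_exists[OF P _ BP card]) auto
  then show ?thesis using M(1) by blast
qed

section \<open>Prime decompositions\<close>

lemma vanishing_ideal_is_ideal: "is_ideal (vanishing_ideal A)"
  by (auto simp: is_ideal_def vanishing_ideal_def)

lemma ideal_prod_member:
  assumes "is_ideal J" "finite A" "s \<in> A" "f s \<in> J"
  shows "prod f A \<in> J"
  using assms by (simp add: prod.remove ideal_mult_right)

lemma zero_set_decomposition:
  assumes "prime_decomposition I k Is"
  shows "zero_set I = (\<Union>t\<in>{1..k}. zero_set (Is t))"
proof (intro equalityI subsetI)
  fix x assume x: "x \<in> zero_set I"
  show "x \<in> (\<Union>t\<in>{1..k}. zero_set (Is t))"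
  proof (rule ccontr)
    assume "\<not> ?thesis"
    then have "\<forall>t\<in>{1..k}. \<exists>p\<in>Is t. peval p x \<noteq> 0" by (auto simp: zero_set_def)
    then obtain p where p: "\<And>t. t \<in> {1..k} \<Longrightarrow> p t \<in> Is t" "\<And>t. t \<in> {1..k} \<Longrightarrow> peval (p t) x \<noteq> 0" by metis
    have "prod p {1..k} \<in> Is t" if "t \<in> {1..k}" for t
      using assms p that by (intro ideal_prod_member[of _ _ t]) (auto simp: prime_decomposition_def prime_ideal_def)
    then have "prod p {1..k} \<in> I" using assms by (auto simp: prime_decomposition_def)
    then have "peval (prod p {1..k}) x = 0" using x by (auto simp: zero_set_def)
    then show False using p(2) by auto
  qed
next
  fix x assume "x \<in> (\<Union>t\<in>{1..k}. zero_set (Is t))"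
  then show "x \<in> zero_set I" using assms by (auto simp: zero_set_def prime_decomposition_def)
qed

text \<open>If the intersection of the \<open>J s\<close> equals \<open>I\<close>, primality of
  \<open>Is t\<close> puts some \<open>J s\<close> inside \<open>Is t\<close>. Since
  \<open>Is s\<close> is contained in \<open>J s\<close>, irredundance forces
  \<open>s = t\<close>.\<close>

lemma vanishing_ideal_decomposition:
  assumes dec: "prime_decomposition I k Is"
  shows "vanishing_ideal (U \<inter> zero_set I) = I \<longleftrightarrow>
    (\<forall>t\<in>{1..k}. vanishing_ideal (zero_set (Is t) \<inter> U) \<subseteq> Is t)"
proof -
  have I: "I = (\<Inter>t\<in>{1..k}. Is t)" and prime: "\<And>t. t \<in> {1..k} \<Longrightarrow> prime_ideal (Is t)"
    and irr: "\<And>t. t \<in> {1..k} \<Longrightarrow> (\<Inter>s\<in>{1..k} - {t}. Is s) \<noteq> I"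
    using dec by (auto simp: prime_decomposition_def)
  define J where "J t = vanishing_ideal (zero_set (Is t) \<inter> U)" for t
  have van: "vanishing_ideal (U \<inter> zero_set I) = (\<Inter>t\<in>{1..k}. J t)"
    unfolding zero_set_decomposition[OF dec] J_def by (auto simp: vanishing_ideal_def)
  have sub: "Is t \<subseteq> J t" for t by (auto simp: J_def vanishing_ideal_def zero_set_def)
  show ?thesis
  proof
    assume eq: "vanishing_ideal (U \<inter> zero_set I) = I"
    have "J t \<subseteq> Is t" if t: "t \<in> {1..k}" for t
    proof -
      have "\<exists>s\<in>{1..k}. J s \<subseteq> Is t"
      proof (rule ccontr)
        assume "\<not> ?thesis"
        then have "\<forall>s\<in>{1..k}. \<exists>p. p \<in> J s \<and> p \<notin> Is t" by blast
        then obtain p where p: "\<And>s. s \<in> {1..k} \<Longrightarrow> p s \<in> J s" "\<And>s. s \<in> {1..k} \<Longrightarrow> p s \<notin> Is t" by metis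
        have "prod p {1..k} \<in> J s" if "s \<in> {1..k}" for s
          using p that vanishing_ideal_is_ideal by (intro ideal_prod_member[of _ _ s]) (auto simp: J_def)
        then have "prod p {1..k} \<in> I" using van eq by auto
        then have "prod p {1..k} \<in> Is t" using I t by auto
        then show False using prime_ideal_prod[OF _ prime[OF t], of "{1..k}" p] p(2) by auto
      qed
      then obtain s where s: "s \<in> {1..k}" "J s \<subseteq> Is t" by blast
      have "s = t"
      proof (rule ccontr)
        assume "s \<noteq> t"
        then have "(\<Inter>r\<in>{1..k} - {t}. Is r) \<subseteq> Is s" using s(1) by auto
        also have "\<dots> \<subseteq> Is t" using sub s(2) by blast
        finally have "(\<Inter>r\<in>{1..k} - {t}. Is r) = I" using I by auto
        then show False using irr[OF t] by blast
      qed
      then show ?thesis using s(2) by simp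
    qed
    then show "\<forall>t\<in>{1..k}. vanishing_ideal (zero_set (Is t) \<inter> U) \<subseteq> Is t" by (simp add: J_def)
  next
    assume "\<forall>t\<in>{1..k}. vanishing_ideal (zero_set (Is t) \<inter> U) \<subseteq> Is t"
    then have "J t = Is t" if "t \<in> {1..k}" for t using that sub by (auto simp: J_def)
    then have "(\<Inter>t\<in>{1..k}. J t) = (\<Inter>t\<in>{1..k}. Is t)" by auto
    then show "vanishing_ideal (U \<inter> zero_set I) = I" using van I by argo
  qed
qed

theorem theorem3p13:
  fixes S :: "(real^'n::finite) set"
    and I :: "'n mpoly set"
    and k :: nat
    and Is :: "nat \<Rightarrow> 'n mpoly set"
    and gens :: "nat \<Rightarrow> 'n mpoly list"
  assumes "semialgebraic S"
    and "is_ideal I"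
    and "prime_decomposition I k Is"
    and "\<forall>t\<in>{1..k}. ideal_gen (set (gens t)) = Is t"
    and "interior S \<inter> zero_set I \<noteq> {}"
  shows "(vanishing_ideal (interior S \<inter> zero_set I) = I \<longleftrightarrow>
           (\<forall>t\<in>{1..k}. \<exists>x\<in>zero_set (Is t) \<inter> interior S.
               int (jacobian_rank (gens t) x) = int CARD('n) - int (krull_dim (Is t))))
       \<and> (vanishing_ideal (interior S \<inter> zero_set I) = I \<longleftrightarrow>
           (\<forall>t\<in>{1..k}. dim_top (zero_set (Is t) \<inter> interior S) = int (krull_dim (Is t))))"
proof -
  have prime: "prime_ideal (Is t)" and gens: "ideal_gen (set (gens t)) = Is t" if "t \<in> {1..k}" for t
    using assms(3,4) that by (auto simp: prime_decomposition_def)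
  have krull: "krull_dim (Is t) = tr_deg (Is t)" if "t \<in> {1..k}" for t
    using krull_dim_eq_tr_deg[OF prime[OF that]] .
  \<comment> \<open>For each component, the rank and dimension conditions are both compared with the
    vanishing condition into which (i) splits.\<close>
  have rank: "vanishing_ideal (zero_set (Is t) \<inter> interior S) \<subseteq> Is t \<longleftrightarrow>
      (\<exists>x\<in>zero_set (Is t) \<inter> interior S. int (jacobian_rank (gens t) x) = int CARD('n) - int (krull_dim (Is t)))"
    if t: "t \<in> {1..k}" for t
  proof -
    have eq: "int (jacobian_rank (gens t) x) = int CARD('n) - int (krull_dim (Is t)) \<longleftrightarrow>
        jacobian_rank (gens t) x + tr_deg (Is t) = CARD('n)" for x
      using krull[OF t] by linarith
    show ?thesis
      unfolding eq using vanishing_imp_rank[OF prime[OF t] gens[OF t], of "interior S"]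
        full_rank_imp(1)[OF prime[OF t] gens[OF t] open_interior[of S]] by blast
  qed
  have dim: "vanishing_ideal (zero_set (Is t) \<inter> interior S) \<subseteq> Is t \<longleftrightarrow>
      dim_top (zero_set (Is t) \<inter> interior S) = int (krull_dim (Is t))" if t: "t \<in> {1..k}" for t
    using vanishing_imp_rank[OF prime[OF t] gens[OF t], of "interior S"]
      dim_top_imp_rank[OF prime[OF t] gens[OF t], of "interior S"]
      full_rank_imp[OF prime[OF t] gens[OF t] open_interior[of S]]
    unfolding krull[OF t] by blast
  show ?thesis
    unfolding vanishing_ideal_decomposition[OF assms(3)] using rank dim by blast
qed

end
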